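(* The following assertions are equivalent for a coalgebra $C$ over a field $K$: (i) $C$ is a right chain coalgebra. (ii) $C_{n+1}/C_n$ is either $0$ or a simple right $C$-comodule for all $n\geq -1$. (iii) $C$ is a left chain coalgebra. In this case, $C$ and the $C_n$, $n\geq -1$, are the only subcomodules (left, right, or two-sided) of $C$, and $C_n$ is finite dimensional for all $n$.
   Context: A coalgebra $C$ is called a left (respectively right) chain coalgebra if the lattice of left (respectively right) subcomodules of $C$ is a chain, i.e. for any two left (respectively right) subcomodules $M,N$ of $C$ either $M\subseteq N$ or $N\subseteq M$. The coradical filtration $C_0\subseteq C_1\subseteq C_2\subseteq\cdots$ of $C$ is defined by: $C_0$ is the coradical (the sum of all simple subcomodules of $C$), and $C_{n+1}\supseteq C_n$ is such that $C_{n+1}/C_n$ is the socle of the right (equivalently, left) $C$-comodule $C/C_n$; put $C_{-1}=0$. Each $C_n$ is a subcoalgebra and $\bigcup_n C_n=C$. *)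

theory Defs
  imports "HOL-Algebra.AbelCoset" "Jordan_Normal_Form.Missing_VectorSpace"
begin

section \<open>Quotients and tensor products of vector spaces\<close>

text \<open>Vector spaces are \<^const>\<open>vectorspace\<close> records with explicit carriers. The fields
  \<^term>\<open>mult\<close> and \<^term>\<open>one\<close>, which the record type of modules inherits from rings, carry no
  information and are filled arbitrarily.\<close>

definition quot_mod ::
    "('k, 'r) ring_scheme \<Rightarrow> ('k, 'v, 'm) module_scheme \<Rightarrow> 'v set \<Rightarrow> ('k, 'v set) module" where
  "quot_mod K V N =
    \<lparr>carrier = a_rcosets\<^bsub>V\<^esub> N, mult = (\<lambda>X Y. N), one = N, zero = N, add = set_add V,
     smult = (\<lambda>a X. \<Union>x\<in>X. N +>\<^bsub>V\<^esub> (a \<odot>\<^bsub>V\<^esub> x))\<rparr>"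

definition scalars :: "('k, 'r) ring_scheme \<Rightarrow> ('k, 'k) module" where
  "scalars K =
    \<lparr>carrier = carrier K, mult = mult K, one = one K, zero = zero K, add = add K,
     smult = mult K\<rparr>"

definition free_mod :: "('k, 'r) ring_scheme \<Rightarrow> 's set \<Rightarrow> ('k, 's \<Rightarrow> 'k) module" where
  "free_mod K S =
    \<lparr>carrier = {f. (\<forall>s. f s \<in> carrier K) \<and> (\<forall>s. s \<notin> S \<longrightarrow> f s = \<zero>\<^bsub>K\<^esub>) \<and> finite {s. f s \<noteq> \<zero>\<^bsub>K\<^esub>}},
     mult = (\<lambda>f g s. \<zero>\<^bsub>K\<^esub>), one = (\<lambda>s. \<zero>\<^bsub>K\<^esub>), zero = (\<lambda>s. \<zero>\<^bsub>K\<^esub>),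
     add = (\<lambda>f g s. f s \<oplus>\<^bsub>K\<^esub> g s), smult = (\<lambda>a f s. a \<otimes>\<^bsub>K\<^esub> f s)\<rparr>"

definition free_gen :: "('k, 'r) ring_scheme \<Rightarrow> 's \<Rightarrow> 's \<Rightarrow> 'k" where
  "free_gen K s = (\<lambda>t. if t = s then \<one>\<^bsub>K\<^esub> else \<zero>\<^bsub>K\<^esub>)"

definition free_lift ::
    "('k, 'r) ring_scheme \<Rightarrow> ('k, 'p, 'm) module_scheme \<Rightarrow> ('s \<Rightarrow> 'p) \<Rightarrow> ('s \<Rightarrow> 'k) \<Rightarrow> 'p" where
  "free_lift K P g f = (\<Oplus>\<^bsub>P\<^esub> s\<in>{s. f s \<noteq> \<zero>\<^bsub>K\<^esub>}. f s \<odot>\<^bsub>P\<^esub> g s)"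

definition tensor_relators ::
    "('k, 'r) ring_scheme \<Rightarrow> ('k, 'v, 'm) module_scheme \<Rightarrow> ('k, 'w, 'n) module_scheme
      \<Rightarrow> ('v \<times> 'w \<Rightarrow> 'k) set" where
  "tensor_relators K V W =
    (let F = free_mod K (carrier V \<times> carrier W); g = (\<lambda>v w. free_gen K (v, w)) in
      {g (v \<oplus>\<^bsub>V\<^esub> v') w \<ominus>\<^bsub>F\<^esub> (g v w \<oplus>\<^bsub>F\<^esub> g v' w) | v v' w.
          v \<in> carrier V \<and> v' \<in> carrier V \<and> w \<in> carrier W}
    \<union> {g v (w \<oplus>\<^bsub>W\<^esub> w') \<ominus>\<^bsub>F\<^esub> (g v w \<oplus>\<^bsub>F\<^esub> g v w') | v w w'.
          v \<in> carrier V \<and> w \<in> carrier W \<and> w' \<in> carrier W}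
    \<union> {g (a \<odot>\<^bsub>V\<^esub> v) w \<ominus>\<^bsub>F\<^esub> a \<odot>\<^bsub>F\<^esub> g v w | a v w.
          a \<in> carrier K \<and> v \<in> carrier V \<and> w \<in> carrier W}
    \<union> {g v (a \<odot>\<^bsub>W\<^esub> w) \<ominus>\<^bsub>F\<^esub> a \<odot>\<^bsub>F\<^esub> g v w | a v w.
          a \<in> carrier K \<and> v \<in> carrier V \<and> w \<in> carrier W})"

definition tensor_null ::
    "('k, 'r) ring_scheme \<Rightarrow> ('k, 'v, 'm) module_scheme \<Rightarrow> ('k, 'w, 'n) module_scheme
      \<Rightarrow> ('v \<times> 'w \<Rightarrow> 'k) set" where
  "tensor_null K V W =
    module.span K (free_mod K (carrier V \<times> carrier W)) (tensor_relators K V W)"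

definition tensor ::
    "('k, 'r) ring_scheme \<Rightarrow> ('k, 'v, 'm) module_scheme \<Rightarrow> ('k, 'w, 'n) module_scheme
      \<Rightarrow> ('k, ('v \<times> 'w \<Rightarrow> 'k) set) module" where
  "tensor K V W =
    quot_mod K (free_mod K (carrier V \<times> carrier W)) (tensor_null K V W)"

definition pure_tensor ::
    "('k, 'r) ring_scheme \<Rightarrow> ('k, 'v, 'm) module_scheme \<Rightarrow> ('k, 'w, 'n) module_scheme
      \<Rightarrow> 'v \<Rightarrow> 'w \<Rightarrow> ('v \<times> 'w \<Rightarrow> 'k) set" where
  "pure_tensor K V W v w =
    tensor_null K V W +>\<^bsub>free_mod K (carrier V \<times> carrier W)\<^esub> free_gen K (v, w)"

text \<open>For bilinear \<open>B : V \<times> W \<rightarrow> P\<close>, the linear map \<open>V \<otimes> W \<rightarrow> P\<close> with \<open>v \<otimes> w \<mapsto> B v w\<close>.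
  A map on a quotient is written \<open>\<lambda>X. the_elem (h ` X)\<close>, as in the library's homomorphism
  theorems.\<close>

definition tensor_lift ::
    "('k, 'r) ring_scheme \<Rightarrow> ('k, 'p, 'm) module_scheme \<Rightarrow> ('v \<Rightarrow> 'w \<Rightarrow> 'p)
      \<Rightarrow> ('v \<times> 'w \<Rightarrow> 'k) set \<Rightarrow> 'p" where
  "tensor_lift K P B X = the_elem (free_lift K P (\<lambda>(v, w). B v w) ` X)"

text \<open>The map \<open>f \<otimes> g\<close> into \<open>V' \<otimes> W'\<close>, and the associativity isomorphism
  \<open>(U \<otimes> V) \<otimes> W \<rightarrow> U \<otimes> (V \<otimes> W)\<close>.\<close>

definition tensor_map ::
    "('k, 'r) ring_scheme \<Rightarrow> ('k, 'v2, 'm) module_scheme \<Rightarrow> ('k, 'w2, 'n) module_scheme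
      \<Rightarrow> ('v \<Rightarrow> 'v2) \<Rightarrow> ('w \<Rightarrow> 'w2) \<Rightarrow> ('v \<times> 'w \<Rightarrow> 'k) set \<Rightarrow> ('v2 \<times> 'w2 \<Rightarrow> 'k) set" where
  "tensor_map K V' W' f g =
    tensor_lift K (tensor K V' W') (\<lambda>v w. pure_tensor K V' W' (f v) (g w))"

definition tensor_assoc ::
    "('k, 'r) ring_scheme \<Rightarrow> ('k, 'u, 'l) module_scheme \<Rightarrow> ('k, 'v, 'm) module_scheme
      \<Rightarrow> ('k, 'w, 'n) module_scheme \<Rightarrow> (('u \<times> 'v \<Rightarrow> 'k) set \<times> 'w \<Rightarrow> 'k) set
      \<Rightarrow> ('u \<times> ('v \<times> 'w \<Rightarrow> 'k) set \<Rightarrow> 'k) set" where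
  "tensor_assoc K U V W =
    tensor_lift K (tensor K U (tensor K V W))
      (\<lambda>t w. tensor_lift K (tensor K U (tensor K V W))
        (\<lambda>u v. pure_tensor K U (tensor K V W) u (pure_tensor K V W v w)) t)"

text \<open>For subspaces \<open>A \<subseteq> V\<close> and \<open>B \<subseteq> W\<close>, the image of \<open>A \<otimes> B\<close> in \<open>V \<otimes> W\<close>
  (over a field, \<open>A \<otimes> B\<close> itself).\<close>

definition tensor_sub ::
    "('k, 'r) ring_scheme \<Rightarrow> ('k, 'v, 'm) module_scheme \<Rightarrow> ('k, 'w, 'n) module_scheme
      \<Rightarrow> 'v set \<Rightarrow> 'w set \<Rightarrow> ('v \<times> 'w \<Rightarrow> 'k) set set" where
  "tensor_sub K V W A B =
    module.span K (tensor K V W) {pure_tensor K V W a b | a b. a \<in> A \<and> b \<in> B}"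


section \<open>Coalgebras and comodules\<close>

locale coalgebra = vectorspace K C
  for K :: "('k, 'r) ring_scheme" and C :: "('k, 'c, 'm) module_scheme" +
  fixes \<Delta> :: "'c \<Rightarrow> ('c \<times> 'c \<Rightarrow> 'k) set" and \<epsilon> :: "'c \<Rightarrow> 'k"
  assumes comult_hom: "\<Delta> \<in> module_hom K C (tensor K C C)"
    and counit_hom: "\<epsilon> \<in> module_hom K C (scalars K)"
    and coassoc: "c \<in> carrier C \<Longrightarrow>
      tensor_assoc K C C C (tensor_map K (tensor K C C) C \<Delta> id (\<Delta> c))
        = tensor_map K C (tensor K C C) id \<Delta> (\<Delta> c)"
    and counit_left: "c \<in> carrier C \<Longrightarrow>
      tensor_lift K C (\<lambda>a x. a \<odot>\<^bsub>C\<^esub> x) (tensor_map K (scalars K) C \<epsilon> id (\<Delta> c)) = c"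
    and counit_right: "c \<in> carrier C \<Longrightarrow>
      tensor_lift K C (\<lambda>x a. a \<odot>\<^bsub>C\<^esub> x) (tensor_map K C (scalars K) id \<epsilon> (\<Delta> c)) = c"

locale right_comodule = C: coalgebra K C \<Delta> \<epsilon> + M: vectorspace K M
  for K :: "('k, 'r) ring_scheme" and C :: "('k, 'c, 'm) module_scheme" and \<Delta> \<epsilon>
    and M :: "('k, 'a, 'n) module_scheme" +
  fixes \<rho> :: "'a \<Rightarrow> ('a \<times> 'c \<Rightarrow> 'k) set"
  assumes coact_hom: "\<rho> \<in> module_hom K M (tensor K M C)"
    and coact_coassoc: "x \<in> carrier M \<Longrightarrow>
      tensor_assoc K M C C (tensor_map K (tensor K M C) C \<rho> id (\<rho> x))
        = tensor_map K M (tensor K C C) id \<Delta> (\<rho> x)"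
    and coact_counit: "x \<in> carrier M \<Longrightarrow>
      tensor_lift K M (\<lambda>y a. a \<odot>\<^bsub>M\<^esub> y) (tensor_map K M (scalars K) id \<epsilon> (\<rho> x)) = x"

locale left_comodule = C: coalgebra K C \<Delta> \<epsilon> + M: vectorspace K M
  for K :: "('k, 'r) ring_scheme" and C :: "('k, 'c, 'm) module_scheme" and \<Delta> \<epsilon>
    and M :: "('k, 'a, 'n) module_scheme" +
  fixes \<rho> :: "'a \<Rightarrow> ('c \<times> 'a \<Rightarrow> 'k) set"
  assumes coact_hom: "\<rho> \<in> module_hom K M (tensor K C M)"
    and coact_coassoc: "x \<in> carrier M \<Longrightarrow>
      tensor_assoc K C C M (tensor_map K (tensor K C C) M \<Delta> id (\<rho> x))
        = tensor_map K C (tensor K C M) id \<rho> (\<rho> x)"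
    and coact_counit: "x \<in> carrier M \<Longrightarrow>
      tensor_lift K M (\<lambda>a y. a \<odot>\<^bsub>M\<^esub> y) (tensor_map K (scalars K) M \<epsilon> id (\<rho> x)) = x"

locale right_subcomodule = right_comodule K C \<Delta> \<epsilon> M \<rho> + VectorSpace.subspace K N M
  for K :: "('k, 'r) ring_scheme" and C :: "('k, 'c, 'm) module_scheme" and \<Delta> \<epsilon>
    and M :: "('k, 'a, 'n) module_scheme" and \<rho> and N +
  assumes coact_closed: "\<rho> ` N \<subseteq> tensor_sub K M C N (carrier C)"

locale left_subcomodule = left_comodule K C \<Delta> \<epsilon> M \<rho> + VectorSpace.subspace K N M
  for K :: "('k, 'r) ring_scheme" and C :: "('k, 'c, 'm) module_scheme" and \<Delta> \<epsilon>
    and M :: "('k, 'a, 'n) module_scheme" and \<rho> and N +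
  assumes coact_closed: "\<rho> ` N \<subseteq> tensor_sub K C M (carrier C) N"

text \<open>The coaction \<open>M/N \<rightarrow> (M/N) \<otimes> C\<close> induced on the quotient by a subcomodule \<open>N\<close>.\<close>

definition quot_coact ::
    "('k, 'r) ring_scheme \<Rightarrow> ('k, 'c, 'm) module_scheme \<Rightarrow> ('k, 'a, 'n) module_scheme
      \<Rightarrow> ('a \<Rightarrow> ('a \<times> 'c \<Rightarrow> 'k) set) \<Rightarrow> 'a set \<Rightarrow> 'a set \<Rightarrow> ('a set \<times> 'c \<Rightarrow> 'k) set" where
  "quot_coact K C M \<rho> N X =
    the_elem ((\<lambda>x. tensor_map K (quot_mod K M N) C (\<lambda>y. N +>\<^bsub>M\<^esub> y) id (\<rho> x)) ` X)"

text \<open>A subcomodule \<open>S\<close> of \<open>M\<close> is simple as a comodule; its subcomodules are those of \<open>M\<close>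
  contained in \<open>S\<close>.\<close>

definition simple_right_subcomodule where
  "simple_right_subcomodule K C \<Delta> \<epsilon> M \<rho> S \<longleftrightarrow>
    right_subcomodule K C \<Delta> \<epsilon> M \<rho> S \<and> S \<noteq> {\<zero>\<^bsub>M\<^esub>} \<and>
    (\<forall>T. right_subcomodule K C \<Delta> \<epsilon> M \<rho> T \<and> T \<subseteq> S \<longrightarrow> T = {\<zero>\<^bsub>M\<^esub>} \<or> T = S)"

definition right_socle where
  "right_socle K C \<Delta> \<epsilon> M \<rho> =
    module.span K M (\<Union>{S. simple_right_subcomodule K C \<Delta> \<epsilon> M \<rho> S})"


section \<open>The coradical filtration\<close>

text \<open>\<open>corad_nat K C \<Delta> \<epsilon> n\<close> is \<open>C\<^sub>n\<close>, formed with right comodules; \<^term>\<open>corad_filt\<close> extends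
  the indexing by \<open>C\<^sub>-\<^sub>1 = 0\<close>.\<close>

primrec corad_nat ::
    "('k, 'r) ring_scheme \<Rightarrow> ('k, 'c, 'm) module_scheme \<Rightarrow> ('c \<Rightarrow> ('c \<times> 'c \<Rightarrow> 'k) set)
      \<Rightarrow> ('c \<Rightarrow> 'k) \<Rightarrow> nat \<Rightarrow> 'c set" where
  "corad_nat K C \<Delta> \<epsilon> 0 = right_socle K C \<Delta> \<epsilon> C \<Delta>"
| "corad_nat K C \<Delta> \<epsilon> (Suc n) =
    (let N = corad_nat K C \<Delta> \<epsilon> n in
      {x \<in> carrier C. N +>\<^bsub>C\<^esub> x \<in>
        right_socle K C \<Delta> \<epsilon> (quot_mod K C N) (quot_coact K C C \<Delta> N)})"

definition corad_filt ::
    "('k, 'r) ring_scheme \<Rightarrow> ('k, 'c, 'm) module_scheme \<Rightarrow> ('c \<Rightarrow> ('c \<times> 'c \<Rightarrow> 'k) set)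
      \<Rightarrow> ('c \<Rightarrow> 'k) \<Rightarrow> int \<Rightarrow> 'c set" where
  "corad_filt K C \<Delta> \<epsilon> n = (if n < 0 then {\<zero>\<^bsub>C\<^esub>} else corad_nat K C \<Delta> \<epsilon> (nat n))"

text \<open>\<open>C\<^sub>n\<^sub>+\<^sub>1/C\<^sub>n\<close> is zero or a simple right comodule; the factor is the subcomodule of \<open>C/C\<^sub>n\<close>
  consisting of the cosets \<open>C\<^sub>n + x\<close> with \<open>x \<in> C\<^sub>n\<^sub>+\<^sub>1\<close>.\<close>

definition corad_factor_zero_or_simple where
  "corad_factor_zero_or_simple K C \<Delta> \<epsilon> n \<longleftrightarrow>
    (let N = corad_filt K C \<Delta> \<epsilon> n; Q = quot_mod K C N;
         S = (\<lambda>x. N +>\<^bsub>C\<^esub> x) ` corad_filt K C \<Delta> \<epsilon> (n + 1)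
     in S = {\<zero>\<^bsub>Q\<^esub>} \<or> simple_right_subcomodule K C \<Delta> \<epsilon> Q (quot_coact K C C \<Delta> N) S)"


section \<open>Chain coalgebras\<close>

definition right_chain_coalgebra where
  "right_chain_coalgebra K C \<Delta> \<epsilon> \<longleftrightarrow> coalgebra K C \<Delta> \<epsilon> \<and>
    (\<forall>M N. right_subcomodule K C \<Delta> \<epsilon> C \<Delta> M \<and> right_subcomodule K C \<Delta> \<epsilon> C \<Delta> N
      \<longrightarrow> M \<subseteq> N \<or> N \<subseteq> M)"

definition left_chain_coalgebra where
  "left_chain_coalgebra K C \<Delta> \<epsilon> \<longleftrightarrow> coalgebra K C \<Delta> \<epsilon> \<and>
    (\<forall>M N. left_subcomodule K C \<Delta> \<epsilon> C \<Delta> M \<and> left_subcomodule K C \<Delta> \<epsilon> C \<Delta> N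
      \<longrightarrow> M \<subseteq> N \<or> N \<subseteq> M)"

definition two_sided_subcomodule where
  "two_sided_subcomodule K C \<Delta> \<epsilon> N \<longleftrightarrow>
    right_subcomodule K C \<Delta> \<epsilon> C \<Delta> N \<and> left_subcomodule K C \<Delta> \<epsilon> C \<Delta> N"

end

theory Submission
  imports Defs
begin

text \<open>Let \<open>C\<^sup>*\<close> be the space of linear functionals on \<open>C\<close>. A functional \<open>f\<close> acts on a right comodule by
  \<open>f \<cdot> x = (id \<otimes> f)(\<rho> x)\<close> and on a left comodule by \<open>x \<cdot> f = (f \<otimes> id)(\<rho> x)\<close>. Functionals separate points
  from subspaces, so the subcomodules are exactly the subspaces stable under these operators
  (\<open>right_subcomodule_iff\<close>, \<open>left_subcomodule_iff\<close>). By coassociativity and the counit law,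
  \<open>C\<^sup>* \<cdot> x\<close> is the least right subcomodule and \<open>x \<cdot> C\<^sup>*\<close> the least left subcomodule that contains \<open>x\<close>.

  The passage between left and right rests on one observation. Write \<open>\<Delta> x = \<Sum>\<^sub>i a\<^sub>i \<otimes> b\<^sub>i\<close> with as few
  terms as possible. Then the \<open>a\<^sub>i\<close> are independent, the \<open>b\<^sub>i\<close> are independent, and applying dual
  functionals gives \<open>C\<^sup>* \<cdot> x = span {a\<^sub>i}\<close> and \<open>x \<cdot> C\<^sup>* = span {b\<^sub>i}\<close>: both cyclic subcomodules have the same
  finite dimension, the rank of \<open>\<Delta> x\<close> (\<open>tensor_rank_decomposition\<close>). Suppose that the right subcomodules
  form a chain and let \<open>y \<in> x \<cdot> C\<^sup>*\<close>. Then \<open>y \<cdot> C\<^sup>* \<subseteq> x \<cdot> C\<^sup>*\<close>, so \<open>dim C\<^sup>* \<cdot> y \<le> dim C\<^sup>* \<cdot> x\<close>; these two spaces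
  are comparable, hence \<open>y \<in> C\<^sup>* \<cdot> y \<subseteq> C\<^sup>* \<cdot> x\<close>. Thus \<open>x \<cdot> C\<^sup>* \<subseteq> C\<^sup>* \<cdot> x\<close>, and equality of dimensions makes this an
  equality (\<open>cyclic_subspaces_agree\<close>). So left and right subcomodules coincide, and in particular the left
  ones form a chain. The converse is the same argument with the sides exchanged.

  For the coradical filtration only right subcomodules matter. The quotient by a right subcomodule
  \<open>N\<close> is again a comodule (\<open>quotient_right_comodule\<close>), and its simple subcomodules are the images of the right
  subcomodules that cover \<open>N\<close> in the lattice of right subcomodules. Hence the preimage of the socle of
  \<open>C/N\<close> contains all covers of \<open>N\<close>; it is \<open>N\<close> if there are none, and the cover if there is exactly one. In a
  chain there is at most one cover, so every factor of the filtration is zero or simple. Conversely,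
  suppose that every factor is zero or simple. As cyclic subcomodules are finite dimensional, every
  right subcomodule that is not contained in \<open>N\<close> yields a cover of \<open>N\<close> (\<open>covers_exists\<close>); so the filtration
  exhausts \<open>C\<close>, and a right subcomodule that omits some layer is equal to the last layer it
  contains (\<open>right_sub_classification\<close>). Therefore the layers and \<open>C\<close> are the only right
  subcomodules, and they form a chain.\<close>

section \<open>Linear maps and subspaces\<close>

lemma module_homI:
  assumes "\<And>x. x \<in> carrier V \<Longrightarrow> f x \<in> carrier W"
    and "\<And>x y. x \<in> carrier V \<Longrightarrow> y \<in> carrier V \<Longrightarrow> f (x \<oplus>\<^bsub>V\<^esub> y) = f x \<oplus>\<^bsub>W\<^esub> f y"
    and "\<And>a x. a \<in> carrier K \<Longrightarrow> x \<in> carrier V \<Longrightarrow> f (a \<odot>\<^bsub>V\<^esub> x) = a \<odot>\<^bsub>W\<^esub> f x"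
  shows "f \<in> module_hom K V W"
  using assms by (auto simp: module_hom_def)

lemma module_hom_in: "f \<in> module_hom K V W \<Longrightarrow> x \<in> carrier V \<Longrightarrow> f x \<in> carrier W"
  by (auto simp: module_hom_def)

lemma module_hom_comp:
  assumes "f \<in> module_hom K U V" "g \<in> module_hom K V W"
  shows "(\<lambda>x. g (f x)) \<in> module_hom K U W"
  using assms by (auto simp: module_hom_def Pi_iff)

lemma module_hom_id: "id \<in> module_hom K V V"
  by (auto simp: module_hom_def)

lemma module_hom_zero:
  assumes "vectorspace K V" "vectorspace K W" "f \<in> module_hom K V W"
  shows "f \<zero>\<^bsub>V\<^esub> = \<zero>\<^bsub>W\<^esub>"
proof -
  interpret linear_map K V W f
    using assms by (auto simp: linear_map_def mod_hom_def mod_hom_axioms_def vectorspace_def)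
  show ?thesis by simp
qed

lemma module_hom_minus:
  assumes "vectorspace K V" "vectorspace K W" "f \<in> module_hom K V W"
    and "x \<in> carrier V" "y \<in> carrier V"
  shows "f (x \<ominus>\<^bsub>V\<^esub> y) = f x \<ominus>\<^bsub>W\<^esub> f y"
proof -
  interpret linear_map K V W f
    using assms by (auto simp: linear_map_def mod_hom_def mod_hom_axioms_def vectorspace_def)
  show ?thesis using assms by simp
qed

lemma module_hom_finsum:
  assumes "vectorspace K V" "vectorspace K W" "f \<in> module_hom K V W"
    and "g \<in> I \<rightarrow> carrier V"
  shows "f (\<Oplus>\<^bsub>V\<^esub>i\<in>I. g i) = (\<Oplus>\<^bsub>W\<^esub>i\<in>I. f (g i))"
proof -
  interpret V: vectorspace K V by fact
  interpret W: vectorspace K W by fact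
  show ?thesis using assms(4)
  proof (induction I rule: infinite_finite_induct)
    case (insert i I)
    then have "f (\<Oplus>\<^bsub>V\<^esub>j\<in>insert i I. g j) = f (g i \<oplus>\<^bsub>V\<^esub> (\<Oplus>\<^bsub>V\<^esub>j\<in>I. g j))"
      by (subst V.finsum_insert) auto
    also have "\<dots> = f (g i) \<oplus>\<^bsub>W\<^esub> f (\<Oplus>\<^bsub>V\<^esub>j\<in>I. g j)"
      using insert by (intro module_hom_add[OF assms(3)]) auto
    also have "\<dots> = (\<Oplus>\<^bsub>W\<^esub>j\<in>insert i I. f (g j))"
      using insert module_hom_in[OF assms(3)] by (subst W.finsum_insert) auto
    finally show ?case .
  qed (use module_hom_zero[OF assms(1-3)] in auto)
qed

lemma module_hom_plus:
  assumes "vectorspace K V" "vectorspace K W" "f \<in> module_hom K V W" "g \<in> module_hom K V W"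
  shows "(\<lambda>x. f x \<oplus>\<^bsub>W\<^esub> g x) \<in> module_hom K V W"
proof -
  interpret W: vectorspace K W by fact
  show ?thesis
    using module_hom_in[OF assms(3)] module_hom_in[OF assms(4)]
    by (intro module_homI) (auto simp: W.M.a_ac W.smult_r_distr module_hom_add[OF assms(3)]
      module_hom_add[OF assms(4)] module_hom_smult[OF assms(3)] module_hom_smult[OF assms(4)])
qed

lemma module_hom_scale:
  assumes "vectorspace K V" "vectorspace K W" "f \<in> module_hom K V W" "a \<in> carrier K"
  shows "(\<lambda>x. a \<odot>\<^bsub>W\<^esub> f x) \<in> module_hom K V W"
proof -
  interpret W: vectorspace K W by fact
  show ?thesis
    using module_hom_in[OF assms(3)] assms(4)
    by (intro module_homI) (auto simp: W.R.m_comm W.smult_r_distr module_hom_add[OF assms(3)]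
       module_hom_smult[OF assms(3)] simp flip: W.smult_assoc1)
qed

lemma subspaceI:
  assumes "vectorspace K V" "N \<subseteq> carrier V" "\<zero>\<^bsub>V\<^esub> \<in> N"
    and "\<And>x y. x \<in> N \<Longrightarrow> y \<in> N \<Longrightarrow> x \<oplus>\<^bsub>V\<^esub> y \<in> N"
    and "\<And>a x. a \<in> carrier K \<Longrightarrow> x \<in> N \<Longrightarrow> a \<odot>\<^bsub>V\<^esub> x \<in> N"
  shows "VectorSpace.subspace K N V"
  using assms by (auto simp: VectorSpace.subspace_def submodule_def vectorspace_def)

lemma subspaceD:
  assumes "VectorSpace.subspace K N V"
  shows "vectorspace K V" "N \<subseteq> carrier V" "\<zero>\<^bsub>V\<^esub> \<in> N"
    and "\<And>x. x \<in> N \<Longrightarrow> x \<in> carrier V"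
    and "\<And>x y. x \<in> N \<Longrightarrow> y \<in> N \<Longrightarrow> x \<oplus>\<^bsub>V\<^esub> y \<in> N"
    and "\<And>a x. a \<in> carrier K \<Longrightarrow> x \<in> N \<Longrightarrow> a \<odot>\<^bsub>V\<^esub> x \<in> N"
  using assms by (auto simp: VectorSpace.subspace_def submodule_def)

lemma subspace_uminus:
  assumes "VectorSpace.subspace K N V" "y \<in> N"
  shows "\<ominus>\<^bsub>V\<^esub> y \<in> N"
proof -
  interpret V: vectorspace K V using assms by (simp add: subspaceD)
  have "\<ominus>\<^bsub>V\<^esub> y = (\<ominus>\<^bsub>K\<^esub> \<one>\<^bsub>K\<^esub>) \<odot>\<^bsub>V\<^esub> y"
    using subspaceD(4)[OF assms] by (subst V.smult_minus_1) auto
  also have "\<dots> \<in> N" using assms by (intro subspaceD(6)) auto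
  finally show ?thesis .
qed

lemma subspace_minus:
  assumes "VectorSpace.subspace K N V" "x \<in> N" "y \<in> N"
  shows "x \<ominus>\<^bsub>V\<^esub> y \<in> N"
  unfolding a_minus_def using assms subspace_uminus by (intro subspaceD(5)) auto

lemma subspace_finsum:
  assumes "VectorSpace.subspace K N V" "g \<in> I \<rightarrow> N"
  shows "(\<Oplus>\<^bsub>V\<^esub>i\<in>I. g i) \<in> N"
proof -
  interpret V: vectorspace K V using assms by (simp add: subspaceD)
  show ?thesis using assms(2)
  proof (induction I rule: infinite_finite_induct)
    case (insert i I)
    then show ?case using subspaceD(4,5)[OF assms(1)] by (subst V.finsum_insert) auto
  qed (use subspaceD(3)[OF assms(1)] in auto)
qed

lemma span_minimal:
  assumes "VectorSpace.subspace K N V" "S \<subseteq> N"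
  shows "module.span K V S \<subseteq> N"
proof -
  interpret V: vectorspace K V using assms by (simp add: subspaceD)
  show ?thesis using assms by (intro V.span_is_subset) auto
qed

lemma subspace_zero: "vectorspace K V \<Longrightarrow> VectorSpace.subspace K {\<zero>\<^bsub>V\<^esub>} V"
proof -
  assume V: "vectorspace K V"
  interpret V: vectorspace K V by fact
  show ?thesis using V by (intro subspaceI) auto
qed

lemma subspace_carrier: "vectorspace K V \<Longrightarrow> VectorSpace.subspace K (carrier V) V"
proof -
  assume V: "vectorspace K V"
  interpret V: vectorspace K V by fact
  show ?thesis using V by (intro subspaceI) auto
qed

lemma subspace_Int:
  assumes "VectorSpace.subspace K N V" "VectorSpace.subspace K M V"
  shows "VectorSpace.subspace K (N \<inter> M) V"
  using assms by (intro subspaceI) (auto simp: subspaceD dest: subspaceD(4))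

lemma subspace_vimage:
  assumes "vectorspace K V" "f \<in> module_hom K V W" "VectorSpace.subspace K N W"
  shows "VectorSpace.subspace K {x \<in> carrier V. f x \<in> N} V"
proof -
  interpret V: vectorspace K V by fact
  show ?thesis
    using assms(1) subspaceD(3,5,6)[OF assms(3)] module_hom_zero[OF assms(1) subspaceD(1)[OF assms(3)] assms(2)]
      module_hom_add[OF assms(2)] module_hom_smult[OF assms(2)]
    by (intro subspaceI) auto
qed

lemma subspace_image:
  assumes "vectorspace K W" "f \<in> module_hom K V W" "VectorSpace.subspace K N V"
  shows "VectorSpace.subspace K (f ` N) W"
proof -
  note N = subspaceD[OF assms(3)]
  show ?thesis
  proof (rule subspaceI[OF assms(1)])
    show "f ` N \<subseteq> carrier W" using module_hom_in[OF assms(2)] N(4) by auto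
    show "\<zero>\<^bsub>W\<^esub> \<in> f ` N" using module_hom_zero[OF N(1) assms(1,2)] N(3) by force
    fix a y assume a: "a \<in> carrier K" and "y \<in> f ` N"
    then obtain x where x: "x \<in> N" "y = f x" by auto
    then have "a \<odot>\<^bsub>W\<^esub> y = f (a \<odot>\<^bsub>V\<^esub> x)" using a N(4) by (simp add: module_hom_smult[OF assms(2)])
    then show "a \<odot>\<^bsub>W\<^esub> y \<in> f ` N" using a x N(6) by blast
  next
    fix y y' assume "y \<in> f ` N" "y' \<in> f ` N"
    then obtain x x' where x: "x \<in> N" "y = f x" "x' \<in> N" "y' = f x'" by auto
    then have "y \<oplus>\<^bsub>W\<^esub> y' = f (x \<oplus>\<^bsub>V\<^esub> x')" using N(4) by (simp add: module_hom_add[OF assms(2)])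
    then show "y \<oplus>\<^bsub>W\<^esub> y' \<in> f ` N" using x N(5) by blast
  qed
qed

section \<open>Quotient spaces\<close>

context
  fixes K :: "('k, 'r) ring_scheme" and V :: "('k, 'v, 'm) module_scheme" and N :: "'v set"
  assumes sub: "VectorSpace.subspace K N V"
begin

interpretation V: vectorspace K V using sub by (rule subspaceD)
interpretation N: abelian_subgroup N V
proof (rule abelian_subgroupI3)
  show "additive_subgroup N V"
  proof (rule additive_subgroupI, rule V.add.subgroupI)
    fix a assume "a \<in> N" then show "\<ominus>\<^bsub>V\<^esub> a \<in> N" using subspace_uminus[OF sub] by auto
  qed (use subspaceD[OF sub] in auto)
  show "abelian_group V" by (rule V.M.abelian_group_axioms)
qed

lemma coset_eq_iff:
  assumes "x \<in> carrier V" "y \<in> carrier V"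
  shows "N +>\<^bsub>V\<^esub> x = N +>\<^bsub>V\<^esub> y \<longleftrightarrow> x \<ominus>\<^bsub>V\<^esub> y \<in> N"
proof -
  have "x \<in> N +>\<^bsub>V\<^esub> y \<longleftrightarrow> x \<oplus>\<^bsub>V\<^esub> \<ominus>\<^bsub>V\<^esub> y \<in> N" using assms by (intro N.a_rcos_module) auto
  then show ?thesis
    using N.a_repr_independence'[of x y] N.a_repr_independenceD[of x y] assms by (auto simp: a_minus_def)
qed

lemma coset_self_mem: "x \<in> carrier V \<Longrightarrow> x \<in> N +>\<^bsub>V\<^esub> x"
  by (rule N.a_rcos_self)

lemma mem_coset_iff:
  assumes "x \<in> carrier V"
  shows "y \<in> N +>\<^bsub>V\<^esub> x \<longleftrightarrow> y \<in> carrier V \<and> N +>\<^bsub>V\<^esub> y = N +>\<^bsub>V\<^esub> x"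
  using assms N.a_repr_independence'[of y x] coset_self_mem N.a_elemrcos_carrier by metis

lemma quot_carrier: "carrier (quot_mod K V N) = (\<lambda>x. N +>\<^bsub>V\<^esub> x) ` carrier V"
  by (auto simp: quot_mod_def A_RCOSETS_def')

lemma quot_zero: "\<zero>\<^bsub>quot_mod K V N\<^esub> = N +>\<^bsub>V\<^esub> \<zero>\<^bsub>V\<^esub>"
  using N.a_rcos_const[of "\<zero>\<^bsub>V\<^esub>"] by (auto simp: quot_mod_def)

lemma quot_add: "x \<in> carrier V \<Longrightarrow> y \<in> carrier V \<Longrightarrow>
   (N +>\<^bsub>V\<^esub> x) \<oplus>\<^bsub>quot_mod K V N\<^esub> (N +>\<^bsub>V\<^esub> y) = N +>\<^bsub>V\<^esub> (x \<oplus>\<^bsub>V\<^esub> y)"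
  by (simp add: quot_mod_def N.a_rcos_sum)

lemma quot_smult:
  assumes "a \<in> carrier K" "x \<in> carrier V"
  shows "a \<odot>\<^bsub>quot_mod K V N\<^esub> (N +>\<^bsub>V\<^esub> x) = N +>\<^bsub>V\<^esub> (a \<odot>\<^bsub>V\<^esub> x)"
proof -
  have "N +>\<^bsub>V\<^esub> (a \<odot>\<^bsub>V\<^esub> y) = N +>\<^bsub>V\<^esub> (a \<odot>\<^bsub>V\<^esub> x)" if "y \<in> N +>\<^bsub>V\<^esub> x" for y
  proof -
    have y: "y \<in> carrier V" "y \<ominus>\<^bsub>V\<^esub> x \<in> N" using that assms mem_coset_iff coset_eq_iff by auto
    have "a \<odot>\<^bsub>V\<^esub> y \<ominus>\<^bsub>V\<^esub> a \<odot>\<^bsub>V\<^esub> x = a \<odot>\<^bsub>V\<^esub> (y \<ominus>\<^bsub>V\<^esub> x)"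
      using assms y by (simp add: a_minus_def V.smult_r_distr V.smult_r_minus)
    also have "\<dots> \<in> N" using assms y sub by (intro subspaceD(6))
    finally show ?thesis using assms y by (subst coset_eq_iff) auto
  qed
  then have "(\<Union>y\<in>N +>\<^bsub>V\<^esub> x. N +>\<^bsub>V\<^esub> (a \<odot>\<^bsub>V\<^esub> y)) = N +>\<^bsub>V\<^esub> (a \<odot>\<^bsub>V\<^esub> x)"
    using coset_self_mem[OF assms(2)] by blast
  then show ?thesis by (simp add: quot_mod_def)
qed

lemma quot_vectorspace: "vectorspace K (quot_mod K V N)"
proof (rule vs_criteria)
  let ?Q = "quot_mod K V N"
  show "\<forall>v\<in>carrier ?Q. \<exists>neg_v\<in>carrier ?Q. v \<oplus>\<^bsub>?Q\<^esub> neg_v = \<zero>\<^bsub>?Q\<^esub>"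
  proof
    fix X assume "X \<in> carrier ?Q"
    then obtain x where x: "x \<in> carrier V" "X = N +>\<^bsub>V\<^esub> x" by (auto simp: quot_carrier)
    have "N +>\<^bsub>V\<^esub> (\<ominus>\<^bsub>V\<^esub> x) \<in> carrier ?Q" using x by (simp add: quot_carrier)
    moreover have "X \<oplus>\<^bsub>?Q\<^esub> (N +>\<^bsub>V\<^esub> (\<ominus>\<^bsub>V\<^esub> x)) = \<zero>\<^bsub>?Q\<^esub>"
      using x by (simp add: quot_add quot_zero V.r_neg)
    ultimately show "\<exists>Y\<in>carrier ?Q. X \<oplus>\<^bsub>?Q\<^esub> Y = \<zero>\<^bsub>?Q\<^esub>" by blast
  qed
qed (auto simp: V.field_axioms quot_carrier quot_add quot_smult quot_zero V.smult_r_distr V.smult_l_distr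
      V.smult_assoc1 V.M.a_ac)

lemma quot_proj_hom: "(\<lambda>x. N +>\<^bsub>V\<^esub> x) \<in> module_hom K V (quot_mod K V N)"
  by (rule module_homI) (auto simp: quot_carrier quot_add quot_smult)

lemma quot_proj_zero_iff:
  assumes "x \<in> carrier V"
  shows "N +>\<^bsub>V\<^esub> x = \<zero>\<^bsub>quot_mod K V N\<^esub> \<longleftrightarrow> x \<in> N"
proof -
  have "\<ominus>\<^bsub>V\<^esub> \<zero>\<^bsub>V\<^esub> = \<zero>\<^bsub>V\<^esub>" by (rule V.M.minus_equality) auto
  then have "x \<ominus>\<^bsub>V\<^esub> \<zero>\<^bsub>V\<^esub> = x" using assms by (simp add: a_minus_def)
  then show ?thesis using coset_eq_iff[of x "\<zero>\<^bsub>V\<^esub>"] assms by (simp add: quot_zero)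
qed

text \<open>A linear map that kills \<open>N\<close> is constant on the cosets of \<open>N\<close>, which is what gives \<^const>\<open>the_elem\<close> its value.\<close>

lemma quot_lift:
  assumes W: "vectorspace K W" and h: "h \<in> module_hom K V W" and kill: "\<And>x. x \<in> N \<Longrightarrow> h x = \<zero>\<^bsub>W\<^esub>"
  shows quot_lift_coset: "x \<in> carrier V \<Longrightarrow> the_elem (h ` (N +>\<^bsub>V\<^esub> x)) = h x"
    and quot_lift_hom: "(\<lambda>X. the_elem (h ` X)) \<in> module_hom K (quot_mod K V N) W"
proof -
  interpret W: vectorspace K W by fact
  have *: "the_elem (h ` (N +>\<^bsub>V\<^esub> x)) = h x" if x: "x \<in> carrier V" for x
  proof -
    have "h y = h x" if "y \<in> N +>\<^bsub>V\<^esub> x" for y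
    proof -
      have y: "y \<in> carrier V" "y \<ominus>\<^bsub>V\<^esub> x \<in> N" using that x mem_coset_iff coset_eq_iff by auto
      then have "h y \<ominus>\<^bsub>W\<^esub> h x = \<zero>\<^bsub>W\<^esub>"
        using kill module_hom_minus[OF V.vectorspace_axioms W h] x by metis
      then show ?thesis using y x module_hom_in[OF h] by simp
    qed
    then have "h ` (N +>\<^bsub>V\<^esub> x) = {h x}" using coset_self_mem[OF x] by blast
    then show ?thesis by simp
  qed
  show "x \<in> carrier V \<Longrightarrow> the_elem (h ` (N +>\<^bsub>V\<^esub> x)) = h x" by (rule *)
  show "(\<lambda>X. the_elem (h ` X)) \<in> module_hom K (quot_mod K V N) W"
    using module_hom_in[OF h] module_hom_add[OF h] module_hom_smult[OF h]
    by (intro module_homI) (auto simp: quot_carrier quot_add quot_smult *)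
qed

end

section \<open>Free modules\<close>

lemma free_mod_simps [simp]:
  "\<zero>\<^bsub>free_mod K S\<^esub> = (\<lambda>s. \<zero>\<^bsub>K\<^esub>)"
  "f \<oplus>\<^bsub>free_mod K S\<^esub> g = (\<lambda>s. f s \<oplus>\<^bsub>K\<^esub> g s)"
  "a \<odot>\<^bsub>free_mod K S\<^esub> f = (\<lambda>s. a \<otimes>\<^bsub>K\<^esub> f s)"
  by (simp_all add: free_mod_def)

lemma free_mod_carrier:
  "f \<in> carrier (free_mod K S) \<longleftrightarrow>
     (\<forall>s. f s \<in> carrier K) \<and> {s. f s \<noteq> \<zero>\<^bsub>K\<^esub>} \<subseteq> S \<and> finite {s. f s \<noteq> \<zero>\<^bsub>K\<^esub>}"
  by (auto simp: free_mod_def)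

lemma free_mod_out: "f \<in> carrier (free_mod K S) \<Longrightarrow> s \<notin> S \<Longrightarrow> f s = \<zero>\<^bsub>K\<^esub>"
  by (auto simp: free_mod_carrier)

lemma free_mod_vectorspace:
  fixes K :: "('k, 'r) ring_scheme" (structure) and S :: "'s set"
  assumes "field K"
  shows "vectorspace K (free_mod K S)"
proof -
  interpret field K by fact
  have fin: "finite {s. h s \<noteq> \<zero>\<^bsub>K\<^esub>}"
    if "finite {s. f s \<noteq> \<zero>\<^bsub>K\<^esub>}" "finite {s. g s \<noteq> \<zero>\<^bsub>K\<^esub>}"
      "\<And>s. f s = \<zero>\<^bsub>K\<^esub> \<Longrightarrow> g s = \<zero>\<^bsub>K\<^esub> \<Longrightarrow> h s = \<zero>\<^bsub>K\<^esub>" for f g h :: "'s \<Rightarrow> 'k"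
    by (rule finite_subset[of _ "{s. f s \<noteq> \<zero>\<^bsub>K\<^esub>} \<union> {s. g s \<noteq> \<zero>\<^bsub>K\<^esub>}"]) (use that in auto)
  show ?thesis
  proof (rule vs_criteria)
    show "\<forall>v w. v \<in> carrier (free_mod K S) \<and> w \<in> carrier (free_mod K S) \<longrightarrow>
        v \<oplus>\<^bsub>free_mod K S\<^esub> w \<in> carrier (free_mod K S)"
    proof (intro allI impI, elim conjE)
      fix f g assume f: "f \<in> carrier (free_mod K S)" and g: "g \<in> carrier (free_mod K S)"
      have "finite {s. f s \<oplus> g s \<noteq> \<zero>}"
        by (rule fin[of f g]) (use f g in \<open>auto simp: free_mod_carrier\<close>)
      then show "f \<oplus>\<^bsub>free_mod K S\<^esub> g \<in> carrier (free_mod K S)"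
        using f g unfolding free_mod_carrier free_mod_simps
        by (auto, metis free_mod_out[OF f] free_mod_out[OF g] l_zero zero_closed)
    qed
    show "\<forall>c v. c \<in> carrier K \<and> v \<in> carrier (free_mod K S) \<longrightarrow>
        c \<odot>\<^bsub>free_mod K S\<^esub> v \<in> carrier (free_mod K S)"
    proof (intro allI impI, elim conjE)
      fix c f assume c: "c \<in> carrier K" and f: "f \<in> carrier (free_mod K S)"
      have "finite {s. c \<otimes> f s \<noteq> \<zero>}"
        by (rule fin[of f f]) (use f c in \<open>auto simp: free_mod_carrier\<close>)
      then show "c \<odot>\<^bsub>free_mod K S\<^esub> f \<in> carrier (free_mod K S)"
        using f c unfolding free_mod_carrier free_mod_simps
        by auto
    qed
    show "\<forall>v\<in>carrier (free_mod K S). \<exists>neg_v\<in>carrier (free_mod K S).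
        v \<oplus>\<^bsub>free_mod K S\<^esub> neg_v = \<zero>\<^bsub>free_mod K S\<^esub>"
    proof
      fix f assume f: "f \<in> carrier (free_mod K S)"
      have "finite {s. \<ominus> f s \<noteq> \<zero>}"
        by (rule fin[of f f]) (use f in \<open>auto simp: free_mod_carrier\<close>)
      then have "(\<lambda>s. \<ominus> f s) \<in> carrier (free_mod K S)"
        using f unfolding free_mod_carrier
        by auto
      moreover have "f \<oplus>\<^bsub>free_mod K S\<^esub> (\<lambda>s. \<ominus> f s) = \<zero>\<^bsub>free_mod K S\<^esub>"
        using f by (auto simp: free_mod_carrier r_neg)
      ultimately show "\<exists>g\<in>carrier (free_mod K S). f \<oplus>\<^bsub>free_mod K S\<^esub> g = \<zero>\<^bsub>free_mod K S\<^esub>"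
        by blast
    qed
  qed (auto simp: assms free_mod_carrier m_assoc l_distr r_distr a_assoc fun_eq_iff intro: a_comm)
qed

lemma free_gen_in:
  fixes K (structure)
  assumes "field K" "s \<in> S"
  shows "free_gen K s \<in> carrier (free_mod K S)"
proof -
  interpret field K by fact
  have "{t. free_gen K s t \<noteq> \<zero>} = {s}" by (auto simp: free_gen_def)
  then show ?thesis using assms by (auto simp: free_mod_carrier) (auto simp: free_gen_def)
qed

lemma free_mod_induct:
  fixes K :: "('k, 'r) ring_scheme" (structure) and S :: "'s set"
  assumes K: "field K" and f: "f \<in> carrier (free_mod K S)"
    and gen: "\<And>s. s \<in> S \<Longrightarrow> Q (free_gen K s)" and zero: "Q (\<lambda>s. \<zero>\<^bsub>K\<^esub>)"
    and add: "\<And>f g. f \<in> carrier (free_mod K S) \<Longrightarrow> g \<in> carrier (free_mod K S) \<Longrightarrow> Q f \<Longrightarrow> Q g \<Longrightarrow>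
       Q (f \<oplus>\<^bsub>free_mod K S\<^esub> g)"
    and smult: "\<And>a f. a \<in> carrier K \<Longrightarrow> f \<in> carrier (free_mod K S) \<Longrightarrow> Q f \<Longrightarrow> Q (a \<odot>\<^bsub>free_mod K S\<^esub> f)"
  shows "Q f"
proof -
  interpret field K by fact
  interpret F: vectorspace K "free_mod K S" using K by (rule free_mod_vectorspace)
  have "\<forall>f\<in>carrier (free_mod K S). {s. f s \<noteq> \<zero>} \<subseteq> A \<longrightarrow> Q f" if "finite A" "A \<subseteq> S" for A
    using that
  proof (induction A)
    case empty
    show ?case
    proof (intro ballI impI)
      fix f :: "'s \<Rightarrow> 'k" assume "{s. f s \<noteq> \<zero>} \<subseteq> {}"
      then have "f = (\<lambda>s. \<zero>)" by auto
      then show "Q f" using zero by simp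
    qed
  next
    case (insert s A)
    show ?case
    proof (intro ballI impI)
      fix f assume f: "f \<in> carrier (free_mod K S)" "{t. f t \<noteq> \<zero>} \<subseteq> insert s A"
      let ?f = "\<lambda>t. if t = s then \<zero> else f t"
      have "finite {t. ?f t \<noteq> \<zero>}"
        by (rule finite_subset[of _ "{t. f t \<noteq> \<zero>}"]) (use f in \<open>auto simp: free_mod_carrier\<close>)
      then have f': "?f \<in> carrier (free_mod K S)" using f by (auto simp: free_mod_carrier)
      have "{t. ?f t \<noteq> \<zero>} \<subseteq> A" using f(2) by auto
      then have "Q ?f" using insert.IH insert.prems by (auto dest!: bspec[OF _ f'])
      have fs: "f s \<in> carrier K" using f by (auto simp: free_mod_carrier)
      have gs: "free_gen K s \<in> carrier (free_mod K S)" using insert K by (auto intro: free_gen_in)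
      have "f = f s \<odot>\<^bsub>free_mod K S\<^esub> free_gen K s \<oplus>\<^bsub>free_mod K S\<^esub> ?f"
        using f by (auto simp: free_gen_def fun_eq_iff free_mod_carrier)
      moreover have "Q (f s \<odot>\<^bsub>free_mod K S\<^esub> free_gen K s \<oplus>\<^bsub>free_mod K S\<^esub> ?f)"
        using f' \<open>Q ?f\<close> fs gs F.smult_closed[OF fs gs] insert.prems
        by (intro add smult gen) auto
      ultimately show "Q f" by simp
    qed
  qed
  then show ?thesis using f by (auto simp: free_mod_carrier)
qed

text \<open>The support of a sum may be smaller than the union of the supports. Summing over any finite superset of
  the support makes \<^const>\<open>free_lift\<close> visibly linear.\<close>

lemma free_lift_superset:
  assumes P: "vectorspace K P" and g: "g \<in> S \<rightarrow> carrier P" and f: "f \<in> carrier (free_mod K S)"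
    and A: "finite A" "{s. f s \<noteq> \<zero>\<^bsub>K\<^esub>} \<subseteq> A" "A \<subseteq> S"
  shows "free_lift K P g f = (\<Oplus>\<^bsub>P\<^esub>s\<in>A. f s \<odot>\<^bsub>P\<^esub> g s)"
proof -
  interpret P: vectorspace K P by fact
  show ?thesis unfolding free_lift_def
    by (rule P.M.add.finprod_mono_neutral_cong_left)
      (use f g A in \<open>auto simp: free_mod_carrier Pi_iff\<close>)
qed

lemma free_lift_hom:
  assumes P: "vectorspace K P" and g: "g \<in> S \<rightarrow> carrier P"
  shows "free_lift K P g \<in> module_hom K (free_mod K S) P"
proof -
  interpret P: vectorspace K P by fact
  interpret F: vectorspace K "free_mod K S" by (rule free_mod_vectorspace) (rule P.field_axioms)
  show ?thesis
  proof (rule module_homI)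
    fix f assume f: "f \<in> carrier (free_mod K S)"
    show "free_lift K P g f \<in> carrier P"
      using f g by (subst free_lift_superset[OF P g f order.refl[THEN finite_subset] order.refl])
        (auto simp: free_mod_carrier intro!: P.finsum_closed)
    fix a assume a: "a \<in> carrier K"
    let ?A = "{s. f s \<noteq> \<zero>\<^bsub>K\<^esub>}"
    have A: "finite ?A" "?A \<subseteq> S" using f by (auto simp: free_mod_carrier)
    have gA: "g s \<in> carrier P" "f s \<in> carrier K" if "s \<in> ?A" for s
      using that A g f by (auto simp: free_mod_carrier)
    have "free_lift K P g (a \<odot>\<^bsub>free_mod K S\<^esub> f) = (\<Oplus>\<^bsub>P\<^esub>s\<in>?A. (a \<otimes>\<^bsub>K\<^esub> f s) \<odot>\<^bsub>P\<^esub> g s)"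
      using a f A by (subst free_lift_superset[OF P g F.smult_closed]) (auto simp: free_mod_carrier)
    also have "\<dots> = (\<Oplus>\<^bsub>P\<^esub>s\<in>?A. a \<odot>\<^bsub>P\<^esub> (f s \<odot>\<^bsub>P\<^esub> g s))"
      using a gA by (intro P.finsum_cong') (auto simp: P.smult_assoc1)
    also have "\<dots> = a \<odot>\<^bsub>P\<^esub> free_lift K P g f"
      unfolding free_lift_superset[OF P g f A(1) order.refl A(2)]
      using a gA by (intro P.finsum_smult[symmetric]) auto
    finally show "free_lift K P g (a \<odot>\<^bsub>free_mod K S\<^esub> f) = a \<odot>\<^bsub>P\<^esub> free_lift K P g f" .
  next
    fix f h assume f: "f \<in> carrier (free_mod K S)" and h: "h \<in> carrier (free_mod K S)"
    let ?A = "{s. f s \<noteq> \<zero>\<^bsub>K\<^esub>} \<union> {s. h s \<noteq> \<zero>\<^bsub>K\<^esub>}"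
    have A: "finite ?A" "?A \<subseteq> S" using f h by (auto simp: free_mod_carrier)
    have gA: "g s \<in> carrier P" "f s \<in> carrier K" "h s \<in> carrier K" if "s \<in> ?A" for s
      using that A g f h by (auto simp: free_mod_carrier)
    have "free_lift K P g (f \<oplus>\<^bsub>free_mod K S\<^esub> h) = (\<Oplus>\<^bsub>P\<^esub>s\<in>?A. (f s \<oplus>\<^bsub>K\<^esub> h s) \<odot>\<^bsub>P\<^esub> g s)"
      using f h A by (subst free_lift_superset[OF P g F.M.add.m_closed]) (auto simp: free_mod_carrier)
    also have "\<dots> = (\<Oplus>\<^bsub>P\<^esub>s\<in>?A. f s \<odot>\<^bsub>P\<^esub> g s \<oplus>\<^bsub>P\<^esub> h s \<odot>\<^bsub>P\<^esub> g s)"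
      using gA by (intro P.finsum_cong') (auto simp: P.smult_l_distr)
    also have "\<dots> = (\<Oplus>\<^bsub>P\<^esub>s\<in>?A. f s \<odot>\<^bsub>P\<^esub> g s) \<oplus>\<^bsub>P\<^esub> (\<Oplus>\<^bsub>P\<^esub>s\<in>?A. h s \<odot>\<^bsub>P\<^esub> g s)"
      using gA by (intro P.finsum_addf) blast+
    also have "\<dots> = free_lift K P g f \<oplus>\<^bsub>P\<^esub> free_lift K P g h"
      using free_lift_superset[OF P g f A(1) _ A(2)] free_lift_superset[OF P g h A(1) _ A(2)] by auto
    finally show "free_lift K P g (f \<oplus>\<^bsub>free_mod K S\<^esub> h) = free_lift K P g f \<oplus>\<^bsub>P\<^esub> free_lift K P g h" .
  qed
qed

lemma free_lift_gen:
  assumes P: "vectorspace K P" and g: "g \<in> S \<rightarrow> carrier P" and s: "s \<in> S"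
  shows "free_lift K P g (free_gen K s) = g s"
proof -
  interpret P: vectorspace K P by fact
  have gs: "free_gen K s \<in> carrier (free_mod K S)" using P.field_axioms s by (rule free_gen_in)
  have "g s \<in> carrier P" using g s by auto
  then show ?thesis using s
    by (subst free_lift_superset[OF P g gs, of "{s}"]) (auto simp: free_gen_def)
qed

section \<open>The universal property of the tensor product\<close>

definition bilinear_map ::
    "('k, 'r) ring_scheme \<Rightarrow> ('k, 'v, 'm) module_scheme \<Rightarrow> ('k, 'w, 'n) module_scheme
      \<Rightarrow> ('k, 'p, 'l) module_scheme \<Rightarrow> ('v \<Rightarrow> 'w \<Rightarrow> 'p) \<Rightarrow> bool" where
  "bilinear_map K V W P B \<longleftrightarrow>
    (\<forall>v\<in>carrier V. (\<lambda>w. B v w) \<in> module_hom K W P) \<and> (\<forall>w\<in>carrier W. (\<lambda>v. B v w) \<in> module_hom K V P)"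

lemma bilinear_mapD:
  assumes "bilinear_map K V W P B"
  shows "v \<in> carrier V \<Longrightarrow> (\<lambda>w. B v w) \<in> module_hom K W P"
    and "w \<in> carrier W \<Longrightarrow> (\<lambda>v. B v w) \<in> module_hom K V P"
    and "v \<in> carrier V \<Longrightarrow> w \<in> carrier W \<Longrightarrow> B v w \<in> carrier P"
  using assms by (auto simp: bilinear_map_def module_hom_def)

lemma bilinear_map_flip: "bilinear_map K V W P B \<Longrightarrow> bilinear_map K W V P (\<lambda>w v. B v w)"
  by (auto simp: bilinear_map_def)

context
  fixes K :: "('k, 'r) ring_scheme" and V :: "('k, 'v, 'm) module_scheme"
    and W :: "('k, 'w, 'n) module_scheme"
  assumes V: "vectorspace K V" and W: "vectorspace K W"
begin

interpretation V: vectorspace K V by (rule V)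
interpretation W: vectorspace K W by (rule W)

abbreviation (input) "pair_mod \<equiv> free_mod K (carrier V \<times> carrier W)"

interpretation F: vectorspace K pair_mod by (rule free_mod_vectorspace) (rule V.field_axioms)

lemma free_gen_pair_in: "v \<in> carrier V \<Longrightarrow> w \<in> carrier W \<Longrightarrow> free_gen K (v, w) \<in> carrier pair_mod"
  by (rule free_gen_in) (auto simp: V.field_axioms)

lemma tensor_relators_subset: "tensor_relators K V W \<subseteq> carrier pair_mod"
  unfolding tensor_relators_def Let_def
  by (intro Un_least subsetI; elim CollectE exE conjE; hypsubst; 
      intro F.M.minus_closed F.M.add.m_closed F.smult_closed free_gen_pair_in) auto

lemma tensor_null_subspace: "VectorSpace.subspace K (tensor_null K V W) pair_mod"
  unfolding tensor_null_def by (rule F.span_is_subspace) (rule tensor_relators_subset)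

lemma tensor_relators_null: "r \<in> tensor_relators K V W \<Longrightarrow> r \<in> tensor_null K V W"
  using F.in_own_span[OF tensor_relators_subset] by (auto simp: tensor_null_def)

lemma tensor_vectorspace: "vectorspace K (tensor K V W)"
  unfolding tensor_def by (rule quot_vectorspace) (rule tensor_null_subspace)

interpretation T: vectorspace K "tensor K V W" by (rule tensor_vectorspace)

lemma pure_tensor_in: "v \<in> carrier V \<Longrightarrow> w \<in> carrier W \<Longrightarrow> pure_tensor K V W v w \<in> carrier (tensor K V W)"
  unfolding tensor_def pure_tensor_def using free_gen_pair_in by (auto simp: quot_carrier[OF tensor_null_subspace])

lemma pure_tensor_bilinear: "bilinear_map K V W (tensor K V W) (pure_tensor K V W)"
proof -
  note eq = coset_eq_iff[OF tensor_null_subspace]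
  have 1: "pure_tensor K V W (v \<oplus>\<^bsub>V\<^esub> v') w = pure_tensor K V W v w \<oplus>\<^bsub>tensor K V W\<^esub> pure_tensor K V W v' w"
    if vw: "v \<in> carrier V" "v' \<in> carrier V" "w \<in> carrier W" for v v' w
  proof -
    have "free_gen K (v \<oplus>\<^bsub>V\<^esub> v', w) \<ominus>\<^bsub>pair_mod\<^esub> (free_gen K (v, w) \<oplus>\<^bsub>pair_mod\<^esub> free_gen K (v', w)) \<in> tensor_relators K V W"
      using vw unfolding tensor_relators_def Let_def by blast
    then show ?thesis unfolding tensor_def pure_tensor_def
      using vw tensor_relators_null free_gen_pair_in
      by (subst quot_add[OF tensor_null_subspace]) (auto simp: eq simp del: free_mod_simps)
  qed
  have 2: "pure_tensor K V W v (w \<oplus>\<^bsub>W\<^esub> w') = pure_tensor K V W v w \<oplus>\<^bsub>tensor K V W\<^esub> pure_tensor K V W v w'"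
    if vw: "v \<in> carrier V" "w' \<in> carrier W" "w \<in> carrier W" for v w' w
  proof -
    have "free_gen K (v, w \<oplus>\<^bsub>W\<^esub> w') \<ominus>\<^bsub>pair_mod\<^esub> (free_gen K (v, w) \<oplus>\<^bsub>pair_mod\<^esub> free_gen K (v, w')) \<in> tensor_relators K V W"
      using vw unfolding tensor_relators_def Let_def by blast
    then show ?thesis unfolding tensor_def pure_tensor_def
      using vw tensor_relators_null free_gen_pair_in
      by (subst quot_add[OF tensor_null_subspace]) (auto simp: eq simp del: free_mod_simps)
  qed
  have 3: "pure_tensor K V W (a \<odot>\<^bsub>V\<^esub> v) w = a \<odot>\<^bsub>tensor K V W\<^esub> pure_tensor K V W v w"
    if vw: "v \<in> carrier V" "a \<in> carrier K" "w \<in> carrier W" for v a w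
  proof -
    have "free_gen K (a \<odot>\<^bsub>V\<^esub> v, w) \<ominus>\<^bsub>pair_mod\<^esub> a \<odot>\<^bsub>pair_mod\<^esub> free_gen K (v, w) \<in> tensor_relators K V W"
      using vw unfolding tensor_relators_def Let_def by blast
    then show ?thesis unfolding tensor_def pure_tensor_def
      using vw tensor_relators_null free_gen_pair_in F.smult_closed[OF _ free_gen_pair_in]
      by (subst quot_smult[OF tensor_null_subspace]) (auto simp: eq simp del: free_mod_simps)
  qed
  have 4: "pure_tensor K V W v (a \<odot>\<^bsub>W\<^esub> w) = a \<odot>\<^bsub>tensor K V W\<^esub> pure_tensor K V W v w"
    if vw: "v \<in> carrier V" "a \<in> carrier K" "w \<in> carrier W" for v a w
  proof -
    have "free_gen K (v, a \<odot>\<^bsub>W\<^esub> w) \<ominus>\<^bsub>pair_mod\<^esub> a \<odot>\<^bsub>pair_mod\<^esub> free_gen K (v, w) \<in> tensor_relators K V W"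
      using vw unfolding tensor_relators_def Let_def by blast
    then show ?thesis unfolding tensor_def pure_tensor_def
      using vw tensor_relators_null free_gen_pair_in F.smult_closed[OF _ free_gen_pair_in]
      by (subst quot_smult[OF tensor_null_subspace]) (auto simp: eq simp del: free_mod_simps)
  qed
  show ?thesis unfolding bilinear_map_def
    by (intro conjI ballI module_homI) (auto simp: 1 2 3 4 pure_tensor_in)
qed

text \<open>Scalar multiples of a pure tensor are pure, so pure tensors span the tensor product already under
  addition.\<close>

lemma tensor_induct:
  assumes t: "t \<in> carrier (tensor K V W)"
    and pure: "\<And>v w. v \<in> carrier V \<Longrightarrow> w \<in> carrier W \<Longrightarrow> Q (pure_tensor K V W v w)"
    and add: "\<And>s t. s \<in> carrier (tensor K V W) \<Longrightarrow> t \<in> carrier (tensor K V W) \<Longrightarrow> Q s \<Longrightarrow> Q t \<Longrightarrow>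
      Q (s \<oplus>\<^bsub>tensor K V W\<^esub> t)"
  shows "Q t"
proof -
  note B = pure_tensor_bilinear
  let ?p = "\<lambda>f. tensor_null K V W +>\<^bsub>pair_mod\<^esub> f"
  have p: "?p \<in> module_hom K pair_mod (tensor K V W)"
    unfolding tensor_def by (rule quot_proj_hom) (rule tensor_null_subspace)
  \<comment> \<open>closure under scalar multiples is carried along, since a multiple of a pure tensor is pure\<close>
  have "\<forall>a\<in>carrier K. Q (?p (a \<odot>\<^bsub>pair_mod\<^esub> f))" if "f \<in> carrier pair_mod" for f
    using V.field_axioms that
  proof (rule free_mod_induct)
    fix s assume "s \<in> carrier V \<times> carrier W"
    then obtain v w where s: "s = (v, w)" "v \<in> carrier V" "w \<in> carrier W" by auto
    have "?p (a \<odot>\<^bsub>pair_mod\<^esub> free_gen K s) = pure_tensor K V W (a \<odot>\<^bsub>V\<^esub> v) w" if "a \<in> carrier K" for a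
      using s that module_hom_smult[OF p that free_gen_pair_in] module_hom_smult[OF bilinear_mapD(2)[OF B s(3)] that s(2)]
      unfolding pure_tensor_def by metis
    then show "\<forall>a\<in>carrier K. Q (?p (a \<odot>\<^bsub>pair_mod\<^esub> free_gen K s))" using pure s by auto
  next
    have "?p (\<lambda>s. \<zero>\<^bsub>K\<^esub>) = \<zero>\<^bsub>tensor K V W\<^esub>"
      using module_hom_zero[OF F.vectorspace_axioms T.vectorspace_axioms p] by simp
    also have "\<dots> = pure_tensor K V W \<zero>\<^bsub>V\<^esub> \<zero>\<^bsub>W\<^esub>"
      using module_hom_zero[OF V T.vectorspace_axioms bilinear_mapD(2)[OF B, of "\<zero>\<^bsub>W\<^esub>"]] by simp
    finally have "Q (?p (\<lambda>s. \<zero>\<^bsub>K\<^esub>))" using pure by simp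
    moreover have "a \<odot>\<^bsub>pair_mod\<^esub> (\<lambda>s. \<zero>\<^bsub>K\<^esub>) = (\<lambda>s. \<zero>\<^bsub>K\<^esub>)" if "a \<in> carrier K" for a using that by auto
    ultimately show "\<forall>a\<in>carrier K. Q (?p (a \<odot>\<^bsub>pair_mod\<^esub> (\<lambda>s. \<zero>\<^bsub>K\<^esub>)))" by metis
  next
    fix f g assume fg: "f \<in> carrier pair_mod" "g \<in> carrier pair_mod"
      "\<forall>a\<in>carrier K. Q (?p (a \<odot>\<^bsub>pair_mod\<^esub> f))" "\<forall>a\<in>carrier K. Q (?p (a \<odot>\<^bsub>pair_mod\<^esub> g))"
    show "\<forall>a\<in>carrier K. Q (?p (a \<odot>\<^bsub>pair_mod\<^esub> (f \<oplus>\<^bsub>pair_mod\<^esub> g)))"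
    proof
      fix a assume a: "a \<in> carrier K"
      have af: "a \<odot>\<^bsub>pair_mod\<^esub> f \<in> carrier pair_mod" "a \<odot>\<^bsub>pair_mod\<^esub> g \<in> carrier pair_mod" using a fg by (intro F.smult_closed; simp)+
      have "?p (a \<odot>\<^bsub>pair_mod\<^esub> (f \<oplus>\<^bsub>pair_mod\<^esub> g)) = ?p (a \<odot>\<^bsub>pair_mod\<^esub> f) \<oplus>\<^bsub>tensor K V W\<^esub> ?p (a \<odot>\<^bsub>pair_mod\<^esub> g)"
        unfolding F.smult_r_distr[OF a fg(1,2)] by (rule module_hom_add[OF p af])
      moreover have "Q \<dots>" using add a fg af module_hom_in[OF p] by blast
      ultimately show "Q (?p (a \<odot>\<^bsub>pair_mod\<^esub> (f \<oplus>\<^bsub>pair_mod\<^esub> g)))" by simp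
    qed
  next
    fix b f assume b: "b \<in> carrier K" and f: "f \<in> carrier pair_mod" "\<forall>a\<in>carrier K. Q (?p (a \<odot>\<^bsub>pair_mod\<^esub> f))"
    have "a \<odot>\<^bsub>pair_mod\<^esub> (b \<odot>\<^bsub>pair_mod\<^esub> f) = (a \<otimes>\<^bsub>K\<^esub> b) \<odot>\<^bsub>pair_mod\<^esub> f" if "a \<in> carrier K" for a
      by (rule F.smult_assoc1[OF that b f(1), symmetric])
    then show "\<forall>a\<in>carrier K. Q (?p (a \<odot>\<^bsub>pair_mod\<^esub> (b \<odot>\<^bsub>pair_mod\<^esub> f)))"
      using b f(2) by (metis V.R.m_closed)
  qed
  moreover obtain f where f: "f \<in> carrier pair_mod" "t = ?p f"
    using t unfolding tensor_def by (auto simp: quot_carrier[OF tensor_null_subspace])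
  moreover have "\<one>\<^bsub>K\<^esub> \<odot>\<^bsub>pair_mod\<^esub> f = f" using f F.smult_one by blast
  ultimately show ?thesis by (metis V.R.one_closed)
qed

text \<open>A bilinear map sends every defining relator to zero, hence its extension to the free module factors
  through the quotient.\<close>

lemma tensor_lift:
  assumes P: "vectorspace K P" and B: "bilinear_map K V W P B"
  shows tensor_lift_hom: "tensor_lift K P B \<in> module_hom K (tensor K V W) P"
    and tensor_lift_pure: "v \<in> carrier V \<Longrightarrow> w \<in> carrier W \<Longrightarrow>
      tensor_lift K P B (pure_tensor K V W v w) = B v w"
proof -
  interpret P: vectorspace K P by fact
  let ?h = "free_lift K P (\<lambda>(v, w). B v w)"
  note Bc = bilinear_mapD(3)[OF B]
  have g: "(\<lambda>(v, w). B v w) \<in> carrier V \<times> carrier W \<rightarrow> carrier P" using Bc by auto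
  have h: "?h \<in> module_hom K pair_mod P" by (rule free_lift_hom[OF P g])
  have hg: "?h (free_gen K (v, w)) = B v w" if "v \<in> carrier V" "w \<in> carrier W" for v w
    using free_lift_gen[OF P g, of "(v, w)"] that by simp
  have hd: "?h (f \<ominus>\<^bsub>pair_mod\<^esub> g) = ?h f \<ominus>\<^bsub>P\<^esub> ?h g" if "f \<in> carrier pair_mod" "g \<in> carrier pair_mod" for f g
    using that by (rule module_hom_minus[OF F.vectorspace_axioms P h])
  have ha: "?h (f \<oplus>\<^bsub>pair_mod\<^esub> g) = ?h f \<oplus>\<^bsub>P\<^esub> ?h g" if "f \<in> carrier pair_mod" "g \<in> carrier pair_mod" for f g
    using that by (rule module_hom_add[OF h])
  have hs: "?h (a \<odot>\<^bsub>pair_mod\<^esub> f) = a \<odot>\<^bsub>P\<^esub> ?h f" if "a \<in> carrier K" "f \<in> carrier pair_mod" for a f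
    using that by (rule module_hom_smult[OF h])
  have ker: "VectorSpace.subspace K {f \<in> carrier pair_mod. ?h f \<in> {\<zero>\<^bsub>P\<^esub>}} pair_mod"
    by (rule subspace_vimage[OF F.vectorspace_axioms h subspace_zero[OF P]])
  have hr: "?h r = \<zero>\<^bsub>P\<^esub>" if "r \<in> tensor_relators K V W" for r
    using that unfolding tensor_relators_def Let_def
  proof (elim UnE CollectE exE conjE)
    fix v v' w assume "r = free_gen K (v \<oplus>\<^bsub>V\<^esub> v', w) \<ominus>\<^bsub>pair_mod\<^esub> (free_gen K (v, w) \<oplus>\<^bsub>pair_mod\<^esub> free_gen K (v', w))"
      and vw: "v \<in> carrier V" "v' \<in> carrier V" "w \<in> carrier W"
    then show ?thesis
      using module_hom_add[OF bilinear_mapD(2)[OF B vw(3)] vw(1,2)] Bc vw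
      by (simp add: hd ha hs hg free_gen_pair_in F.M.add.m_closed[OF free_gen_pair_in free_gen_pair_in] del: free_mod_simps)
  next
    fix v w w' assume "r = free_gen K (v, w \<oplus>\<^bsub>W\<^esub> w') \<ominus>\<^bsub>pair_mod\<^esub> (free_gen K (v, w) \<oplus>\<^bsub>pair_mod\<^esub> free_gen K (v, w'))"
      and vw: "v \<in> carrier V" "w \<in> carrier W" "w' \<in> carrier W"
    then show ?thesis
      using module_hom_add[OF bilinear_mapD(1)[OF B vw(1)] vw(2,3)] Bc vw
      by (simp add: hd ha hs hg free_gen_pair_in F.M.add.m_closed[OF free_gen_pair_in free_gen_pair_in] del: free_mod_simps)
  next
    fix a v w assume "r = free_gen K (a \<odot>\<^bsub>V\<^esub> v, w) \<ominus>\<^bsub>pair_mod\<^esub> a \<odot>\<^bsub>pair_mod\<^esub> free_gen K (v, w)"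
      and vw: "a \<in> carrier K" "v \<in> carrier V" "w \<in> carrier W"
    then show ?thesis
      using module_hom_smult[OF bilinear_mapD(2)[OF B vw(3)] vw(1,2)] Bc vw
      by (simp add: hd ha hs hg free_gen_pair_in F.smult_closed[OF _ free_gen_pair_in] del: free_mod_simps)
  next
    fix a v w assume "r = free_gen K (v, a \<odot>\<^bsub>W\<^esub> w) \<ominus>\<^bsub>pair_mod\<^esub> a \<odot>\<^bsub>pair_mod\<^esub> free_gen K (v, w)"
      and vw: "a \<in> carrier K" "v \<in> carrier V" "w \<in> carrier W"
    then show ?thesis
      using module_hom_smult[OF bilinear_mapD(1)[OF B vw(2)] vw(1,3)] Bc vw
      by (simp add: hd ha hs hg free_gen_pair_in F.smult_closed[OF _ free_gen_pair_in] del: free_mod_simps)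
  qed
  have "tensor_null K V W \<subseteq> {f \<in> carrier pair_mod. ?h f \<in> {\<zero>\<^bsub>P\<^esub>}}"
    unfolding tensor_null_def using tensor_relators_subset hr by (intro span_minimal[OF ker]) auto
  then have kill: "?h f = \<zero>\<^bsub>P\<^esub>" if "f \<in> tensor_null K V W" for f using that by auto
  have *: "tensor_lift K P B = (\<lambda>X. the_elem (?h ` X))" by (simp add: tensor_lift_def fun_eq_iff)
  show "tensor_lift K P B \<in> module_hom K (tensor K V W) P"
    unfolding tensor_def * by (rule quot_lift_hom[OF tensor_null_subspace P h kill])
  show "tensor_lift K P B (pure_tensor K V W v w) = B v w" if "v \<in> carrier V" "w \<in> carrier W"
    unfolding * pure_tensor_def
    using quot_lift_coset[OF tensor_null_subspace P h kill free_gen_pair_in[OF that]] hg that by simp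
qed

text \<open>All identities between maps out of tensor products below are checked on pure tensors with this rule.\<close>

lemma tensor_hom_eqI:
  assumes f: "f \<in> module_hom K (tensor K V W) P" and g: "g \<in> module_hom K (tensor K V W) P"
    and "\<And>v w. v \<in> carrier V \<Longrightarrow> w \<in> carrier W \<Longrightarrow> f (pure_tensor K V W v w) = g (pure_tensor K V W v w)"
    and t: "t \<in> carrier (tensor K V W)"
  shows "f t = g t"
  using t by (rule tensor_induct[where Q = "\<lambda>t. f t = g t"]) (simp_all add: assms(3) module_hom_add[OF f] module_hom_add[OF g])

end

section \<open>Linear functionals\<close>

lemma scalars_simps [simp]:
  "carrier (scalars K) = carrier K" "\<zero>\<^bsub>scalars K\<^esub> = \<zero>\<^bsub>K\<^esub>"
  "a \<oplus>\<^bsub>scalars K\<^esub> b = a \<oplus>\<^bsub>K\<^esub> b" "a \<odot>\<^bsub>scalars K\<^esub> b = a \<otimes>\<^bsub>K\<^esub> b"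
  by (simp_all add: scalars_def)

lemma scalars_vectorspace:
  fixes K (structure)
  assumes "field K"
  shows "vectorspace K (scalars K)"
proof -
  interpret field K by fact
  show ?thesis
  proof (rule vs_criteria)
    show "\<forall>v\<in>carrier (scalars K). \<exists>neg_v\<in>carrier (scalars K). v \<oplus>\<^bsub>scalars K\<^esub> neg_v = \<zero>\<^bsub>scalars K\<^esub>"
      using r_neg by auto
  qed (auto simp: assms m_assoc l_distr r_distr a_assoc intro: a_comm)
qed

abbreviation dual :: "('k, 'r) ring_scheme \<Rightarrow> ('k, 'v, 'm) module_scheme \<Rightarrow> ('v \<Rightarrow> 'k) set" where
  "dual K V \<equiv> module_hom K V (scalars K)"

lemma dual_add:
  assumes "vectorspace K V" "f \<in> dual K V" "g \<in> dual K V"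
  shows "(\<lambda>x. f x \<oplus>\<^bsub>K\<^esub> g x) \<in> dual K V"
  using module_hom_plus[OF assms(1) scalars_vectorspace assms(2,3)] vectorspace.axioms(2)[OF assms(1)] by simp

lemma dual_smult:
  assumes "vectorspace K V" "f \<in> dual K V" "a \<in> carrier K"
  shows "(\<lambda>x. a \<otimes>\<^bsub>K\<^esub> f x) \<in> dual K V"
  using module_hom_scale[OF assms(1) scalars_vectorspace assms(2,3)] vectorspace.axioms(2)[OF assms(1)] by simp

lemma dual_zero:
  assumes "vectorspace K V"
  shows "(\<lambda>x. \<zero>\<^bsub>K\<^esub>) \<in> dual K V"
proof -
  interpret V: vectorspace K V by fact
  show ?thesis by (intro module_homI) auto
qed

text \<open>By Zorn's lemma there is a largest subspace \<open>H\<close> above \<open>U\<close> that avoids \<open>x\<close>. It is a complement of the line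
  through \<open>x\<close>: enlarging \<open>H\<close> by any further vector \<open>y\<close> brings in \<open>x\<close>, and the resulting relation can be solved
  for \<open>y\<close> because \<open>x \<notin> H\<close>.\<close>

lemma hyperplane_exists:
  assumes U: "VectorSpace.subspace K U V" and x: "x \<in> carrier V" "x \<notin> U"
  obtains H where "VectorSpace.subspace K H V" "U \<subseteq> H" "x \<notin> H"
    "\<And>y. y \<in> carrier V \<Longrightarrow> \<exists>a\<in>carrier K. y \<ominus>\<^bsub>V\<^esub> a \<odot>\<^bsub>V\<^esub> x \<in> H"
proof -
  interpret V: vectorspace K V using U by (rule subspaceD)
  define S where "S = {H. VectorSpace.subspace K H V \<and> U \<subseteq> H \<and> x \<notin> H}"
  have "\<exists>M\<in>S. \<forall>X\<in>S. M \<subseteq> X \<longrightarrow> X = M"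
  proof (rule subset_Zorn_nonempty)
    show "S \<noteq> {}" using U x by (auto simp: S_def)
    fix C assume C: "C \<noteq> {}" "subset.chain S C"
    have CS: "VectorSpace.subspace K H V" "U \<subseteq> H" "x \<notin> H" if "H \<in> C" for H
      using that C by (auto simp: subset.chain_def S_def)
    have "VectorSpace.subspace K (\<Union>C) V"
    proof (rule subspaceI[OF V.vectorspace_axioms])
      show "\<Union>C \<subseteq> carrier V" using subspaceD(2)[OF CS(1)] by auto
      obtain H where "H \<in> C" using C(1) by auto
      then show "\<zero>\<^bsub>V\<^esub> \<in> \<Union>C" using subspaceD(3)[OF CS(1)] by auto
    next
      fix a y assume "a \<in> carrier K" "y \<in> \<Union>C"
      then show "a \<odot>\<^bsub>V\<^esub> y \<in> \<Union>C" using subspaceD(6)[OF CS(1)] by auto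
    next
      fix y z assume "y \<in> \<Union>C" "z \<in> \<Union>C"
      then obtain G H where GH: "G \<in> C" "H \<in> C" "y \<in> G" "z \<in> H" by auto
      then have "G \<subseteq> H \<or> H \<subseteq> G" using C(2) by (auto simp: subset.chain_def)
      then show "y \<oplus>\<^bsub>V\<^esub> z \<in> \<Union>C"
      proof
        assume "G \<subseteq> H" then show ?thesis using GH subspaceD(5)[OF CS(1)[OF GH(2)]] by auto
      next
        assume "H \<subseteq> G" then show ?thesis using GH subspaceD(5)[OF CS(1)[OF GH(1)]] by auto
      qed
    qed
    moreover obtain H where "H \<in> C" using C(1) by auto
    then have "U \<subseteq> \<Union>C" using CS(2)[of H] by auto
    ultimately show "\<Union>C \<in> S" using CS(3) by (auto simp: S_def)
  qed
  then obtain H where "H \<in> S" and max: "\<And>X. X \<in> S \<Longrightarrow> H \<subseteq> X \<Longrightarrow> X = H" by auto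
  then have H: "VectorSpace.subspace K H V" "U \<subseteq> H" "x \<notin> H" by (auto simp: S_def)
  note Hc = subspaceD(4)[OF H(1)]
  have "\<exists>a\<in>carrier K. y \<ominus>\<^bsub>V\<^esub> a \<odot>\<^bsub>V\<^esub> x \<in> H" if y: "y \<in> carrier V" for y
  proof (cases "y \<in> H")
    case True
    have "\<zero>\<^bsub>K\<^esub> \<odot>\<^bsub>V\<^esub> x = \<zero>\<^bsub>V\<^esub>" using x by simp
    then have "y \<ominus>\<^bsub>V\<^esub> \<zero>\<^bsub>K\<^esub> \<odot>\<^bsub>V\<^esub> x \<in> H" using True subspaceD(3)[OF H(1)] subspace_minus[OF H(1)] by simp
    then show ?thesis by blast
  next
    case False
    define H' where "H' = (\<Union>h\<in>H. \<Union>a\<in>carrier K. {h \<oplus>\<^bsub>V\<^esub> a \<odot>\<^bsub>V\<^esub> y})"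
    have H'I: "h \<oplus>\<^bsub>V\<^esub> a \<odot>\<^bsub>V\<^esub> y \<in> H'" if "h \<in> H" "a \<in> carrier K" for h a
      using that by (auto simp: H'_def)
    have H'sub: "VectorSpace.subspace K H' V"
    proof (rule subspaceI[OF V.vectorspace_axioms])
      show "H' \<subseteq> carrier V" using Hc y by (auto simp: H'_def)
      show "\<zero>\<^bsub>V\<^esub> \<in> H'" using H'I[OF subspaceD(3)[OF H(1)] V.R.zero_closed] y by simp
    next
      fix u v assume "u \<in> H'" "v \<in> H'"
      then obtain h a h' a' where *: "h \<in> H" "a \<in> carrier K" "h' \<in> H" "a' \<in> carrier K"
        "u = h \<oplus>\<^bsub>V\<^esub> a \<odot>\<^bsub>V\<^esub> y" "v = h' \<oplus>\<^bsub>V\<^esub> a' \<odot>\<^bsub>V\<^esub> y" by (auto simp: H'_def)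
      then have "u \<oplus>\<^bsub>V\<^esub> v = (h \<oplus>\<^bsub>V\<^esub> h') \<oplus>\<^bsub>V\<^esub> (a \<oplus>\<^bsub>K\<^esub> a') \<odot>\<^bsub>V\<^esub> y"
        using y Hc by (simp add: V.smult_l_distr V.M.a_ac)
      then show "u \<oplus>\<^bsub>V\<^esub> v \<in> H'" using * H'I[OF subspaceD(5)[OF H(1)]] by auto
    next
      fix c u assume c: "c \<in> carrier K" and "u \<in> H'"
      then obtain h a where *: "h \<in> H" "a \<in> carrier K" "u = h \<oplus>\<^bsub>V\<^esub> a \<odot>\<^bsub>V\<^esub> y" by (auto simp: H'_def)
      then have "c \<odot>\<^bsub>V\<^esub> u = c \<odot>\<^bsub>V\<^esub> h \<oplus>\<^bsub>V\<^esub> (c \<otimes>\<^bsub>K\<^esub> a) \<odot>\<^bsub>V\<^esub> y"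
        using c y Hc by (simp add: V.smult_r_distr V.smult_assoc1)
      then show "c \<odot>\<^bsub>V\<^esub> u \<in> H'" using c * H'I[OF subspaceD(6)[OF H(1)]] by auto
    qed
    have HH': "H \<subseteq> H'"
    proof
      fix h assume "h \<in> H"
      then show "h \<in> H'" using H'I[OF _ V.R.zero_closed, of h] y Hc by simp
    qed
    have "y \<in> H'" using H'I[OF subspaceD(3)[OF H(1)] V.R.one_closed] y by simp
    then have "H' \<notin> S" using max[OF _ HH'] False by auto
    then have "x \<in> H'" using H'sub HH' H(2) by (auto simp: S_def)
    then obtain h a where ha: "h \<in> H" "a \<in> carrier K" "x = h \<oplus>\<^bsub>V\<^esub> a \<odot>\<^bsub>V\<^esub> y" by (auto simp: H'_def)
    have a0: "a \<noteq> \<zero>\<^bsub>K\<^esub>"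
    proof
      assume "a = \<zero>\<^bsub>K\<^esub>" then have "x = h" using ha y Hc by simp
      then show False using ha H by simp
    qed
    let ?b = "inv\<^bsub>K\<^esub> a"
    have b: "?b \<in> carrier K" using ha a0 by simp
    have "?b \<otimes>\<^bsub>K\<^esub> a = \<one>\<^bsub>K\<^esub>" using ha a0 V.field_Units by (intro V.R.Units_l_inv) auto
    then have "?b \<odot>\<^bsub>V\<^esub> (a \<odot>\<^bsub>V\<^esub> y) = y" using V.smult_assoc1[OF b ha(2) y] y by simp
    then have "?b \<odot>\<^bsub>V\<^esub> x = ?b \<odot>\<^bsub>V\<^esub> h \<oplus>\<^bsub>V\<^esub> y" using ha b y Hc by (simp add: V.smult_r_distr)
    then have "y \<ominus>\<^bsub>V\<^esub> ?b \<odot>\<^bsub>V\<^esub> x = \<ominus>\<^bsub>V\<^esub> (?b \<odot>\<^bsub>V\<^esub> h)"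
      using ha b y Hc by (simp add: a_minus_def V.M.minus_add V.M.a_ac V.M.r_neg V.M.r_neg1 V.M.r_neg2)
    then show ?thesis using subspace_uminus[OF H(1) subspaceD(6)[OF H(1) b ha(1)]] by (intro bexI[OF _ b]) simp
  qed
  then show ?thesis using that H by blast
qed

text \<open>The functional is the coordinate along \<open>x\<close> in the decomposition of \<open>V\<close> into a hyperplane containing \<open>U\<close> and
  the line through \<open>x\<close>.\<close>

lemma dual_separates:
  assumes U: "VectorSpace.subspace K U V" and x: "x \<in> carrier V" "x \<notin> U"
  obtains f where "f \<in> dual K V" "f x = \<one>\<^bsub>K\<^esub>" "\<And>u. u \<in> U \<Longrightarrow> f u = \<zero>\<^bsub>K\<^esub>"
proof -
  interpret V: vectorspace K V using U by (rule subspaceD)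
  obtain H where H: "VectorSpace.subspace K H V" "U \<subseteq> H" "x \<notin> H"
    and ex: "\<And>y. y \<in> carrier V \<Longrightarrow> \<exists>a\<in>carrier K. y \<ominus>\<^bsub>V\<^esub> a \<odot>\<^bsub>V\<^esub> x \<in> H"
    using hyperplane_exists[OF U x] by blast
  note Hc = subspaceD(4)[OF H(1)]
  have uniq: "a = b" if "a \<in> carrier K" "b \<in> carrier K" "y \<in> carrier V"
    "y \<ominus>\<^bsub>V\<^esub> a \<odot>\<^bsub>V\<^esub> x \<in> H" "y \<ominus>\<^bsub>V\<^esub> b \<odot>\<^bsub>V\<^esub> x \<in> H" for a b y
  proof (rule ccontr)
    assume "a \<noteq> b"
    let ?c = "b \<ominus>\<^bsub>K\<^esub> a"
    have c: "?c \<in> carrier K" "?c \<noteq> \<zero>\<^bsub>K\<^esub>" using that \<open>a \<noteq> b\<close> by auto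
    have "(y \<ominus>\<^bsub>V\<^esub> a \<odot>\<^bsub>V\<^esub> x) \<ominus>\<^bsub>V\<^esub> (y \<ominus>\<^bsub>V\<^esub> b \<odot>\<^bsub>V\<^esub> x) = ?c \<odot>\<^bsub>V\<^esub> x"
      using that x by (simp add: a_minus_def V.smult_l_distr V.smult_l_minus V.M.minus_add
        V.M.a_ac V.M.r_neg V.M.r_neg1 V.M.r_neg2)
    then have "?c \<odot>\<^bsub>V\<^esub> x \<in> H" using subspace_minus[OF H(1) that(4,5)] by simp
    moreover have "inv\<^bsub>K\<^esub> ?c \<otimes>\<^bsub>K\<^esub> ?c = \<one>\<^bsub>K\<^esub>" using c V.field_Units by (intro V.R.Units_l_inv) auto
    then have "inv\<^bsub>K\<^esub> ?c \<odot>\<^bsub>V\<^esub> (?c \<odot>\<^bsub>V\<^esub> x) = x"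
      using c x V.smult_assoc1[of "inv\<^bsub>K\<^esub> ?c" ?c x] by simp
    ultimately show False using subspaceD(6)[OF H(1), of "inv\<^bsub>K\<^esub> ?c"] c H(3) by force
  qed
  define f where "f y = (THE a. a \<in> carrier K \<and> y \<ominus>\<^bsub>V\<^esub> a \<odot>\<^bsub>V\<^esub> x \<in> H)" for y
  have f: "f y = a" if "a \<in> carrier K" "y \<in> carrier V" "y \<ominus>\<^bsub>V\<^esub> a \<odot>\<^bsub>V\<^esub> x \<in> H" for a y
    unfolding f_def using that uniq by (intro the_equality) auto
  have fc: "f y \<in> carrier K" "y \<ominus>\<^bsub>V\<^esub> f y \<odot>\<^bsub>V\<^esub> x \<in> H" if "y \<in> carrier V" for y
    using ex[OF that] f[OF _ that] by auto
  show ?thesis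
  proof
    show "f \<in> dual K V"
    proof (rule module_homI)
      fix y z assume yz: "y \<in> carrier V" "z \<in> carrier V"
      have "(y \<oplus>\<^bsub>V\<^esub> z) \<ominus>\<^bsub>V\<^esub> (f y \<oplus>\<^bsub>K\<^esub> f z) \<odot>\<^bsub>V\<^esub> x = (y \<ominus>\<^bsub>V\<^esub> f y \<odot>\<^bsub>V\<^esub> x) \<oplus>\<^bsub>V\<^esub> (z \<ominus>\<^bsub>V\<^esub> f z \<odot>\<^bsub>V\<^esub> x)"
        using yz fc x by (simp add: a_minus_def V.smult_l_distr V.M.minus_add V.M.a_ac)
      also have "\<dots> \<in> H" using yz fc by (intro subspaceD(5)[OF H(1)])
      finally show "f (y \<oplus>\<^bsub>V\<^esub> z) = f y \<oplus>\<^bsub>scalars K\<^esub> f z" using yz fc by (intro f) auto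
    next
      fix a y assume ay: "a \<in> carrier K" "y \<in> carrier V"
      have "a \<odot>\<^bsub>V\<^esub> y \<ominus>\<^bsub>V\<^esub> (a \<otimes>\<^bsub>K\<^esub> f y) \<odot>\<^bsub>V\<^esub> x = a \<odot>\<^bsub>V\<^esub> (y \<ominus>\<^bsub>V\<^esub> f y \<odot>\<^bsub>V\<^esub> x)"
        using ay fc x by (simp add: a_minus_def V.smult_r_distr V.smult_r_minus V.smult_assoc1)
      also have "\<dots> \<in> H" using ay fc by (intro subspaceD(6)[OF H(1)])
      finally show "f (a \<odot>\<^bsub>V\<^esub> y) = a \<odot>\<^bsub>scalars K\<^esub> f y" using ay fc by (intro f) auto
    qed (use fc in auto)
    show "f x = \<one>\<^bsub>K\<^esub>"
      using x subspaceD(3)[OF H(1)] by (intro f) (auto simp: a_minus_def V.M.r_neg)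
    show "f u = \<zero>\<^bsub>K\<^esub>" if "u \<in> U" for u
    proof (rule f)
      have u: "u \<in> H" "u \<in> carrier V" using that H Hc by auto
      then show "u \<in> carrier V" by simp
      have "\<zero>\<^bsub>K\<^esub> \<odot>\<^bsub>V\<^esub> x = \<zero>\<^bsub>V\<^esub>" using x by simp
      then show "u \<ominus>\<^bsub>V\<^esub> \<zero>\<^bsub>K\<^esub> \<odot>\<^bsub>V\<^esub> x \<in> H" using u subspaceD(3)[OF H(1)] subspace_minus[OF H(1)] by simp
    qed auto
  qed
qed

section \<open>Contraction and tensor rank\<close>

text \<open>The maps \<open>id \<otimes> f\<close> and \<open>f \<otimes> id\<close>, with \<open>V \<otimes> K\<close> and \<open>K \<otimes> W\<close> identified with \<open>V\<close> and \<open>W\<close>.\<close>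

definition contract_right ::
    "('k, 'r) ring_scheme \<Rightarrow> ('k, 'v, 'm) module_scheme \<Rightarrow> ('w \<Rightarrow> 'k) \<Rightarrow> ('v \<times> 'w \<Rightarrow> 'k) set \<Rightarrow> 'v" where
  "contract_right K V f = tensor_lift K V (\<lambda>v w. f w \<odot>\<^bsub>V\<^esub> v)"

definition contract_left ::
    "('k, 'r) ring_scheme \<Rightarrow> ('k, 'w, 'm) module_scheme \<Rightarrow> ('v \<Rightarrow> 'k) \<Rightarrow> ('v \<times> 'w \<Rightarrow> 'k) set \<Rightarrow> 'w" where
  "contract_left K W f = tensor_lift K W (\<lambda>v w. f v \<odot>\<^bsub>W\<^esub> w)"

lemma contract_right_bilinear:
  assumes V: "vectorspace K V" and f: "f \<in> dual K W"
  shows "bilinear_map K V W V (\<lambda>v w. f w \<odot>\<^bsub>V\<^esub> v)"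
proof -
  interpret V: vectorspace K V by fact
  show ?thesis unfolding bilinear_map_def
    using module_hom_in[OF f] module_hom_add[OF f] module_hom_smult[OF f]
    by (intro conjI ballI module_homI)
      (auto simp: V.smult_l_distr V.smult_r_distr V.smult_assoc1 V.R.m_comm simp flip: V.smult_assoc1)
qed

lemma contract_right_hom:
  assumes "vectorspace K V" "vectorspace K W" "f \<in> dual K W"
  shows "contract_right K V f \<in> module_hom K (tensor K V W) V"
  unfolding contract_right_def using assms by (intro tensor_lift_hom contract_right_bilinear)

lemma contract_right_pure:
  assumes "vectorspace K V" "vectorspace K W" "f \<in> dual K W" "v \<in> carrier V" "w \<in> carrier W"
  shows "contract_right K V f (pure_tensor K V W v w) = f w \<odot>\<^bsub>V\<^esub> v"
  unfolding contract_right_def using assms by (subst tensor_lift_pure[OF _ _ _ contract_right_bilinear]) auto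

lemma contract_left_hom:
  assumes "vectorspace K V" "vectorspace K W" "f \<in> dual K V"
  shows "contract_left K W f \<in> module_hom K (tensor K V W) W"
  unfolding contract_left_def using assms
  by (intro tensor_lift_hom bilinear_map_flip[OF contract_right_bilinear])

lemma contract_left_pure:
  assumes "vectorspace K V" "vectorspace K W" "f \<in> dual K V" "v \<in> carrier V" "w \<in> carrier W"
  shows "contract_left K W f (pure_tensor K V W v w) = f v \<odot>\<^bsub>W\<^esub> w"
  unfolding contract_left_def using assms
  by (subst tensor_lift_pure[OF _ _ _ bilinear_map_flip[OF contract_right_bilinear]]) auto

lemma tensor_finite_sum:
  assumes V: "vectorspace K V" and W: "vectorspace K W" and t: "t \<in> carrier (tensor K V W)"
  shows "\<exists>(I::nat set) a b. finite I \<and> a \<in> I \<rightarrow> carrier V \<and> b \<in> I \<rightarrow> carrier W \<and>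
     t = (\<Oplus>\<^bsub>tensor K V W\<^esub>i\<in>I. pure_tensor K V W (a i) (b i))"
proof -
  interpret T: vectorspace K "tensor K V W" using V W by (rule tensor_vectorspace)
  note pc = pure_tensor_in[OF V W]
  have "\<exists>(n::nat) a b. a \<in> {..<n} \<rightarrow> carrier V \<and> b \<in> {..<n} \<rightarrow> carrier W \<and>
     t = (\<Oplus>\<^bsub>tensor K V W\<^esub>i\<in>{..<n}. pure_tensor K V W (a i) (b i))"
  proof (rule tensor_induct[OF V W t])
    fix v w assume "v \<in> carrier V" "w \<in> carrier W"
    then show "\<exists>(n::nat) a b. a \<in> {..<n} \<rightarrow> carrier V \<and> b \<in> {..<n} \<rightarrow> carrier W \<and>
       pure_tensor K V W v w = (\<Oplus>\<^bsub>tensor K V W\<^esub>i\<in>{..<n}. pure_tensor K V W (a i) (b i))"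
      by (intro exI[of _ "1::nat"] exI[of _ "\<lambda>_. v"] exI[of _ "\<lambda>_. w"])
        (auto simp: pc lessThan_Suc)
  next
    fix s t
    assume "\<exists>(n::nat) a b. a \<in> {..<n} \<rightarrow> carrier V \<and> b \<in> {..<n} \<rightarrow> carrier W \<and>
       s = (\<Oplus>\<^bsub>tensor K V W\<^esub>i\<in>{..<n}. pure_tensor K V W (a i) (b i))"
    then obtain n :: nat and a b where s: "a \<in> {..<n} \<rightarrow> carrier V" "b \<in> {..<n} \<rightarrow> carrier W"
      "s = (\<Oplus>\<^bsub>tensor K V W\<^esub>i\<in>{..<n}. pure_tensor K V W (a i) (b i))" by blast
    assume "\<exists>(n::nat) a b. a \<in> {..<n} \<rightarrow> carrier V \<and> b \<in> {..<n} \<rightarrow> carrier W \<and>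
       t = (\<Oplus>\<^bsub>tensor K V W\<^esub>i\<in>{..<n}. pure_tensor K V W (a i) (b i))"
    then obtain m :: nat and c d where t: "c \<in> {..<m} \<rightarrow> carrier V" "d \<in> {..<m} \<rightarrow> carrier W"
      "t = (\<Oplus>\<^bsub>tensor K V W\<^esub>i\<in>{..<m}. pure_tensor K V W (c i) (d i))" by blast
    define a' b' where "a' i = (if i < n then a i else c (i - n))"
      and "b' i = (if i < n then b i else d (i - n))" for i
    let ?p = "\<lambda>i. pure_tensor K V W (a' i) (b' i)"
    have ab: "a' i \<in> carrier V" "b' i \<in> carrier W" if "i < n + m" for i
      using that s t by (auto simp: Pi_iff a'_def b'_def)
    have "(\<Oplus>\<^bsub>tensor K V W\<^esub>i\<in>{..<n + m}. ?p i)
       = (\<Oplus>\<^bsub>tensor K V W\<^esub>i\<in>{..<n} \<union> (\<lambda>i. i + n) ` {..<m}. ?p i)"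
    proof -
      have "{..<n + m} = {..<n} \<union> (\<lambda>i. i + n) ` {..<m}"
      proof (intro equalityI subsetI)
        fix i assume "i \<in> {..<n + m}"
        then have "i < n \<or> i - n < m \<and> i = (i - n) + n" by auto
        then show "i \<in> {..<n} \<union> (\<lambda>i. i + n) ` {..<m}" by blast
      qed auto
      then show ?thesis by simp
    qed
    also have "\<dots> = (\<Oplus>\<^bsub>tensor K V W\<^esub>i\<in>{..<n}. ?p i) \<oplus>\<^bsub>tensor K V W\<^esub> (\<Oplus>\<^bsub>tensor K V W\<^esub>i\<in>(\<lambda>i. i + n) ` {..<m}. ?p i)"
      using ab by (intro T.finsum_Un_disjoint) (auto intro!: pc)
    also have "(\<Oplus>\<^bsub>tensor K V W\<^esub>i\<in>(\<lambda>i. i + n) ` {..<m}. ?p i) = (\<Oplus>\<^bsub>tensor K V W\<^esub>i\<in>{..<m}. ?p (i + n))"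
      using ab by (intro T.finsum_reindex) (auto intro!: pc)
    also have "\<dots> = t" unfolding t(3) using t(1,2) by (intro T.finsum_cong') (auto intro!: pc simp: a'_def b'_def)
    also have "(\<Oplus>\<^bsub>tensor K V W\<^esub>i\<in>{..<n}. ?p i) = s"
      unfolding s(3) using s(1,2) by (intro T.finsum_cong') (auto intro!: pc simp: a'_def b'_def)
    finally have "s \<oplus>\<^bsub>tensor K V W\<^esub> t = (\<Oplus>\<^bsub>tensor K V W\<^esub>i\<in>{..<n + m}. ?p i)" by simp
    then show "\<exists>(n::nat) a b. a \<in> {..<n} \<rightarrow> carrier V \<and> b \<in> {..<n} \<rightarrow> carrier W \<and>
       s \<oplus>\<^bsub>tensor K V W\<^esub> t = (\<Oplus>\<^bsub>tensor K V W\<^esub>i\<in>{..<n}. pure_tensor K V W (a i) (b i))"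
      using ab by (intro exI[of _ "n + m"] exI[of _ a'] exI[of _ b']) auto
  qed
  then obtain n :: nat and a b where "a \<in> {..<n} \<rightarrow> carrier V" "b \<in> {..<n} \<rightarrow> carrier W"
    "t = (\<Oplus>\<^bsub>tensor K V W\<^esub>i\<in>{..<n}. pure_tensor K V W (a i) (b i))" by blast
  then show ?thesis by (intro exI[of _ "{..<n}"] exI[of _ a] exI[of _ b]) simp
qed

text \<open>A relation among the right-hand factors shortens a sum of values of a bilinear map. If the relation
  is normalised so that \<open>b j\<close> has coefficient one, subtracting \<open>d i \<odot> a j\<close> from each \<open>a i\<close> changes the sum by
  \<open>B (a j) (\<Oplus>i. d i \<odot> b i) = 0\<close> and makes the summand at \<open>j\<close> vanish. For relations among the left-hand factors the rule
  is used with the arguments of \<open>B\<close> exchanged.\<close>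

lemma bilinear_sum_reduce:
  assumes V: "vectorspace K V" and W: "vectorspace K W" and P: "vectorspace K P"
    and B: "bilinear_map K V W P B" and I: "finite I" "j \<in> I"
    and a: "a \<in> I \<rightarrow> carrier V" and b: "b \<in> I \<rightarrow> carrier W" and c: "c \<in> I \<rightarrow> carrier K" "c j \<noteq> \<zero>\<^bsub>K\<^esub>"
    and rel: "(\<Oplus>\<^bsub>W\<^esub>i\<in>I. c i \<odot>\<^bsub>W\<^esub> b i) = \<zero>\<^bsub>W\<^esub>"
  obtains a' where "a' \<in> I - {j} \<rightarrow> carrier V"
    "(\<Oplus>\<^bsub>P\<^esub>i\<in>I. B (a i) (b i)) = (\<Oplus>\<^bsub>P\<^esub>i\<in>I - {j}. B (a' i) (b i))"
proof -
  interpret V: vectorspace K V by fact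
  interpret W: vectorspace K W by fact
  interpret P: vectorspace K P by fact
  note Bc = bilinear_mapD(3)[OF B]
  have ai: "a i \<in> carrier V" and bi: "b i \<in> carrier W" and ci: "c i \<in> carrier K" if "i \<in> I" for i
    using a b c that by auto
  let ?u = "inv\<^bsub>K\<^esub> (c j)"
  have u: "?u \<in> carrier K" "?u \<otimes>\<^bsub>K\<^esub> c j = \<one>\<^bsub>K\<^esub>"
    using I c ci V.field_Units by (auto intro: V.R.Units_l_inv)
  define d where "d i = ?u \<otimes>\<^bsub>K\<^esub> c i" for i
  have di: "d i \<in> carrier K" if "i \<in> I" for i using that ci u by (auto simp: d_def)
  have dj: "d j = \<one>\<^bsub>K\<^esub>" using u by (simp add: d_def)
  have d0: "(\<Oplus>\<^bsub>W\<^esub>i\<in>I. d i \<odot>\<^bsub>W\<^esub> b i) = \<zero>\<^bsub>W\<^esub>"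
  proof -
    have "(\<Oplus>\<^bsub>W\<^esub>i\<in>I. d i \<odot>\<^bsub>W\<^esub> b i) = (\<Oplus>\<^bsub>W\<^esub>i\<in>I. ?u \<odot>\<^bsub>W\<^esub> (c i \<odot>\<^bsub>W\<^esub> b i))"
      using u ci bi by (intro W.finsum_cong') (auto simp: d_def W.smult_assoc1)
    also have "\<dots> = ?u \<odot>\<^bsub>W\<^esub> (\<Oplus>\<^bsub>W\<^esub>i\<in>I. c i \<odot>\<^bsub>W\<^esub> b i)"
      using u ci bi by (intro W.finsum_smult[symmetric]) auto
    finally show ?thesis using rel u by simp
  qed
  define a' where "a' i = a i \<ominus>\<^bsub>V\<^esub> d i \<odot>\<^bsub>V\<^esub> a j" for i
  have a'i: "a' i \<in> carrier V" if "i \<in> I" for i using that ai di I by (simp add: a'_def)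
  have split: "B (a i) (b i) = B (a' i) (b i) \<oplus>\<^bsub>P\<^esub> B (a j) (d i \<odot>\<^bsub>W\<^esub> b i)" if i: "i \<in> I" for i
  proof -
    have "a i = a' i \<oplus>\<^bsub>V\<^esub> d i \<odot>\<^bsub>V\<^esub> a j"
      using i ai di I by (simp add: a'_def a_minus_def V.M.a_assoc V.M.l_neg)
    then have "B (a i) (b i) = B (a' i) (b i) \<oplus>\<^bsub>P\<^esub> B (d i \<odot>\<^bsub>V\<^esub> a j) (b i)"
      using i a'i di ai I module_hom_add[OF bilinear_mapD(2)[OF B bi[OF i]]] by simp
    also have "B (d i \<odot>\<^bsub>V\<^esub> a j) (b i) = B (a j) (d i \<odot>\<^bsub>W\<^esub> b i)"
      using i di ai bi I module_hom_smult[OF bilinear_mapD(2)[OF B bi[OF i]]]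
        module_hom_smult[OF bilinear_mapD(1)[OF B ai[OF I(2)]]] by simp
    finally show ?thesis .
  qed
  have "a' j = \<zero>\<^bsub>V\<^esub>" using ai I by (simp add: a'_def dj a_minus_def V.M.r_neg)
  then have Bj: "B (a' j) (b j) = \<zero>\<^bsub>P\<^esub>"
    using module_hom_zero[OF V P bilinear_mapD(2)[OF B bi[OF I(2)]]] by simp
  have "(\<Oplus>\<^bsub>P\<^esub>i\<in>I. B (a i) (b i)) = (\<Oplus>\<^bsub>P\<^esub>i\<in>I. B (a' i) (b i) \<oplus>\<^bsub>P\<^esub> B (a j) (d i \<odot>\<^bsub>W\<^esub> b i))"
    using split Bc ai bi a'i di I by (intro P.finsum_cong') auto
  also have "\<dots> = (\<Oplus>\<^bsub>P\<^esub>i\<in>I. B (a' i) (b i)) \<oplus>\<^bsub>P\<^esub> (\<Oplus>\<^bsub>P\<^esub>i\<in>I. B (a j) (d i \<odot>\<^bsub>W\<^esub> b i))"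
    using Bc ai bi a'i di I by (intro P.finsum_addf) auto
  also have "(\<Oplus>\<^bsub>P\<^esub>i\<in>I. B (a j) (d i \<odot>\<^bsub>W\<^esub> b i)) = B (a j) (\<Oplus>\<^bsub>W\<^esub>i\<in>I. d i \<odot>\<^bsub>W\<^esub> b i)"
    using di bi by (intro module_hom_finsum[OF W P bilinear_mapD(1)[OF B ai[OF I(2)]], symmetric]) auto
  also have "\<dots> = \<zero>\<^bsub>P\<^esub>"
    unfolding d0 by (rule module_hom_zero[OF W P bilinear_mapD(1)[OF B ai[OF I(2)]]])
  also have "(\<Oplus>\<^bsub>P\<^esub>i\<in>I. B (a' i) (b i)) = B (a' j) (b j) \<oplus>\<^bsub>P\<^esub> (\<Oplus>\<^bsub>P\<^esub>i\<in>I - {j}. B (a' i) (b i))"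
    using I a'i bi Bc by (subst P.finsum_insert[symmetric]) (auto simp: insert_absorb)
  also have "\<dots> = (\<Oplus>\<^bsub>P\<^esub>i\<in>I - {j}. B (a' i) (b i))"
    unfolding Bj using a'i bi Bc by (intro P.l_zero P.finsum_closed) auto
  finally have "(\<Oplus>\<^bsub>P\<^esub>i\<in>I. B (a i) (b i)) = (\<Oplus>\<^bsub>P\<^esub>i\<in>I - {j}. B (a' i) (b i))"
    using a'i bi Bc by (simp add: Pi_iff)
  then show ?thesis using that a'i by auto
qed

text \<open>Independence of an indexed family; repeated vectors count as dependent, unlike for the set of its values.\<close>

definition independent_family ::
    "('k, 'r) ring_scheme \<Rightarrow> ('k, 'v, 'm) module_scheme \<Rightarrow> 'i set \<Rightarrow> ('i \<Rightarrow> 'v) \<Rightarrow> bool" where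
  "independent_family K V I b \<longleftrightarrow> (\<forall>c\<in>I \<rightarrow> carrier K.
     (\<Oplus>\<^bsub>V\<^esub>i\<in>I. c i \<odot>\<^bsub>V\<^esub> b i) = \<zero>\<^bsub>V\<^esub> \<longrightarrow> (\<forall>i\<in>I. c i = \<zero>\<^bsub>K\<^esub>))"

lemma independent_familyD:
  assumes "independent_family K V I b" "c \<in> I \<rightarrow> carrier K"
    and "(\<Oplus>\<^bsub>V\<^esub>i\<in>I. c i \<odot>\<^bsub>V\<^esub> b i) = \<zero>\<^bsub>V\<^esub>" "i \<in> I"
  shows "c i = \<zero>\<^bsub>K\<^esub>"
  using assms by (simp add: independent_family_def)

text \<open>A representation by the smallest number of pure tensors cannot be shortened, so no relation holds on
  either side.\<close>

lemma tensor_minimal_sum: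
  assumes V: "vectorspace K V" and W: "vectorspace K W" and t: "t \<in> carrier (tensor K V W)"
  obtains I :: "nat set" and a b where "finite I" "a \<in> I \<rightarrow> carrier V" "b \<in> I \<rightarrow> carrier W"
     "t = (\<Oplus>\<^bsub>tensor K V W\<^esub>i\<in>I. pure_tensor K V W (a i) (b i))"
     "independent_family K V I a" "independent_family K W I b"
proof -
  let ?R = "\<lambda>(I::nat set) a b. finite I \<and> a \<in> I \<rightarrow> carrier V \<and> b \<in> I \<rightarrow> carrier W \<and>
     t = (\<Oplus>\<^bsub>tensor K V W\<^esub>i\<in>I. pure_tensor K V W (a i) (b i))"
  note T = tensor_vectorspace[OF V W] and B = pure_tensor_bilinear[OF V W]
  let ?N = "\<lambda>n. \<exists>I a b. ?R I a b \<and> card I = n"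
  have "\<exists>n. ?N n" using tensor_finite_sum[OF assms] by blast
  then have "?N (LEAST n. ?N n)" by (rule LeastI_ex)
  then obtain I a b where R: "?R I a b" and card: "card I = (LEAST n. ?N n)" by blast
  have min: "card I \<le> card J" if "?R J a' b'" for J a' b'
    unfolding card by (rule Least_le) (use that in blast)
  have less: "card (I - {j}) < card I" if "j \<in> I" for j
    using R that by (intro psubset_card_mono) auto
  have "independent_family K W I b"
    unfolding independent_family_def
  proof (intro ballI impI, rule ccontr)
    fix c j assume c: "c \<in> I \<rightarrow> carrier K" "(\<Oplus>\<^bsub>W\<^esub>i\<in>I. c i \<odot>\<^bsub>W\<^esub> b i) = \<zero>\<^bsub>W\<^esub>" "j \<in> I" "c j \<noteq> \<zero>\<^bsub>K\<^esub>"
    from R c obtain a' where "a' \<in> I - {j} \<rightarrow> carrier V"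
      "(\<Oplus>\<^bsub>tensor K V W\<^esub>i\<in>I. pure_tensor K V W (a i) (b i)) = (\<Oplus>\<^bsub>tensor K V W\<^esub>i\<in>I - {j}. pure_tensor K V W (a' i) (b i))"
      by (elim conjE) (rule bilinear_sum_reduce[OF V W T B, of I j a b c])
    then have "?R (I - {j}) a' b" using R by auto
    then have "card I \<le> card (I - {j})" by (rule min)
    then show False using less[OF c(3)] by simp
  qed
  moreover have "independent_family K V I a"
    unfolding independent_family_def
  proof (intro ballI impI, rule ccontr)
    fix c j assume c: "c \<in> I \<rightarrow> carrier K" "(\<Oplus>\<^bsub>V\<^esub>i\<in>I. c i \<odot>\<^bsub>V\<^esub> a i) = \<zero>\<^bsub>V\<^esub>" "j \<in> I" "c j \<noteq> \<zero>\<^bsub>K\<^esub>"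
    from R c obtain b' where "b' \<in> I - {j} \<rightarrow> carrier W"
      "(\<Oplus>\<^bsub>tensor K V W\<^esub>i\<in>I. pure_tensor K V W (a i) (b i)) = (\<Oplus>\<^bsub>tensor K V W\<^esub>i\<in>I - {j}. pure_tensor K V W (a i) (b' i))"
      by (elim conjE) (rule bilinear_sum_reduce[OF W V T bilinear_map_flip[OF B], of I j b a c])
    then have "?R (I - {j}) a b'" using R by auto
    then have "card I \<le> card (I - {j})" by (rule min)
    then show False using less[OF c(3)] by simp
  qed
  ultimately show ?thesis using that R by blast
qed

lemma independent_family_lin_indpt:
  assumes V: "vectorspace K V" and I: "finite I" and b: "b \<in> I \<rightarrow> carrier V"
    and ind: "independent_family K V I b"
  shows "inj_on b I" and "\<not> module.lin_dep K V (b ` I)"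
proof -
  interpret V: vectorspace K V by fact
  have bi: "b i \<in> carrier V" if "i \<in> I" for i using that b by auto
  show inj: "inj_on b I"
  proof (rule inj_onI, rule ccontr)
    fix i j assume ij: "i \<in> I" "j \<in> I" "b i = b j" "i \<noteq> j"
    let ?c = "\<lambda>k. if k = i then \<one>\<^bsub>K\<^esub> else if k = j then \<ominus>\<^bsub>K\<^esub> \<one>\<^bsub>K\<^esub> else \<zero>\<^bsub>K\<^esub>"
    have I': "I = insert i (insert j (I - {i, j}))" using ij by auto
    have "(\<Oplus>\<^bsub>V\<^esub>k\<in>I. ?c k \<odot>\<^bsub>V\<^esub> b k) = (\<Oplus>\<^bsub>V\<^esub>k\<in>insert i (insert j (I - {i, j})). ?c k \<odot>\<^bsub>V\<^esub> b k)"
      using I' by simp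
    also have "\<dots> = b i \<oplus>\<^bsub>V\<^esub> (\<ominus>\<^bsub>K\<^esub> \<one>\<^bsub>K\<^esub> \<odot>\<^bsub>V\<^esub> b j \<oplus>\<^bsub>V\<^esub> (\<Oplus>\<^bsub>V\<^esub>k\<in>I - {i, j}. ?c k \<odot>\<^bsub>V\<^esub> b k))"
      using ij I bi by (subst V.finsum_insert, force, force, force, force)
        (subst V.finsum_insert, auto)
    also have "(\<Oplus>\<^bsub>V\<^esub>k\<in>I - {i, j}. ?c k \<odot>\<^bsub>V\<^esub> b k) = (\<Oplus>\<^bsub>V\<^esub>k\<in>I - {i, j}. \<zero>\<^bsub>V\<^esub>)"
      using bi by (intro V.finsum_cong') auto
    also have "b i \<oplus>\<^bsub>V\<^esub> (\<ominus>\<^bsub>K\<^esub> \<one>\<^bsub>K\<^esub> \<odot>\<^bsub>V\<^esub> b j \<oplus>\<^bsub>V\<^esub> \<dots>) = \<zero>\<^bsub>V\<^esub>"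
      using ij bi by (simp add: V.smult_minus_1 V.M.r_neg)
    finally have "(\<Oplus>\<^bsub>V\<^esub>k\<in>I. ?c k \<odot>\<^bsub>V\<^esub> b k) = \<zero>\<^bsub>V\<^esub>" .
    moreover have "?c \<in> I \<rightarrow> carrier K" by auto
    ultimately have "?c i = \<zero>\<^bsub>K\<^esub>" using independent_familyD[OF ind, of ?c i] ij(1) by simp
    then show False by simp
  qed
  show "\<not> V.lin_dep (b ` I)"
  proof (rule V.finite_lin_indpt2)
    fix e assume e: "e \<in> b ` I \<rightarrow> carrier K" "V.lincomb e (b ` I) = \<zero>\<^bsub>V\<^esub>"
    have "V.lincomb e (b ` I) = (\<Oplus>\<^bsub>V\<^esub>i\<in>I. e (b i) \<odot>\<^bsub>V\<^esub> b i)"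
      unfolding V.lincomb_def using e bi inj by (intro V.finsum_reindex) auto
    then have "(\<Oplus>\<^bsub>V\<^esub>i\<in>I. e (b i) \<odot>\<^bsub>V\<^esub> b i) = \<zero>\<^bsub>V\<^esub>" using e by simp
    moreover have "(\<lambda>i. e (b i)) \<in> I \<rightarrow> carrier K" using e by auto
    ultimately show "\<forall>v\<in>b ` I. e v = \<zero>\<^bsub>K\<^esub>" by (auto intro: independent_familyD[OF ind, of "\<lambda>i. e (b i)"])
  qed (use I bi in auto)
qed

lemma dual_family:
  assumes V: "vectorspace K V" and I: "finite I" and b: "b \<in> I \<rightarrow> carrier V"
    and ind: "independent_family K V I b" and i: "i \<in> I"
  obtains f where "f \<in> dual K V" "f (b i) = \<one>\<^bsub>K\<^esub>" "\<And>k. k \<in> I \<Longrightarrow> k \<noteq> i \<Longrightarrow> f (b k) = \<zero>\<^bsub>K\<^esub>"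
proof -
  interpret V: vectorspace K V by fact
  note li = independent_family_lin_indpt[OF V I b ind]
  have bI: "b ` I \<subseteq> carrier V" using b by auto
  have S: "b ` I - {b i} \<subseteq> carrier V" using bI by auto
  have "b i \<notin> V.span (b ` I - {b i})" using V.lindep_span[OF bI] I li(2) i by auto
  then obtain f where f: "f \<in> dual K V" "f (b i) = \<one>\<^bsub>K\<^esub>" "\<And>u. u \<in> V.span (b ` I - {b i}) \<Longrightarrow> f u = \<zero>\<^bsub>K\<^esub>"
    using dual_separates[OF V.span_is_subspace[OF S], of "b i"] bI i by auto
  have "f (b k) = \<zero>\<^bsub>K\<^esub>" if "k \<in> I" "k \<noteq> i" for k
    using that li(1) i V.in_own_span[OF S] f(3) by (auto simp: inj_on_def)
  then show ?thesis using f that by blast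
qed

text \<open>Independence of the \<open>b i\<close> provides functionals dual to them, so the values \<open>f (b i)\<close> can be prescribed freely.\<close>

lemma dual_combinations:
  assumes V: "vectorspace K V" and W: "vectorspace K W" and I: "finite I"
    and a: "a \<in> I \<rightarrow> carrier V" and b: "b \<in> I \<rightarrow> carrier W" and ind: "independent_family K W I b"
  shows "(\<lambda>f. \<Oplus>\<^bsub>V\<^esub>i\<in>I. f (b i) \<odot>\<^bsub>V\<^esub> a i) ` dual K W = module.span K V (a ` I)"
proof
  interpret V: vectorspace K V by fact
  let ?s = "\<lambda>f. \<Oplus>\<^bsub>V\<^esub>i\<in>I. f (b i) \<odot>\<^bsub>V\<^esub> a i" and ?R = "(\<lambda>f. \<Oplus>\<^bsub>V\<^esub>i\<in>I. f (b i) \<odot>\<^bsub>V\<^esub> a i) ` dual K W"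
  have ai: "a i \<in> carrier V" and bi: "b i \<in> carrier W" if "i \<in> I" for i using a b that by auto
  have aI: "a ` I \<subseteq> carrier V" using ai by auto
  have fb: "f (b i) \<in> carrier K" if "f \<in> dual K W" "i \<in> I" for f i
    using module_hom_in[OF that(1) bi[OF that(2)]] by simp
  show "?R \<subseteq> V.span (a ` I)"
  proof clarify
    fix f assume f: "f \<in> dual K W"
    show "?s f \<in> V.span (a ` I)"
      using fb[OF f] V.in_own_span[OF aI] subspaceD(6)[OF V.span_is_subspace[OF aI]]
      by (intro subspace_finsum[OF V.span_is_subspace[OF aI]]) auto
  qed
  have sc: "?s f \<in> carrier V" if "f \<in> dual K W" for f
    using fb[OF that] ai by (intro V.finsum_closed) auto
  have "VectorSpace.subspace K ?R V"
  proof (rule subspaceI[OF V])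
    show "?R \<subseteq> carrier V" using sc by auto
    have "?s (\<lambda>x. \<zero>\<^bsub>K\<^esub>) = (\<Oplus>\<^bsub>V\<^esub>i\<in>I. \<zero>\<^bsub>V\<^esub>)" using ai by (intro V.finsum_cong') auto
    then have "\<zero>\<^bsub>V\<^esub> = ?s (\<lambda>x. \<zero>\<^bsub>K\<^esub>)" by simp
    then show "\<zero>\<^bsub>V\<^esub> \<in> ?R" by (rule image_eqI[OF _ dual_zero[OF W]])
  next
    fix x y assume "x \<in> ?R" "y \<in> ?R"
    then obtain f g where fg: "f \<in> dual K W" "g \<in> dual K W" "x = ?s f" "y = ?s g" by blast
    have "?s (\<lambda>x. f x \<oplus>\<^bsub>K\<^esub> g x) = (\<Oplus>\<^bsub>V\<^esub>i\<in>I. f (b i) \<odot>\<^bsub>V\<^esub> a i \<oplus>\<^bsub>V\<^esub> g (b i) \<odot>\<^bsub>V\<^esub> a i)"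
      using fb[OF fg(1)] fb[OF fg(2)] ai by (intro V.finsum_cong') (auto simp: V.smult_l_distr)
    also have "\<dots> = x \<oplus>\<^bsub>V\<^esub> y"
      unfolding fg(3,4) using fb[OF fg(1)] fb[OF fg(2)] ai by (intro V.finsum_addf) auto
    finally have "x \<oplus>\<^bsub>V\<^esub> y = ?s (\<lambda>x. f x \<oplus>\<^bsub>K\<^esub> g x)" by simp
    then show "x \<oplus>\<^bsub>V\<^esub> y \<in> ?R" by (rule image_eqI[OF _ dual_add[OF W fg(1,2)]])
  next
    fix c x assume c: "c \<in> carrier K" and "x \<in> ?R"
    then obtain f where f: "f \<in> dual K W" "x = ?s f" by blast
    have "?s (\<lambda>x. c \<otimes>\<^bsub>K\<^esub> f x) = (\<Oplus>\<^bsub>V\<^esub>i\<in>I. c \<odot>\<^bsub>V\<^esub> (f (b i) \<odot>\<^bsub>V\<^esub> a i))"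
      using fb[OF f(1)] ai c by (intro V.finsum_cong') (auto simp: V.smult_assoc1)
    also have "\<dots> = c \<odot>\<^bsub>V\<^esub> x"
      unfolding f(2) using fb[OF f(1)] ai c by (intro V.finsum_smult[symmetric]) auto
    finally have "c \<odot>\<^bsub>V\<^esub> x = ?s (\<lambda>x. c \<otimes>\<^bsub>K\<^esub> f x)" by simp
    then show "c \<odot>\<^bsub>V\<^esub> x \<in> ?R" by (rule image_eqI[OF _ dual_smult[OF W f(1) c]])
  qed
  then show "V.span (a ` I) \<subseteq> ?R"
  proof (rule span_minimal, clarify)
    fix i assume i: "i \<in> I"
    obtain f where f: "f \<in> dual K W" "f (b i) = \<one>\<^bsub>K\<^esub>" "\<And>k. k \<in> I \<Longrightarrow> k \<noteq> i \<Longrightarrow> f (b k) = \<zero>\<^bsub>K\<^esub>"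
      using dual_family[OF W I b ind i] by blast
    have "?s f = (\<Oplus>\<^bsub>V\<^esub>k\<in>{i}. f (b k) \<odot>\<^bsub>V\<^esub> a k)"
      using i I ai f fb[OF f(1)] by (intro V.M.add.finprod_mono_neutral_cong_right) auto
    also have "\<dots> = a i" using i ai f by simp
    finally show "a i \<in> ?R" using f(1) by (intro image_eqI[OF _ f(1)]) simp
  qed
qed

text \<open>Contracting a shortest representation \<open>\<Oplus>i. a i \<otimes> b i\<close> by all functionals on the right fills the span of the
  \<open>a i\<close>, contracting on the left fills the span of the \<open>b i\<close>. Both families are independent and have the same number of
  members, so the two spaces of contractions have equal finite dimension.\<close>

lemma tensor_rank_decomposition:
  assumes V: "vectorspace K V" and W: "vectorspace K W" and t: "t \<in> carrier (tensor K V W)"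
  obtains A B where "finite A" "A \<subseteq> carrier V" "\<not> module.lin_dep K V A"
    "finite B" "B \<subseteq> carrier W" "\<not> module.lin_dep K W B" "card A = card B"
    "(\<lambda>f. contract_right K V f t) ` dual K W = module.span K V A"
    "(\<lambda>f. contract_left K W f t) ` dual K V = module.span K W B"
    "t \<in> tensor_sub K V W A B"
proof -
  interpret T: vectorspace K "tensor K V W" using V W by (rule tensor_vectorspace)
  interpret V: vectorspace K V by (rule V)
  interpret W: vectorspace K W by (rule W)
  from tensor_minimal_sum[OF assms] obtain I :: "nat set" and a b where I: "finite I"
    and a: "a \<in> I \<rightarrow> carrier V" and b: "b \<in> I \<rightarrow> carrier W"
    and t_eq: "t = (\<Oplus>\<^bsub>tensor K V W\<^esub>i\<in>I. pure_tensor K V W (a i) (b i))"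
    and ind: "independent_family K V I a" "independent_family K W I b" .
  have ai: "a i \<in> carrier V" and bi: "b i \<in> carrier W" if "i \<in> I" for i using a b that by auto
  have p: "(\<lambda>i. pure_tensor K V W (a i) (b i)) \<in> I \<rightarrow> carrier (tensor K V W)"
    using ai bi pure_tensor_in[OF V W] by auto
  note la = independent_family_lin_indpt[OF V I a ind(1)] and lb = independent_family_lin_indpt[OF W I b ind(2)]
  have R: "contract_right K V f t = (\<Oplus>\<^bsub>V\<^esub>i\<in>I. f (b i) \<odot>\<^bsub>V\<^esub> a i)" if f: "f \<in> dual K W" for f
  proof -
    have "contract_right K V f t = (\<Oplus>\<^bsub>V\<^esub>i\<in>I. contract_right K V f (pure_tensor K V W (a i) (b i)))"
      unfolding t_eq by (rule module_hom_finsum[OF T.vectorspace_axioms V contract_right_hom[OF V W f] p])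
    also have "\<dots> = (\<Oplus>\<^bsub>V\<^esub>i\<in>I. f (b i) \<odot>\<^bsub>V\<^esub> a i)"
      using ai bi module_hom_in[OF f] by (intro V.finsum_cong') (auto simp: contract_right_pure[OF V W f])
    finally show ?thesis .
  qed
  have L: "contract_left K W f t = (\<Oplus>\<^bsub>W\<^esub>i\<in>I. f (a i) \<odot>\<^bsub>W\<^esub> b i)" if f: "f \<in> dual K V" for f
  proof -
    have "contract_left K W f t = (\<Oplus>\<^bsub>W\<^esub>i\<in>I. contract_left K W f (pure_tensor K V W (a i) (b i)))"
      unfolding t_eq by (rule module_hom_finsum[OF T.vectorspace_axioms W contract_left_hom[OF V W f] p])
    also have "\<dots> = (\<Oplus>\<^bsub>W\<^esub>i\<in>I. f (a i) \<odot>\<^bsub>W\<^esub> b i)"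
      using ai bi module_hom_in[OF f] by (intro W.finsum_cong') (auto simp: contract_left_pure[OF V W f])
    finally show ?thesis .
  qed
  show ?thesis
  proof
    show "finite (a ` I)" "finite (b ` I)" using I by auto
    show "a ` I \<subseteq> carrier V" "b ` I \<subseteq> carrier W" using ai bi by auto
    show "\<not> V.lin_dep (a ` I)" "\<not> W.lin_dep (b ` I)" using la lb by auto
    show "card (a ` I) = card (b ` I)" using la lb by (simp add: card_image)
    show "(\<lambda>f. contract_right K V f t) ` dual K W = V.span (a ` I)"
      using dual_combinations[OF V W I a b ind(2)] by (simp add: R cong: image_cong)
    show "(\<lambda>f. contract_left K W f t) ` dual K V = W.span (b ` I)"
      using dual_combinations[OF W V I b a ind(1)] by (simp add: L cong: image_cong)
    have S: "{pure_tensor K V W x y | x y. x \<in> a ` I \<and> y \<in> b ` I} \<subseteq> carrier (tensor K V W)"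
      using ai bi pure_tensor_in[OF V W] by auto
    show "t \<in> tensor_sub K V W (a ` I) (b ` I)"
      unfolding tensor_sub_def t_eq using T.in_own_span[OF S]
      by (intro subspace_finsum[OF T.span_is_subspace[OF S]]) blast
  qed
qed

section \<open>Tensor products of maps and associativity\<close>

lemma tensor_map:
  assumes V: "vectorspace K V" and W: "vectorspace K W" and V': "vectorspace K V'" and W': "vectorspace K W'"
    and f: "f \<in> module_hom K V V'" and g: "g \<in> module_hom K W W'"
  shows tensor_map_hom: "tensor_map K V' W' f g \<in> module_hom K (tensor K V W) (tensor K V' W')"
    and tensor_map_pure: "v \<in> carrier V \<Longrightarrow> w \<in> carrier W \<Longrightarrow>
       tensor_map K V' W' f g (pure_tensor K V W v w) = pure_tensor K V' W' (f v) (g w)"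
proof -
  note B = pure_tensor_bilinear[OF V' W']
  have B': "bilinear_map K V W (tensor K V' W') (\<lambda>v w. pure_tensor K V' W' (f v) (g w))"
    unfolding bilinear_map_def
    using module_hom_comp[OF g bilinear_mapD(1)[OF B module_hom_in[OF f]]]
      module_hom_comp[OF f bilinear_mapD(2)[OF B module_hom_in[OF g]]] by blast
  show "tensor_map K V' W' f g \<in> module_hom K (tensor K V W) (tensor K V' W')"
    unfolding tensor_map_def by (rule tensor_lift_hom[OF V W tensor_vectorspace[OF V' W'] B'])
  show "v \<in> carrier V \<Longrightarrow> w \<in> carrier W \<Longrightarrow>
       tensor_map K V' W' f g (pure_tensor K V W v w) = pure_tensor K V' W' (f v) (g w)"
    unfolding tensor_map_def by (rule tensor_lift_pure[OF V W tensor_vectorspace[OF V' W'] B'])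
qed

text \<open>Associativity is a tensor lift whose values are tensor lifts in turn; linearity of the outer bilinear map in
  the last argument is itself an identity between maps on \<open>U \<otimes> V\<close>.\<close>

lemma tensor_assoc:
  assumes U: "vectorspace K U" and V: "vectorspace K V" and W: "vectorspace K W"
  shows tensor_assoc_hom: "tensor_assoc K U V W \<in>
      module_hom K (tensor K (tensor K U V) W) (tensor K U (tensor K V W))"
    and tensor_assoc_pure: "u \<in> carrier U \<Longrightarrow> v \<in> carrier V \<Longrightarrow> w \<in> carrier W \<Longrightarrow>
      tensor_assoc K U V W (pure_tensor K (tensor K U V) W (pure_tensor K U V u v) w)
        = pure_tensor K U (tensor K V W) u (pure_tensor K V W v w)"
proof -
  note UV = tensor_vectorspace[OF U V] and VW = tensor_vectorspace[OF V W]
  note P = tensor_vectorspace[OF U VW]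
  note B1 = pure_tensor_bilinear[OF U VW] and B2 = pure_tensor_bilinear[OF V W]
  let ?P = "tensor K U (tensor K V W)"
  let ?b = "\<lambda>w u v. pure_tensor K U (tensor K V W) u (pure_tensor K V W v w)"
  have b: "bilinear_map K U V ?P (?b w)" if w: "w \<in> carrier W" for w
    unfolding bilinear_map_def
    using module_hom_comp[OF bilinear_mapD(2)[OF B2 w] bilinear_mapD(1)[OF B1]]
      bilinear_mapD(2)[OF B1 pure_tensor_in[OF V W _ w]] by blast
  let ?l = "\<lambda>t w. tensor_lift K ?P (?b w) t"
  have lh: "(\<lambda>t. ?l t w) \<in> module_hom K (tensor K U V) ?P" if "w \<in> carrier W" for w
    using tensor_lift_hom[OF U V P b[OF that]] .
  have lp: "?l (pure_tensor K U V u v) w = ?b w u v"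
    if "w \<in> carrier W" "u \<in> carrier U" "v \<in> carrier V" for u v w
    using tensor_lift_pure[OF U V P b] that by blast
  interpret W: vectorspace K W by (rule W)
  have B: "bilinear_map K (tensor K U V) W ?P ?l"
    unfolding bilinear_map_def
  proof (intro conjI ballI)
    fix t assume t: "t \<in> carrier (tensor K U V)"
    show "(\<lambda>w. ?l t w) \<in> module_hom K W ?P"
    proof (rule module_homI)
      fix w w' assume w: "w \<in> carrier W" "w' \<in> carrier W"
      then have ww: "w \<oplus>\<^bsub>W\<^esub> w' \<in> carrier W" by simp
      show "?l t (w \<oplus>\<^bsub>W\<^esub> w') = ?l t w \<oplus>\<^bsub>?P\<^esub> ?l t w'"
        using t
      proof (rule tensor_hom_eqI[OF U V lh[OF ww] module_hom_plus[OF UV P lh[OF w(1)] lh[OF w(2)]], rotated])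
        fix u v assume uv: "u \<in> carrier U" "v \<in> carrier V"
        then show "?l (pure_tensor K U V u v) (w \<oplus>\<^bsub>W\<^esub> w') =
            ?l (pure_tensor K U V u v) w \<oplus>\<^bsub>?P\<^esub> ?l (pure_tensor K U V u v) w'"
          using w pure_tensor_in[OF V W] module_hom_add[OF bilinear_mapD(1)[OF B2 uv(2)]]
            module_hom_add[OF bilinear_mapD(1)[OF B1 uv(1)]] by (simp add: lp ww)
      qed
    next
      fix a w assume a: "a \<in> carrier K" and w: "w \<in> carrier W"
      then have aw: "a \<odot>\<^bsub>W\<^esub> w \<in> carrier W" by simp
      show "?l t (a \<odot>\<^bsub>W\<^esub> w) = a \<odot>\<^bsub>?P\<^esub> ?l t w"
        using t
      proof (rule tensor_hom_eqI[OF U V lh[OF aw] module_hom_scale[OF UV P lh[OF w] a], rotated])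
        fix u v assume uv: "u \<in> carrier U" "v \<in> carrier V"
        then show "?l (pure_tensor K U V u v) (a \<odot>\<^bsub>W\<^esub> w) = a \<odot>\<^bsub>?P\<^esub> ?l (pure_tensor K U V u v) w"
          using w a pure_tensor_in[OF V W] module_hom_smult[OF bilinear_mapD(1)[OF B2 uv(2)]]
            module_hom_smult[OF bilinear_mapD(1)[OF B1 uv(1)]] by (simp add: lp aw)
      qed
    qed (rule module_hom_in[OF lh t])
  qed (rule lh)
  show "tensor_assoc K U V W \<in> module_hom K (tensor K (tensor K U V) W) ?P"
    unfolding tensor_assoc_def by (rule tensor_lift_hom[OF UV W P B])
  show "tensor_assoc K U V W (pure_tensor K (tensor K U V) W (pure_tensor K U V u v) w)
        = pure_tensor K U (tensor K V W) u (pure_tensor K V W v w)"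
    if "u \<in> carrier U" "v \<in> carrier V" "w \<in> carrier W"
    unfolding tensor_assoc_def
    using tensor_lift_pure[OF UV W P B pure_tensor_in[OF U V]] that lp by simp
qed

section \<open>Recognising subspaces by contraction\<close>

lemma tensor_sub_mono:
  assumes "vectorspace K V" "vectorspace K W" "A \<subseteq> A'" "B \<subseteq> B'"
  shows "tensor_sub K V W A B \<subseteq> tensor_sub K V W A' B'"
proof -
  interpret T: vectorspace K "tensor K V W" using assms(1,2) by (rule tensor_vectorspace)
  show ?thesis unfolding tensor_sub_def using assms by (intro T.span_is_monotone) blast
qed

text \<open>For a tensor all of whose contractions lie in \<open>N\<close>, a shortest representation has its left factors in
  \<open>N\<close>, since these factors are contractions.\<close>

lemma tensor_sub_right_iff:
  assumes V: "vectorspace K V" and W: "vectorspace K W" and t: "t \<in> carrier (tensor K V W)"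
    and N: "VectorSpace.subspace K N V"
  shows "t \<in> tensor_sub K V W N (carrier W) \<longleftrightarrow> (\<forall>f\<in>dual K W. contract_right K V f t \<in> N)"
proof
  note T = tensor_vectorspace[OF V W]
  show "\<forall>f\<in>dual K W. contract_right K V f t \<in> N" if t': "t \<in> tensor_sub K V W N (carrier W)"
  proof
    fix f assume f: "f \<in> dual K W"
    have "tensor_sub K V W N (carrier W) \<subseteq> {t \<in> carrier (tensor K V W). contract_right K V f t \<in> N}"
      unfolding tensor_sub_def
    proof (rule span_minimal[OF subspace_vimage[OF T contract_right_hom[OF V W f] N]], clarify)
      fix a b assume ab: "a \<in> N" "b \<in> carrier W"
      then show "pure_tensor K V W a b \<in> carrier (tensor K V W) \<and> contract_right K V f (pure_tensor K V W a b) \<in> N"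
        using subspaceD(4)[OF N] subspaceD(6)[OF N] module_hom_in[OF f] pure_tensor_in[OF V W]
        by (simp add: contract_right_pure[OF V W f])
    qed
    then show "contract_right K V f t \<in> N" using t' by auto
  qed
  assume *: "\<forall>f\<in>dual K W. contract_right K V f t \<in> N"
  interpret V: vectorspace K V by (rule V)
  obtain A B where "A \<subseteq> carrier V" "B \<subseteq> carrier W" "(\<lambda>f. contract_right K V f t) ` dual K W = V.span A"
    "t \<in> tensor_sub K V W A B"
    using tensor_rank_decomposition[OF V W t] by metis
  moreover have "(\<lambda>f. contract_right K V f t) ` dual K W \<subseteq> N" using * by auto
  ultimately have "A \<subseteq> N" "t \<in> tensor_sub K V W A B" "B \<subseteq> carrier W" using V.in_own_span[of A] by auto
  then show "t \<in> tensor_sub K V W N (carrier W)" using tensor_sub_mono[OF V W] by blast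
qed

lemma tensor_sub_left_iff:
  assumes V: "vectorspace K V" and W: "vectorspace K W" and t: "t \<in> carrier (tensor K V W)"
    and N: "VectorSpace.subspace K N W"
  shows "t \<in> tensor_sub K V W (carrier V) N \<longleftrightarrow> (\<forall>f\<in>dual K V. contract_left K W f t \<in> N)"
proof
  note T = tensor_vectorspace[OF V W]
  show "\<forall>f\<in>dual K V. contract_left K W f t \<in> N" if t': "t \<in> tensor_sub K V W (carrier V) N"
  proof
    fix f assume f: "f \<in> dual K V"
    have "tensor_sub K V W (carrier V) N \<subseteq> {t \<in> carrier (tensor K V W). contract_left K W f t \<in> N}"
      unfolding tensor_sub_def
    proof (rule span_minimal[OF subspace_vimage[OF T contract_left_hom[OF V W f] N]], clarify)
      fix a b assume ab: "a \<in> carrier V" "b \<in> N"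
      then show "pure_tensor K V W a b \<in> carrier (tensor K V W) \<and> contract_left K W f (pure_tensor K V W a b) \<in> N"
        using subspaceD(4)[OF N] subspaceD(6)[OF N] module_hom_in[OF f] pure_tensor_in[OF V W]
        by (simp add: contract_left_pure[OF V W f])
    qed
    then show "contract_left K W f t \<in> N" using t' by auto
  qed
  assume *: "\<forall>f\<in>dual K V. contract_left K W f t \<in> N"
  interpret W: vectorspace K W by (rule W)
  obtain A B where "A \<subseteq> carrier V" "B \<subseteq> carrier W" "(\<lambda>f. contract_left K W f t) ` dual K V = W.span B"
    "t \<in> tensor_sub K V W A B"
    using tensor_rank_decomposition[OF V W t] by metis
  moreover have "(\<lambda>f. contract_left K W f t) ` dual K V \<subseteq> N" using * by auto
  ultimately have "B \<subseteq> N" "t \<in> tensor_sub K V W A B" "A \<subseteq> carrier V" using W.in_own_span[of B] by auto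
  then show "t \<in> tensor_sub K V W (carrier V) N" using tensor_sub_mono[OF V W] by blast
qed

section \<open>Comodules as modules over the dual\<close>

abbreviation right_act where "right_act K M \<rho> f x \<equiv> contract_right K M f (\<rho> x)"
abbreviation left_act where "left_act K M \<rho> f x \<equiv> contract_left K M f (\<rho> x)"

text \<open>The functionals on \<open>C\<close> act on a right comodule. Coassociativity turns composition of two such operators into
  the action of a single functional, their convolution product, and the counit acts as the identity.\<close>

context right_comodule
begin

lemmas M_vs = M.vectorspace_axioms and C_vs = C.vectorspace_axioms

lemma coact_in: "x \<in> carrier M \<Longrightarrow> \<rho> x \<in> carrier (tensor K M C)"
  by (rule module_hom_in[OF coact_hom])

lemma act_hom: "f \<in> dual K C \<Longrightarrow> (\<lambda>x. right_act K M \<rho> f x) \<in> module_hom K M M"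
  by (rule module_hom_comp[OF coact_hom contract_right_hom[OF M_vs C_vs]])

lemma act_counit:
  assumes x: "x \<in> carrier M"
  shows "right_act K M \<rho> \<epsilon> x = x"
proof -
  have S: "vectorspace K (scalars K)" by (rule scalars_vectorspace) (rule C.field_axioms)
  note e = C.counit_hom
  have id: "id \<in> dual K (scalars K)" by (rule module_hom_id)
  have B: "bilinear_map K M (scalars K) M (\<lambda>y a. a \<odot>\<^bsub>M\<^esub> y)"
    using contract_right_bilinear[OF M_vs id] by simp
  note mh = tensor_map_hom[OF M_vs C_vs M_vs S module_hom_id e]
  have "contract_right K M \<epsilon> (\<rho> x) =
     tensor_lift K M (\<lambda>y a. a \<odot>\<^bsub>M\<^esub> y) (tensor_map K M (scalars K) id \<epsilon> (\<rho> x))"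
    using coact_in[OF x]
  proof (rule tensor_hom_eqI[OF M_vs C_vs contract_right_hom[OF M_vs C_vs e]
        module_hom_comp[OF mh tensor_lift_hom[OF M_vs S M_vs B]], rotated])
    fix m c assume "m \<in> carrier M" "c \<in> carrier C"
    then show "contract_right K M \<epsilon> (pure_tensor K M C m c) =
       tensor_lift K M (\<lambda>y a. a \<odot>\<^bsub>M\<^esub> y) (tensor_map K M (scalars K) id \<epsilon> (pure_tensor K M C m c))"
      using module_hom_in[OF e]
      by (simp add: contract_right_pure[OF M_vs C_vs e] tensor_map_pure[OF M_vs C_vs M_vs S module_hom_id e]
        tensor_lift_pure[OF M_vs S M_vs B])
  qed
  then show ?thesis using coact_counit[OF x] by simp
qed

lemma act_act:
  assumes f: "f \<in> dual K C" and g: "g \<in> dual K C" and x: "x \<in> carrier M"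
  shows "right_act K M \<rho> g (right_act K M \<rho> f x) = right_act K M \<rho> (\<lambda>c. g (right_act K C \<Delta> f c)) x"
    and "(\<lambda>c. g (right_act K C \<Delta> f c)) \<in> dual K C"
proof -
  note CC = tensor_vectorspace[OF C_vs C_vs] and MC = tensor_vectorspace[OF M_vs C_vs]
  let ?k = "\<lambda>t. g (contract_right K C f t)" and ?h = "\<lambda>c. g (right_act K C \<Delta> f c)"
  have k: "?k \<in> dual K (tensor K C C)" by (rule module_hom_comp[OF contract_right_hom[OF C_vs C_vs f] g])
  have h: "?h \<in> dual K C" using module_hom_comp[OF C.comult_hom k] by simp
  then show "?h \<in> dual K C" .
  note rx = coact_in[OF x]
  note E = contract_right_hom[OF M_vs CC k] and Ep = contract_right_pure[OF M_vs CC k]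
  have fc: "f c \<in> carrier K" and gc: "g c \<in> carrier K" if "c \<in> carrier C" for c
    using module_hom_in[OF f that] module_hom_in[OF g that] by auto
  have dc: "\<Delta> c \<in> carrier (tensor K C C)" if "c \<in> carrier C" for c by (rule module_hom_in[OF C.comult_hom that])
  have 1: "contract_right K M ?k (tensor_map K M (tensor K C C) id \<Delta> (\<rho> x)) = contract_right K M ?h (\<rho> x)"
    using rx
  proof (rule tensor_hom_eqI[OF M_vs C_vs module_hom_comp[OF tensor_map_hom[OF M_vs C_vs M_vs CC module_hom_id C.comult_hom] E]
        contract_right_hom[OF M_vs C_vs h], rotated])
    fix m c assume "m \<in> carrier M" "c \<in> carrier C"
    then show "contract_right K M ?k (tensor_map K M (tensor K C C) id \<Delta> (pure_tensor K M C m c)) =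
        contract_right K M ?h (pure_tensor K M C m c)"
      by (simp add: tensor_map_pure[OF M_vs C_vs M_vs CC module_hom_id C.comult_hom] Ep dc contract_right_pure[OF M_vs C_vs h])
  qed
  \<comment> \<open>Contracting \<open>M \<otimes> (C \<otimes> C)\<close> by \<open>?k = g \<otimes> f\<close> is contracting the last factor by \<open>f\<close> and then the middle one by \<open>g\<close>.\<close>
  have 2: "contract_right K M ?k (tensor_assoc K M C C (pure_tensor K (tensor K M C) C s c)) =
      f c \<odot>\<^bsub>M\<^esub> contract_right K M g s" if s: "s \<in> carrier (tensor K M C)" and c: "c \<in> carrier C" for s c
    using s
  proof (rule tensor_hom_eqI[OF M_vs C_vs
        module_hom_comp[OF module_hom_comp[OF bilinear_mapD(2)[OF pure_tensor_bilinear[OF MC C_vs] c]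
            tensor_assoc_hom[OF M_vs C_vs C_vs]] E]
        module_hom_scale[OF MC M_vs contract_right_hom[OF M_vs C_vs g] fc[OF c]], rotated])
    fix m c' assume "m \<in> carrier M" "c' \<in> carrier C"
    then show "contract_right K M ?k (tensor_assoc K M C C (pure_tensor K (tensor K M C) C (pure_tensor K M C m c') c)) =
      f c \<odot>\<^bsub>M\<^esub> contract_right K M g (pure_tensor K M C m c')"
      using c by (simp add: tensor_assoc_pure[OF M_vs C_vs C_vs] Ep pure_tensor_in[OF C_vs C_vs]
        contract_right_pure[OF M_vs C_vs g] contract_right_pure[OF C_vs C_vs f] module_hom_smult[OF g] fc gc M.smult_assoc1)
  qed
  have 3: "contract_right K M ?k (tensor_assoc K M C C (tensor_map K (tensor K M C) C \<rho> id (\<rho> x))) =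
      contract_right K M g (\<rho> (contract_right K M f (\<rho> x)))"
    using rx
  proof (rule tensor_hom_eqI[OF M_vs C_vs
        module_hom_comp[OF module_hom_comp[OF tensor_map_hom[OF M_vs C_vs MC C_vs coact_hom module_hom_id]
            tensor_assoc_hom[OF M_vs C_vs C_vs]] E]
        module_hom_comp[OF contract_right_hom[OF M_vs C_vs f] act_hom[OF g]], rotated])
    fix m c assume mc: "m \<in> carrier M" "c \<in> carrier C"
    then have "\<rho> (f c \<odot>\<^bsub>M\<^esub> m) = f c \<odot>\<^bsub>tensor K M C\<^esub> \<rho> m" using fc by (intro module_hom_smult[OF coact_hom])
    then show "contract_right K M ?k (tensor_assoc K M C C (tensor_map K (tensor K M C) C \<rho> id (pure_tensor K M C m c))) =
      contract_right K M g (\<rho> (contract_right K M f (pure_tensor K M C m c)))"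
      using mc coact_in by (simp add: tensor_map_pure[OF M_vs C_vs MC C_vs coact_hom module_hom_id] 2
        contract_right_pure[OF M_vs C_vs f] fc module_hom_smult[OF contract_right_hom[OF M_vs C_vs g]])
  qed
  show "right_act K M \<rho> g (right_act K M \<rho> f x) = right_act K M \<rho> ?h x"
    using 1 3 coact_coassoc[OF x] by simp
qed

lemma right_subcomodule_iff:
  "right_subcomodule K C \<Delta> \<epsilon> M \<rho> N \<longleftrightarrow>
     VectorSpace.subspace K N M \<and> (\<forall>x\<in>N. \<forall>f\<in>dual K C. right_act K M \<rho> f x \<in> N)"
proof -
  have "right_subcomodule K C \<Delta> \<epsilon> M \<rho> N \<longleftrightarrow>
     VectorSpace.subspace K N M \<and> (\<forall>x\<in>N. \<rho> x \<in> tensor_sub K M C N (carrier C))"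
    using right_comodule_axioms
    by (auto simp: right_subcomodule_def right_subcomodule_axioms_def)
  then show ?thesis
    using tensor_sub_right_iff[OF M_vs C_vs coact_in] subspaceD(4)[of K N M] by blast
qed

lemma cyclic_right_subcomodule:
  assumes x: "x \<in> carrier M"
  shows "right_subcomodule K C \<Delta> \<epsilon> M \<rho> ((\<lambda>f. right_act K M \<rho> f x) ` dual K C)"
    and "x \<in> (\<lambda>f. right_act K M \<rho> f x) ` dual K C"
proof -
  obtain A where "A \<subseteq> carrier M" "(\<lambda>f. right_act K M \<rho> f x) ` dual K C = M.span A"
    using tensor_rank_decomposition[OF M_vs C_vs coact_in[OF x]] by metis
  then have "VectorSpace.subspace K ((\<lambda>f. right_act K M \<rho> f x) ` dual K C) M"
    using M.span_is_subspace by simp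
  then show "right_subcomodule K C \<Delta> \<epsilon> M \<rho> ((\<lambda>f. right_act K M \<rho> f x) ` dual K C)"
    using act_act[OF _ _ x] unfolding right_subcomodule_iff by blast
  show "x \<in> (\<lambda>f. right_act K M \<rho> f x) ` dual K C"
    using act_counit[OF x] C.counit_hom by (intro image_eqI[of _ _ \<epsilon>]) auto
qed

end

text \<open>The mirror image: on a left comodule the functionals contract the left factor.\<close>

context left_comodule
begin

lemmas M_vs = M.vectorspace_axioms and C_vs = C.vectorspace_axioms

lemma coact_in: "x \<in> carrier M \<Longrightarrow> \<rho> x \<in> carrier (tensor K C M)"
  by (rule module_hom_in[OF coact_hom])

lemma act_hom: "f \<in> dual K C \<Longrightarrow> (\<lambda>x. left_act K M \<rho> f x) \<in> module_hom K M M"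
  by (rule module_hom_comp[OF coact_hom contract_left_hom[OF C_vs M_vs]])

lemma act_counit:
  assumes x: "x \<in> carrier M"
  shows "left_act K M \<rho> \<epsilon> x = x"
proof -
  have S: "vectorspace K (scalars K)" by (rule scalars_vectorspace) (rule C.field_axioms)
  note e = C.counit_hom
  have id: "id \<in> dual K (scalars K)" by (rule module_hom_id)
  have B: "bilinear_map K (scalars K) M M (\<lambda>a y. a \<odot>\<^bsub>M\<^esub> y)"
    using bilinear_map_flip[OF contract_right_bilinear[OF M_vs id]] by simp
  note mh = tensor_map_hom[OF C_vs M_vs S M_vs e module_hom_id]
  have "contract_left K M \<epsilon> (\<rho> x) =
     tensor_lift K M (\<lambda>a y. a \<odot>\<^bsub>M\<^esub> y) (tensor_map K (scalars K) M \<epsilon> id (\<rho> x))"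
    using coact_in[OF x]
  proof (rule tensor_hom_eqI[OF C_vs M_vs contract_left_hom[OF C_vs M_vs e]
        module_hom_comp[OF mh tensor_lift_hom[OF S M_vs M_vs B]], rotated])
    fix c m assume "c \<in> carrier C" "m \<in> carrier M"
    then show "contract_left K M \<epsilon> (pure_tensor K C M c m) =
       tensor_lift K M (\<lambda>a y. a \<odot>\<^bsub>M\<^esub> y) (tensor_map K (scalars K) M \<epsilon> id (pure_tensor K C M c m))"
      using module_hom_in[OF e]
      by (simp add: contract_left_pure[OF C_vs M_vs e] tensor_map_pure[OF C_vs M_vs S M_vs e module_hom_id]
        tensor_lift_pure[OF S M_vs M_vs B])
  qed
  then show ?thesis using coact_counit[OF x] by simp
qed

lemma act_act:
  assumes f: "f \<in> dual K C" and g: "g \<in> dual K C" and x: "x \<in> carrier M"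
  shows "left_act K M \<rho> g (left_act K M \<rho> f x) = left_act K M \<rho> (\<lambda>c. g (left_act K C \<Delta> f c)) x"
    and "(\<lambda>c. g (left_act K C \<Delta> f c)) \<in> dual K C"
proof -
  note CC = tensor_vectorspace[OF C_vs C_vs] and CM = tensor_vectorspace[OF C_vs M_vs]
  let ?k = "\<lambda>t. g (contract_left K C f t)" and ?h = "\<lambda>c. g (left_act K C \<Delta> f c)"
  let ?E = "\<lambda>t. contract_left K M g (contract_left K (tensor K C M) f t)"
  have k: "?k \<in> dual K (tensor K C C)" by (rule module_hom_comp[OF contract_left_hom[OF C_vs C_vs f] g])
  have h: "?h \<in> dual K C" using module_hom_comp[OF C.comult_hom k] by simp
  then show "?h \<in> dual K C" .
  note rx = coact_in[OF x]
  note E = module_hom_comp[OF contract_left_hom[OF C_vs CM f] contract_left_hom[OF C_vs M_vs g]]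
  have fc: "f c \<in> carrier K" and gc: "g c \<in> carrier K" if "c \<in> carrier C" for c
    using module_hom_in[OF f that] module_hom_in[OF g that] by auto
  have Ep: "?E (pure_tensor K C (tensor K C M) c t) = f c \<odot>\<^bsub>M\<^esub> contract_left K M g t"
    if "c \<in> carrier C" "t \<in> carrier (tensor K C M)" for c t
    using that fc by (simp add: contract_left_pure[OF C_vs CM f] module_hom_smult[OF contract_left_hom[OF C_vs M_vs g]])
  have dc: "\<Delta> c \<in> carrier (tensor K C C)" if "c \<in> carrier C" for c by (rule module_hom_in[OF C.comult_hom that])
  have 1: "?E (tensor_map K C (tensor K C M) id \<rho> (\<rho> x)) = contract_left K M g (\<rho> (contract_left K M f (\<rho> x)))"
    using rx
  proof (rule tensor_hom_eqI[OF C_vs M_vs module_hom_comp[OF tensor_map_hom[OF C_vs M_vs C_vs CM module_hom_id coact_hom] E]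
        module_hom_comp[OF contract_left_hom[OF C_vs M_vs f] act_hom[OF g]], rotated])
    fix c m assume cm: "c \<in> carrier C" "m \<in> carrier M"
    then have "\<rho> (f c \<odot>\<^bsub>M\<^esub> m) = f c \<odot>\<^bsub>tensor K C M\<^esub> \<rho> m" using fc by (intro module_hom_smult[OF coact_hom])
    then show "?E (tensor_map K C (tensor K C M) id \<rho> (pure_tensor K C M c m)) =
        contract_left K M g (\<rho> (contract_left K M f (pure_tensor K C M c m)))"
      using cm coact_in by (simp add: tensor_map_pure[OF C_vs M_vs C_vs CM module_hom_id coact_hom] Ep
        contract_left_pure[OF C_vs M_vs f] fc module_hom_smult[OF contract_left_hom[OF C_vs M_vs g]])
  qed
  \<comment> \<open>\<open>?E\<close> contracts the first factor of \<open>C \<otimes> (C \<otimes> M)\<close> by \<open>f\<close> and then the second one by \<open>g\<close>.\<close>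
  have 2: "?E (tensor_assoc K C C M (pure_tensor K (tensor K C C) M s m)) = ?k s \<odot>\<^bsub>M\<^esub> m"
    if s: "s \<in> carrier (tensor K C C)" and m: "m \<in> carrier M" for s m
    using s
  proof (rule tensor_hom_eqI[OF C_vs C_vs
        module_hom_comp[OF module_hom_comp[OF bilinear_mapD(2)[OF pure_tensor_bilinear[OF CC M_vs] m]
            tensor_assoc_hom[OF C_vs C_vs M_vs]] E]
        bilinear_mapD(1)[OF contract_right_bilinear[OF M_vs k] m], rotated])
    fix c c' assume "c \<in> carrier C" "c' \<in> carrier C"
    then show "?E (tensor_assoc K C C M (pure_tensor K (tensor K C C) M (pure_tensor K C C c c') m)) =
      ?k (pure_tensor K C C c c') \<odot>\<^bsub>M\<^esub> m"
      using m by (simp add: tensor_assoc_pure[OF C_vs C_vs M_vs] Ep pure_tensor_in[OF C_vs M_vs]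
        contract_left_pure[OF C_vs M_vs g] contract_left_pure[OF C_vs C_vs f] module_hom_smult[OF g] fc gc M.smult_assoc1)
  qed
  have 3: "?E (tensor_assoc K C C M (tensor_map K (tensor K C C) M \<Delta> id (\<rho> x))) = contract_left K M ?h (\<rho> x)"
    using rx
  proof (rule tensor_hom_eqI[OF C_vs M_vs
        module_hom_comp[OF module_hom_comp[OF tensor_map_hom[OF C_vs M_vs CC M_vs C.comult_hom module_hom_id]
            tensor_assoc_hom[OF C_vs C_vs M_vs]] E]
        contract_left_hom[OF C_vs M_vs h], rotated])
    fix c m assume "c \<in> carrier C" "m \<in> carrier M"
    then show "?E (tensor_assoc K C C M (tensor_map K (tensor K C C) M \<Delta> id (pure_tensor K C M c m))) =
      contract_left K M ?h (pure_tensor K C M c m)"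
      by (simp add: tensor_map_pure[OF C_vs M_vs CC M_vs C.comult_hom module_hom_id] 2 dc contract_left_pure[OF C_vs M_vs h])
  qed
  show "left_act K M \<rho> g (left_act K M \<rho> f x) = left_act K M \<rho> ?h x"
    using 1 3 coact_coassoc[OF x] by simp
qed

lemma left_subcomodule_iff:
  "left_subcomodule K C \<Delta> \<epsilon> M \<rho> N \<longleftrightarrow>
     VectorSpace.subspace K N M \<and> (\<forall>x\<in>N. \<forall>f\<in>dual K C. left_act K M \<rho> f x \<in> N)"
proof -
  have "left_subcomodule K C \<Delta> \<epsilon> M \<rho> N \<longleftrightarrow>
     VectorSpace.subspace K N M \<and> (\<forall>x\<in>N. \<rho> x \<in> tensor_sub K C M (carrier C) N)"
    using left_comodule_axioms
    by (auto simp: left_subcomodule_def left_subcomodule_axioms_def)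
  then show ?thesis
    using tensor_sub_left_iff[OF C_vs M_vs coact_in] subspaceD(4)[of K N M] by blast
qed

lemma cyclic_left_subcomodule:
  assumes x: "x \<in> carrier M"
  shows "left_subcomodule K C \<Delta> \<epsilon> M \<rho> ((\<lambda>f. left_act K M \<rho> f x) ` dual K C)"
    and "x \<in> (\<lambda>f. left_act K M \<rho> f x) ` dual K C"
proof -
  obtain A where "A \<subseteq> carrier M" "(\<lambda>f. left_act K M \<rho> f x) ` dual K C = M.span A"
    using tensor_rank_decomposition[OF C_vs M_vs coact_in[OF x]] by metis
  then have "VectorSpace.subspace K ((\<lambda>f. left_act K M \<rho> f x) ` dual K C) M"
    using M.span_is_subspace by simp
  then show "left_subcomodule K C \<Delta> \<epsilon> M \<rho> ((\<lambda>f. left_act K M \<rho> f x) ` dual K C)"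
    using act_act[OF _ _ x] unfolding left_subcomodule_iff by blast
  show "x \<in> (\<lambda>f. left_act K M \<rho> f x) ` dual K C"
    using act_counit[OF x] C.counit_hom by (intro image_eqI[of _ _ \<epsilon>]) auto
qed

end

section \<open>Quotient comodules\<close>

context right_subcomodule
begin

abbreviation "quot \<equiv> quot_mod K M N"
abbreviation "proj \<equiv> \<lambda>y. N +>\<^bsub>M\<^esub> y"
abbreviation "qcoact \<equiv> quot_coact K C M \<rho> N"

lemma is_subspace: "VectorSpace.subspace K N M" by (rule subspace_axioms)
lemma Q_vs: "vectorspace K quot" by (rule quot_vectorspace[OF is_subspace])
lemma proj_hom: "proj \<in> module_hom K M quot" by (rule quot_proj_hom[OF is_subspace])

lemma proj_coact_hom: "(\<lambda>x. tensor_map K quot C proj id (\<rho> x)) \<in> module_hom K M (tensor K quot C)"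
  by (rule module_hom_comp[OF coact_hom tensor_map_hom[OF M_vs C_vs Q_vs C_vs proj_hom module_hom_id]])

text \<open>The coaction maps \<open>N\<close> into \<open>N \<otimes> C\<close>, which dies in \<open>(M/N) \<otimes> C\<close>; so the induced coaction on \<open>M/N\<close> is well defined.\<close>

lemma proj_coact_zero:
  assumes x: "x \<in> N"
  shows "tensor_map K quot C proj id (\<rho> x) = \<zero>\<^bsub>tensor K quot C\<^esub>"
proof -
  note QC = tensor_vectorspace[OF Q_vs C_vs]
  note h = tensor_map_hom[OF M_vs C_vs Q_vs C_vs proj_hom module_hom_id]
  have "tensor_sub K M C N (carrier C) \<subseteq>
      {t \<in> carrier (tensor K M C). tensor_map K quot C proj id t \<in> {\<zero>\<^bsub>tensor K quot C\<^esub>}}"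
    unfolding tensor_sub_def
  proof (rule span_minimal[OF subspace_vimage[OF tensor_vectorspace[OF M_vs C_vs] h subspace_zero[OF QC]]], clarify)
    fix a b assume ab: "a \<in> N" "b \<in> carrier C"
    have a: "a \<in> carrier M" by (rule subspaceD(4)[OF is_subspace ab(1)])
    moreover have "proj a = \<zero>\<^bsub>quot\<^esub>" using ab(1) quot_proj_zero_iff[OF is_subspace a] by simp
    moreover have "pure_tensor K quot C \<zero>\<^bsub>quot\<^esub> b = \<zero>\<^bsub>tensor K quot C\<^esub>"
      by (rule module_hom_zero[OF Q_vs QC bilinear_mapD(2)[OF pure_tensor_bilinear[OF Q_vs C_vs] ab(2)]])
    ultimately show "pure_tensor K M C a b \<in> carrier (tensor K M C) \<and>
        tensor_map K quot C proj id (pure_tensor K M C a b) \<in> {\<zero>\<^bsub>tensor K quot C\<^esub>}"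
      using ab pure_tensor_in[OF M_vs C_vs] by (simp add: tensor_map_pure[OF M_vs C_vs Q_vs C_vs proj_hom module_hom_id])
  qed
  then show ?thesis using coact_closed x by auto
qed

lemma qcoact_hom: "qcoact \<in> module_hom K quot (tensor K quot C)"
  using quot_lift_hom[OF is_subspace tensor_vectorspace[OF Q_vs C_vs] proj_coact_hom proj_coact_zero]
  by (simp add: quot_coact_def[abs_def])

lemma qcoact_proj: "x \<in> carrier M \<Longrightarrow> qcoact (proj x) = tensor_map K quot C proj id (\<rho> x)"
  using quot_lift_coset[OF is_subspace tensor_vectorspace[OF Q_vs C_vs] proj_coact_hom proj_coact_zero]
  by (simp add: quot_coact_def)

lemma contract_proj:
  assumes f: "f \<in> dual K C" and t: "t \<in> carrier (tensor K M C)"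
  shows "contract_right K quot f (tensor_map K quot C proj id t) = proj (contract_right K M f t)"
  using t
proof (rule tensor_hom_eqI[OF M_vs C_vs
    module_hom_comp[OF tensor_map_hom[OF M_vs C_vs Q_vs C_vs proj_hom module_hom_id] contract_right_hom[OF Q_vs C_vs f]]
    module_hom_comp[OF contract_right_hom[OF M_vs C_vs f] proj_hom], rotated])
  fix m c assume "m \<in> carrier M" "c \<in> carrier C"
  then show "contract_right K quot f (tensor_map K quot C proj id (pure_tensor K M C m c)) =
      proj (contract_right K M f (pure_tensor K M C m c))"
    using module_hom_in[OF f] module_hom_in[OF proj_hom]
    by (simp add: tensor_map_pure[OF M_vs C_vs Q_vs C_vs proj_hom module_hom_id] contract_right_pure[OF M_vs C_vs f]
      contract_right_pure[OF Q_vs C_vs f] module_hom_smult[OF proj_hom])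
qed

lemma qact_proj:
  "f \<in> dual K C \<Longrightarrow> x \<in> carrier M \<Longrightarrow> right_act K quot qcoact f (proj x) = proj (right_act K M \<rho> f x)"
  by (simp add: qcoact_proj contract_proj coact_in)

text \<open>Both comodule laws are obtained by applying the projection to those of \<open>M\<close>, using that it commutes with the
  coaction, with associativity and with contraction.\<close>

lemma quotient_right_comodule: "right_comodule K C \<Delta> \<epsilon> quot qcoact"
proof (intro right_comodule.intro right_comodule_axioms.intro)
  show "coalgebra K C \<Delta> \<epsilon>" by (rule C.coalgebra_axioms)
  show "vectorspace K quot" by (rule Q_vs)
  show "qcoact \<in> module_hom K quot (tensor K quot C)" by (rule qcoact_hom)
  note CC = tensor_vectorspace[OF C_vs C_vs] and MC = tensor_vectorspace[OF M_vs C_vs]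
    and QC = tensor_vectorspace[OF Q_vs C_vs]
  note pid = tensor_map_hom[OF M_vs C_vs Q_vs C_vs proj_hom module_hom_id]
    and pidp = tensor_map_pure[OF M_vs C_vs Q_vs C_vs proj_hom module_hom_id]
  note pCC = tensor_map_hom[OF M_vs CC Q_vs CC proj_hom module_hom_id]
    and pCCp = tensor_map_pure[OF M_vs CC Q_vs CC proj_hom module_hom_id]
  have pc: "proj m \<in> carrier quot" if "m \<in> carrier M" for m by (rule module_hom_in[OF proj_hom that])
  have dc: "\<Delta> c \<in> carrier (tensor K C C)" if "c \<in> carrier C" for c by (rule module_hom_in[OF C.comult_hom that])
  fix X assume "X \<in> carrier quot"
  then obtain x where x: "x \<in> carrier M" "X = proj x" by (auto simp: quot_carrier[OF is_subspace])
  have 1: "tensor_assoc K quot C C (pure_tensor K (tensor K quot C) C (tensor_map K quot C proj id s) c) =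
     tensor_map K quot (tensor K C C) proj id (tensor_assoc K M C C (pure_tensor K (tensor K M C) C s c))"
    if s: "s \<in> carrier (tensor K M C)" and c: "c \<in> carrier C" for s c
    using s
  proof (rule tensor_hom_eqI[OF M_vs C_vs
        module_hom_comp[OF module_hom_comp[OF pid bilinear_mapD(2)[OF pure_tensor_bilinear[OF QC C_vs] c]]
          tensor_assoc_hom[OF Q_vs C_vs C_vs]]
        module_hom_comp[OF module_hom_comp[OF bilinear_mapD(2)[OF pure_tensor_bilinear[OF MC C_vs] c]
          tensor_assoc_hom[OF M_vs C_vs C_vs]] pCC], rotated])
    fix m c' assume "m \<in> carrier M" "c' \<in> carrier C"
    then show "tensor_assoc K quot C C (pure_tensor K (tensor K quot C) C (tensor_map K quot C proj id (pure_tensor K M C m c')) c) =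
     tensor_map K quot (tensor K C C) proj id (tensor_assoc K M C C (pure_tensor K (tensor K M C) C (pure_tensor K M C m c') c))"
      using c pc by (simp add: pidp pCCp tensor_assoc_pure[OF M_vs C_vs C_vs] tensor_assoc_pure[OF Q_vs C_vs C_vs] pure_tensor_in[OF C_vs C_vs])
  qed
  have "tensor_assoc K quot C C (tensor_map K (tensor K quot C) C qcoact id (tensor_map K quot C proj id (\<rho> x)))
     = tensor_map K quot (tensor K C C) proj id (tensor_assoc K M C C (tensor_map K (tensor K M C) C \<rho> id (\<rho> x)))"
    using coact_in[OF x(1)]
  proof (rule tensor_hom_eqI[OF M_vs C_vs
        module_hom_comp[OF module_hom_comp[OF pid tensor_map_hom[OF Q_vs C_vs QC C_vs qcoact_hom module_hom_id]]
          tensor_assoc_hom[OF Q_vs C_vs C_vs]]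
        module_hom_comp[OF module_hom_comp[OF tensor_map_hom[OF M_vs C_vs MC C_vs coact_hom module_hom_id]
          tensor_assoc_hom[OF M_vs C_vs C_vs]] pCC], rotated])
    fix m c assume "m \<in> carrier M" "c \<in> carrier C"
    then show "tensor_assoc K quot C C (tensor_map K (tensor K quot C) C qcoact id (tensor_map K quot C proj id (pure_tensor K M C m c)))
     = tensor_map K quot (tensor K C C) proj id (tensor_assoc K M C C (tensor_map K (tensor K M C) C \<rho> id (pure_tensor K M C m c)))"
      using pc by (simp add: pidp tensor_map_pure[OF Q_vs C_vs QC C_vs qcoact_hom module_hom_id] 
        tensor_map_pure[OF M_vs C_vs MC C_vs coact_hom module_hom_id] qcoact_proj 1 coact_in)
  qed
  also have "\<dots> = tensor_map K quot (tensor K C C) proj id (tensor_map K M (tensor K C C) id \<Delta> (\<rho> x))"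
    using coact_coassoc[OF x(1)] by simp
  also have "\<dots> = tensor_map K quot (tensor K C C) id \<Delta> (tensor_map K quot C proj id (\<rho> x))"
    using coact_in[OF x(1)]
  proof (rule tensor_hom_eqI[OF M_vs C_vs
        module_hom_comp[OF tensor_map_hom[OF M_vs C_vs M_vs CC module_hom_id C.comult_hom] pCC]
        module_hom_comp[OF pid tensor_map_hom[OF Q_vs C_vs Q_vs CC module_hom_id C.comult_hom]], rotated])
    fix m c assume "m \<in> carrier M" "c \<in> carrier C"
    then show "tensor_map K quot (tensor K C C) proj id (tensor_map K M (tensor K C C) id \<Delta> (pure_tensor K M C m c))
      = tensor_map K quot (tensor K C C) id \<Delta> (tensor_map K quot C proj id (pure_tensor K M C m c))"
      using pc dc by (simp add: pidp pCCp tensor_map_pure[OF M_vs C_vs M_vs CC module_hom_id C.comult_hom]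
        tensor_map_pure[OF Q_vs C_vs Q_vs CC module_hom_id C.comult_hom])
  qed
  finally show "tensor_assoc K quot C C (tensor_map K (tensor K quot C) C qcoact id (qcoact X)) =
      tensor_map K quot (tensor K C C) id \<Delta> (qcoact X)"
    using x by (simp add: qcoact_proj)
  have S: "vectorspace K (scalars K)" by (rule scalars_vectorspace) (rule C.field_axioms)
  note e = C.counit_hom
  have id: "id \<in> dual K (scalars K)" by (rule module_hom_id)
  have B: "bilinear_map K quot (scalars K) quot (\<lambda>y a. a \<odot>\<^bsub>quot\<^esub> y)"
    using contract_right_bilinear[OF Q_vs id] by simp
  have "tensor_lift K quot (\<lambda>y a. a \<odot>\<^bsub>quot\<^esub> y) (tensor_map K quot (scalars K) id \<epsilon> (qcoact X)) =
      contract_right K quot \<epsilon> (qcoact X)"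
    using module_hom_in[OF qcoact_hom \<open>X \<in> carrier quot\<close>]
  proof (rule tensor_hom_eqI[OF Q_vs C_vs
        module_hom_comp[OF tensor_map_hom[OF Q_vs C_vs Q_vs S module_hom_id e] tensor_lift_hom[OF Q_vs S Q_vs B]]
        contract_right_hom[OF Q_vs C_vs e], rotated])
    fix m c assume "m \<in> carrier quot" "c \<in> carrier C"
    then show "tensor_lift K quot (\<lambda>y a. a \<odot>\<^bsub>quot\<^esub> y) (tensor_map K quot (scalars K) id \<epsilon> (pure_tensor K quot C m c)) =
      contract_right K quot \<epsilon> (pure_tensor K quot C m c)"
      using module_hom_in[OF e]
      by (simp add: contract_right_pure[OF Q_vs C_vs e] tensor_map_pure[OF Q_vs C_vs Q_vs S module_hom_id e]
        tensor_lift_pure[OF Q_vs S Q_vs B])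
  qed
  also have "\<dots> = X" using qact_proj[OF e x(1)] act_counit[OF x(1)] x(2) by simp
  finally show "tensor_lift K quot (\<lambda>y a. a \<odot>\<^bsub>quot\<^esub> y) (tensor_map K quot (scalars K) id \<epsilon> (qcoact X)) = X" .
qed

end

section \<open>Dimension and comparable cyclic subspaces\<close>

text \<open>Dimension is a notion for whole vector spaces, so a subspace \<open>N\<close> is measured as the restricted record
  \<open>V\<lparr>carrier := N\<rparr>\<close>.\<close>

definition sub_dim where "sub_dim K V N = vectorspace.dim K (V\<lparr>carrier := N\<rparr>)"
definition sub_fin_dim where "sub_fin_dim K V N = vectorspace.fin_dim K (V\<lparr>carrier := N\<rparr>)"

lemma sub_dim_span:
  assumes V: "vectorspace K V" and A: "finite A" "A \<subseteq> carrier V" "\<not> module.lin_dep K V A"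
  shows "sub_fin_dim K V (module.span K V A)" "sub_dim K V (module.span K V A) = card A"
proof -
  interpret V: vectorspace K V by fact
  let ?N = "V.span A"
  have N: "VectorSpace.subspace K ?N V" by (rule V.span_is_subspace[OF A(2)])
  interpret N: vectorspace K "V\<lparr>carrier := ?N\<rparr>" by (rule V.subspace_is_vs[OF N])
  have AN: "A \<subseteq> ?N" by (rule V.in_own_span[OF A(2)])
  note nd = V.span_li_not_depend[OF AN V.is_module[OF N]]
  show "sub_fin_dim K V ?N" unfolding sub_fin_dim_def N.fin_dim_def using A AN nd by auto
  have "N.basis A" unfolding N.basis_def using A AN nd by auto
  then show "sub_dim K V ?N = card A" unfolding sub_dim_def by (rule N.dim_basis[OF A(1)])
qed

lemma subspace_basis:
  assumes M: "VectorSpace.subspace K M V" and fd: "sub_fin_dim K V M"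
    and N: "VectorSpace.subspace K N V" and NM: "N \<subseteq> M"
  obtains A where "finite A" "A \<subseteq> N" "\<not> module.lin_dep K V A" "module.span K V A = N"
    "card A \<le> sub_dim K V M" "card A = sub_dim K V M \<Longrightarrow> N = M"
proof -
  interpret V: vectorspace K V by (rule subspaceD(1)[OF M])
  interpret M: vectorspace K "V\<lparr>carrier := M\<rparr>" by (rule V.subspace_is_vs[OF M])
  interpret N: vectorspace K "V\<lparr>carrier := N\<rparr>" by (rule V.subspace_is_vs[OF N])
  note ndM = V.span_li_not_depend[OF _ V.is_module[OF M]] and ndN = V.span_li_not_depend[OF _ V.is_module[OF N]]
  have fdM: "M.fin_dim" using fd by (simp add: sub_fin_dim_def)
  let ?P = "\<lambda>S. S \<subseteq> carrier (V\<lparr>carrier := N\<rparr>) \<and> \<not> N.lin_dep S"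
  have bound: "finite S \<and> card S \<le> M.dim" if "?P S" for S
  proof -
    have "S \<subseteq> M" "\<not> M.lin_dep S" using that NM ndM(2)[of S] ndN(2)[of S] by auto
    then show ?thesis using M.li_le_dim[OF fdM, of S] by simp
  qed
  have "?P {}" by (auto simp: N.lin_dep_def)
  then obtain A where A: "finite A" "VectorSpace.maximal A ?P"
    using maximal_exists[of ?P M.dim "{}"] bound by blast
  have bA: "N.basis A" by (rule N.max_li_is_basis[OF A(2)])
  then have AN: "A \<subseteq> N" "\<not> V.lin_dep A" "V.span A = N"
    using ndN[of A] by (auto simp: N.basis_def)
  have cA: "card A \<le> M.dim" using bound[of A] bA by (auto simp: N.basis_def)
  show ?thesis
  proof
    show "finite A" "A \<subseteq> N" "\<not> V.lin_dep A" "V.span A = N" by (fact A AN)+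
    show "card A \<le> sub_dim K V M" using cA by (simp add: sub_dim_def)
    assume "card A = sub_dim K V M"
    then have "M.basis A"
      using M.dim_li_is_basis[OF fdM A(1)] AN NM ndM(2)[of A] by (auto simp: sub_dim_def)
    then show "N = M" using AN NM ndM(1)[of A] by (auto simp: M.basis_def)
  qed
qed

lemma sub_dim_mono:
  assumes M: "VectorSpace.subspace K M V" and fd: "sub_fin_dim K V M"
    and N: "VectorSpace.subspace K N V" and NM: "N \<subseteq> M"
  shows "sub_fin_dim K V N" "sub_dim K V N \<le> sub_dim K V M"
    and "sub_dim K V N = sub_dim K V M \<Longrightarrow> N = M"
proof -
  obtain A where A: "finite A" "A \<subseteq> N" "\<not> module.lin_dep K V A" "module.span K V A = N"
    "card A \<le> sub_dim K V M" "card A = sub_dim K V M \<Longrightarrow> N = M"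
    using subspace_basis[OF assms] by blast
  have "A \<subseteq> carrier V" using A(2) subspaceD(2)[OF N] by auto
  note d = sub_dim_span[OF subspaceD(1)[OF M] A(1) this A(3), unfolded A(4)]
  show "sub_fin_dim K V N" "sub_dim K V N \<le> sub_dim K V M" "sub_dim K V N = sub_dim K V M \<Longrightarrow> N = M"
    using d A(5,6) by auto
qed

text \<open>The dimension argument that links the two sides. It is stated for two abstract families of cyclic
  subspaces because it is applied once in each direction.\<close>

lemma cyclic_subspaces_agree:
  assumes L: "\<And>x. x \<in> carrier V \<Longrightarrow> VectorSpace.subspace K (L x) V"
      "\<And>x. x \<in> carrier V \<Longrightarrow> sub_fin_dim K V (L x)" "\<And>x. x \<in> carrier V \<Longrightarrow> x \<in> L x"
    and R: "\<And>x. x \<in> carrier V \<Longrightarrow> VectorSpace.subspace K (R x) V"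
      "\<And>x y. x \<in> carrier V \<Longrightarrow> y \<in> R x \<Longrightarrow> R y \<subseteq> R x"
    and fdR: "\<And>x. x \<in> carrier V \<Longrightarrow> sub_fin_dim K V (R x)"
    and dim: "\<And>x. x \<in> carrier V \<Longrightarrow> sub_dim K V (L x) = sub_dim K V (R x)"
    and chain: "\<And>x y. x \<in> carrier V \<Longrightarrow> y \<in> carrier V \<Longrightarrow> L x \<subseteq> L y \<or> L y \<subseteq> L x"
    and x: "x \<in> carrier V"
  shows "R x = L x"
proof -
  have "R x \<subseteq> L x"
  proof
    fix y assume y: "y \<in> R x"
    then have yc: "y \<in> carrier V" using subspaceD(4)[OF R(1)[OF x]] by simp
    have "sub_dim K V (R y) \<le> sub_dim K V (R x)"
      by (rule sub_dim_mono(2)[OF R(1)[OF x] fdR[OF x] R(1)[OF yc] R(2)[OF x y]])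
    then have le: "sub_dim K V (L y) \<le> sub_dim K V (L x)" by (simp add: dim x yc)
    have "L y \<subseteq> L x"
    proof (cases "L x \<subseteq> L y")
      case True
      then have "sub_dim K V (L x) \<le> sub_dim K V (L y)"
        by (rule sub_dim_mono(2)[OF L(1)[OF yc] L(2)[OF yc] L(1)[OF x]])
      then have "L x = L y" using le by (intro sub_dim_mono(3)[OF L(1)[OF yc] L(2)[OF yc] L(1)[OF x] True]) simp
      then show ?thesis by simp
    qed (use chain[OF x yc] in auto)
    then show "y \<in> L x" using L(3)[OF yc] by auto
  qed
  then show ?thesis using dim[OF x] by (intro sub_dim_mono(3)[OF L(1)[OF x] L(2)[OF x] R(1)[OF x]]) auto
qed

section \<open>Left and right subcomodules of a coalgebra\<close>

context coalgebra
begin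

lemma right_comodule_self: "right_comodule K C \<Delta> \<epsilon> C \<Delta>"
  using coalgebra_axioms vectorspace_axioms comult_hom coassoc counit_right
  by (intro right_comodule.intro right_comodule_axioms.intro) auto

lemma left_comodule_self: "left_comodule K C \<Delta> \<epsilon> C \<Delta>"
  using coalgebra_axioms vectorspace_axioms comult_hom coassoc counit_left
  by (intro left_comodule.intro left_comodule_axioms.intro) auto

interpretation R: right_comodule K C \<Delta> \<epsilon> C \<Delta> by (rule right_comodule_self)
interpretation L: left_comodule K C \<Delta> \<epsilon> C \<Delta> by (rule left_comodule_self)

abbreviation "right_sub N \<equiv> right_subcomodule K C \<Delta> \<epsilon> C \<Delta> N"
abbreviation "left_sub N \<equiv> left_subcomodule K C \<Delta> \<epsilon> C \<Delta> N"
abbreviation "right_cyclic x \<equiv> (\<lambda>f. right_act K C \<Delta> f x) ` dual K C"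
abbreviation "left_cyclic x \<equiv> (\<lambda>f. left_act K C \<Delta> f x) ` dual K C"

lemma right_sub_subspace: "right_sub N \<Longrightarrow> VectorSpace.subspace K N C" by (simp add: R.right_subcomodule_iff)
lemma left_sub_subspace: "left_sub N \<Longrightarrow> VectorSpace.subspace K N C" by (simp add: L.left_subcomodule_iff)

lemma right_cyclic_least: "right_sub N \<Longrightarrow> x \<in> N \<Longrightarrow> right_cyclic x \<subseteq> N" by (auto simp: R.right_subcomodule_iff)
lemma left_cyclic_least: "left_sub N \<Longrightarrow> x \<in> N \<Longrightarrow> left_cyclic x \<subseteq> N" by (auto simp: L.left_subcomodule_iff)

text \<open>Both dimensions are the rank of \<open>\<Delta> x\<close>.\<close>

lemma cyclic_dims:
  assumes x: "x \<in> carrier C"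
  shows "sub_fin_dim K C (right_cyclic x)" "sub_fin_dim K C (left_cyclic x)" "sub_dim K C (right_cyclic x) = sub_dim K C (left_cyclic x)"
proof -
  obtain A B where AB: "finite A" "A \<subseteq> carrier C" "\<not> lin_dep A" "finite B" "B \<subseteq> carrier C" "\<not> lin_dep B"
    "card A = card B" "right_cyclic x = span A" "left_cyclic x = span B"
    using tensor_rank_decomposition[OF vectorspace_axioms vectorspace_axioms R.coact_in[OF x]] by metis
  show "sub_fin_dim K C (right_cyclic x)" "sub_fin_dim K C (left_cyclic x)" "sub_dim K C (right_cyclic x) = sub_dim K C (left_cyclic x)"
    unfolding AB(8,9) using sub_dim_span[OF vectorspace_axioms AB(1-3)] sub_dim_span[OF vectorspace_axioms AB(4-6)] AB(7)
    by auto
qed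

lemma right_cyclic: "x \<in> carrier C \<Longrightarrow> right_sub (right_cyclic x)" "x \<in> carrier C \<Longrightarrow> x \<in> right_cyclic x"
  using R.cyclic_right_subcomodule by auto
lemma left_cyclic: "x \<in> carrier C \<Longrightarrow> left_sub (left_cyclic x)" "x \<in> carrier C \<Longrightarrow> x \<in> left_cyclic x"
  using L.cyclic_left_subcomodule by auto

text \<open>A subspace is a right (left) subcomodule iff it contains the right (left) cyclic subcomodule of each of its
  elements.\<close>

lemma subcomodules_agreeI:
  assumes "\<And>x. x \<in> carrier C \<Longrightarrow> left_cyclic x = right_cyclic x"
  shows "right_sub N \<longleftrightarrow> left_sub N"
proof (cases "VectorSpace.subspace K N C")
  case True
  have "right_sub N \<longleftrightarrow> (\<forall>x\<in>N. right_cyclic x \<subseteq> N)" using True by (auto simp: R.right_subcomodule_iff)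
  also have "\<dots> \<longleftrightarrow> (\<forall>x\<in>N. left_cyclic x \<subseteq> N)" using assms subspaceD(4)[OF True] by simp
  also have "\<dots> \<longleftrightarrow> left_sub N" using True by (auto simp: L.left_subcomodule_iff)
  finally show ?thesis .
qed (auto simp: R.right_subcomodule_iff L.left_subcomodule_iff)

lemma right_chain_agree:
  assumes chain: "\<And>M N. right_sub M \<Longrightarrow> right_sub N \<Longrightarrow> M \<subseteq> N \<or> N \<subseteq> M"
  shows "right_sub N \<longleftrightarrow> left_sub N"
proof (rule subcomodules_agreeI)
  fix x assume x: "x \<in> carrier C"
  show "left_cyclic x = right_cyclic x"
    by (rule cyclic_subspaces_agree[OF right_sub_subspace[OF right_cyclic(1)] cyclic_dims(1) right_cyclic(2) left_sub_subspace[OF left_cyclic(1)]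
          left_cyclic_least[OF left_cyclic(1)] cyclic_dims(2,3) chain[OF right_cyclic(1) right_cyclic(1)] x])
qed

lemma left_chain_agree:
  assumes chain: "\<And>M N. left_sub M \<Longrightarrow> left_sub N \<Longrightarrow> M \<subseteq> N \<or> N \<subseteq> M"
  shows "right_sub N \<longleftrightarrow> left_sub N"
proof (rule subcomodules_agreeI)
  fix x assume x: "x \<in> carrier C"
  have "right_cyclic x = left_cyclic x"
    by (rule cyclic_subspaces_agree[OF left_sub_subspace[OF left_cyclic(1)] cyclic_dims(2) left_cyclic(2) right_sub_subspace[OF right_cyclic(1)]
          right_cyclic_least[OF right_cyclic(1)] cyclic_dims(1) cyclic_dims(3)[symmetric] chain[OF left_cyclic(1) left_cyclic(1)] x])
  then show "left_cyclic x = right_cyclic x" ..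
qed

lemma right_chain_iff_left_chain:
  "right_chain_coalgebra K C \<Delta> \<epsilon> \<longleftrightarrow> left_chain_coalgebra K C \<Delta> \<epsilon>"
  unfolding right_chain_coalgebra_def left_chain_coalgebra_def
  using right_chain_agree left_chain_agree by metis

section \<open>Covers in the lattice of right subcomodules\<close>

lemma right_sub_zero: "right_sub {\<zero>\<^bsub>C\<^esub>}"
  unfolding R.right_subcomodule_iff
  using subspace_zero[OF vectorspace_axioms] module_hom_zero[OF vectorspace_axioms vectorspace_axioms R.act_hom] by auto

lemma right_sub_carrier: "right_sub (carrier C)"
  unfolding R.right_subcomodule_iff
  using subspace_carrier[OF vectorspace_axioms] module_hom_in[OF R.act_hom] by auto

lemma right_sub_Int: "right_sub M \<Longrightarrow> right_sub N \<Longrightarrow> right_sub (M \<inter> N)"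
  by (simp add: R.right_subcomodule_iff subspace_Int)

lemma right_sub_sum:
  assumes M: "right_sub M" and N: "right_sub N"
  shows "right_sub (subspace_sum M N)" "M \<subseteq> subspace_sum M N" "N \<subseteq> subspace_sum M N"
proof -
  note sM = right_sub_subspace[OF M] and sN = right_sub_subspace[OF N]
  have "right_act K C \<Delta> f x \<in> subspace_sum M N" if x: "x \<in> subspace_sum M N" and f: "f \<in> dual K C" for f x
  proof -
    from x obtain m n where mn: "m \<in> M" "n \<in> N" "x = m \<oplus>\<^bsub>C\<^esub> n" by (auto simp: submodule_sum_def)
    then have "right_act K C \<Delta> f x = right_act K C \<Delta> f m \<oplus>\<^bsub>C\<^esub> right_act K C \<Delta> f n"
      using subspaceD(4)[OF sM] subspaceD(4)[OF sN] by (simp add: module_hom_add[OF R.act_hom[OF f]])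
    moreover have "right_act K C \<Delta> f m \<in> M" "right_act K C \<Delta> f n \<in> N"
      using M N mn f by (auto simp: R.right_subcomodule_iff)
    ultimately show ?thesis by (auto simp: submodule_sum_def)
  qed
  then show "right_sub (subspace_sum M N)" unfolding R.right_subcomodule_iff using sum_is_subspace[OF sM sN] by blast
  show "M \<subseteq> subspace_sum M N" by (rule in_sum_vs[OF sM sN])
  show "N \<subseteq> subspace_sum M N" using in_sum_vs[OF sN sM] vsum_comm[OF sM sN] by simp
qed

lemma mem_subspace_sumD:
  assumes M: "right_sub M" and N: "right_sub N" and B: "right_sub B" "M \<subseteq> B" and b: "b \<in> B" "b \<in> subspace_sum M N"
  obtains m n where "m \<in> M" "n \<in> N" "n \<in> B" "b = m \<oplus>\<^bsub>C\<^esub> n"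
proof -
  from b obtain m n where mn: "m \<in> M" "n \<in> N" "b = m \<oplus>\<^bsub>C\<^esub> n" by (auto simp: submodule_sum_def)
  then have c: "m \<in> carrier C" "n \<in> carrier C"
    using subspaceD(4)[OF right_sub_subspace[OF M]] subspaceD(4)[OF right_sub_subspace[OF N]] by auto
  have "b = n \<oplus>\<^bsub>C\<^esub> m" using mn c by (simp add: M.a_comm)
  then have "b \<ominus>\<^bsub>C\<^esub> m = n" using c by (simp add: a_minus_def M.a_assoc M.r_neg)
  moreover have "b \<ominus>\<^bsub>C\<^esub> m \<in> B" using b(1) B(2) mn(1) by (intro subspace_minus[OF right_sub_subspace[OF B(1)]]) auto
  ultimately show ?thesis using mn that by simp
qed

text \<open>The covering relation \<open>N \<prec> A\<close>; over a subcomodule \<open>N\<close> the covers \<open>A\<close> correspond to the simple subcomodules \<open>A/N\<close> of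
  \<open>C/N\<close>.\<close>

definition covers :: "'c set \<Rightarrow> 'c set \<Rightarrow> bool" where
  "covers A N \<longleftrightarrow> right_sub A \<and> N \<subset> A \<and> (\<forall>B. right_sub B \<and> N \<subseteq> B \<and> B \<subseteq> A \<longrightarrow> B = N \<or> B = A)"

text \<open>Among the subcomodules of the finite dimensional \<open>D\<close> that are not contained in \<open>N\<close> choose one, \<open>D'\<close>, of least
  dimension. By the modular law, a subcomodule \<open>B\<close> between \<open>N\<close> and \<open>N + D'\<close> is determined by \<open>B \<inter> D'\<close>, which is contained
  in \<open>N\<close> or equal to \<open>D'\<close> by minimality.\<close>

lemma covers_exists:
  assumes N: "right_sub N" and D: "right_sub D" "sub_fin_dim K C D" "\<not> D \<subseteq> N"
  obtains A where "covers A N" "A \<subseteq> subspace_sum N D"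
proof -
  define P where "P D' \<longleftrightarrow> right_sub D' \<and> D' \<subseteq> D \<and> \<not> D' \<subseteq> N" for D'
  have "P D" using D by (simp add: P_def)
  then obtain D' where D': "P D'" and min: "\<And>E. P E \<Longrightarrow> sub_dim K C D' \<le> sub_dim K C E"
    using ex_has_least_nat[of P D "sub_dim K C"] by blast
  have RD': "right_sub D'" "D' \<subseteq> D" "\<not> D' \<subseteq> N" using D' by (auto simp: P_def)
  have fd: "sub_fin_dim K C D'"
    by (rule sub_dim_mono(1)[OF right_sub_subspace[OF D(1)] D(2) right_sub_subspace[OF RD'(1)] RD'(2)])
  let ?A = "subspace_sum N D'"
  note S = right_sub_sum[OF N RD'(1)]
  have "B = N \<or> B = ?A" if B: "right_sub B" "N \<subseteq> B" "B \<subseteq> ?A" for B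
  proof (cases "B \<inter> D' \<subseteq> N")
    case True
    have "B \<subseteq> N"
    proof
      fix b assume b: "b \<in> B"
      then obtain m n where "m \<in> N" "n \<in> D'" "n \<in> B" "b = m \<oplus>\<^bsub>C\<^esub> n"
        using mem_subspace_sumD[OF N RD'(1) B(1,2) b] B(3) by blast
      then show "b \<in> N" using True subspaceD(5)[OF right_sub_subspace[OF N]] by auto
    qed
    then show ?thesis using B by auto
  next
    case False
    have BD: "right_sub (B \<inter> D')" using right_sub_Int[OF B(1) RD'(1)] .
    then have "P (B \<inter> D')" using False RD' by (auto simp: P_def)
    then have "sub_dim K C D' \<le> sub_dim K C (B \<inter> D')" by (rule min)
    moreover have "sub_dim K C (B \<inter> D') \<le> sub_dim K C D'"
      by (rule sub_dim_mono(2)[OF right_sub_subspace[OF RD'(1)] fd right_sub_subspace[OF BD]]) simp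
    ultimately have "B \<inter> D' = D'"
      by (intro sub_dim_mono(3)[OF right_sub_subspace[OF RD'(1)] fd right_sub_subspace[OF BD]]) auto
    then have "?A \<subseteq> B"
      using vsum_is_minimal[OF right_sub_subspace[OF N] right_sub_subspace[OF RD'(1)] right_sub_subspace[OF B(1)]] B(2) by auto
    then show ?thesis using B by auto
  qed
  then have "covers ?A N" unfolding covers_def using S RD'(3) by blast
  moreover have "?A \<subseteq> subspace_sum N D" using RD'(2) by (auto simp: submodule_sum_def)
  ultimately show ?thesis using that by blast
qed

section \<open>Socles of quotients\<close>

abbreviation "Q N \<equiv> quot_mod K C N"
abbreviation "quot_sub N T \<equiv> right_subcomodule K C \<Delta> \<epsilon> (quot_mod K C N) (quot_coact K C C \<Delta> N) T"
abbreviation "quot_simple N T \<equiv> simple_right_subcomodule K C \<Delta> \<epsilon> (quot_mod K C N) (quot_coact K C C \<Delta> N) T"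
abbreviation "coset_preimage N T \<equiv> {x \<in> carrier C. N +>\<^bsub>C\<^esub> x \<in> T}"
abbreviation "cosets N B \<equiv> (\<lambda>x. N +>\<^bsub>C\<^esub> x) ` B"

lemma coset_preimage_zero: "right_sub N \<Longrightarrow> coset_preimage N {\<zero>\<^bsub>Q N\<^esub>} = N"
  using quot_proj_zero_iff[OF right_sub_subspace] subspaceD(4)[OF right_sub_subspace] by blast

lemma cosets_zero:
  assumes N: "right_sub N"
  shows "cosets N N = {\<zero>\<^bsub>Q N\<^esub>}"
proof -
  have "N +>\<^bsub>C\<^esub> x = \<zero>\<^bsub>Q N\<^esub>" if "x \<in> N" for x
    using that quot_proj_zero_iff[OF right_sub_subspace[OF N]] subspaceD(4)[OF right_sub_subspace[OF N]] by simp
  then show ?thesis using subspaceD(3)[OF right_sub_subspace[OF N]] by auto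
qed

lemma coset_preimage_cosets:
  assumes N: "right_sub N" and B: "VectorSpace.subspace K B C" and NB: "N \<subseteq> B"
  shows "coset_preimage N (cosets N B) = B"
proof
  show "B \<subseteq> coset_preimage N (cosets N B)" using subspaceD(4)[OF B] by auto
  show "coset_preimage N (cosets N B) \<subseteq> B"
  proof clarify
    fix x b assume x: "x \<in> carrier C" "b \<in> B" "N +>\<^bsub>C\<^esub> x = N +>\<^bsub>C\<^esub> b"
    have b: "b \<in> carrier C" by (rule subspaceD(4)[OF B x(2)])
    have "x \<ominus>\<^bsub>C\<^esub> b \<in> B" using coset_eq_iff[OF right_sub_subspace[OF N] x(1) b] x(3) NB by auto
    then have "(x \<ominus>\<^bsub>C\<^esub> b) \<oplus>\<^bsub>C\<^esub> b \<in> B" using x(2) by (rule subspaceD(5)[OF B])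
    then show "x \<in> B" using x b by (simp add: a_minus_def M.a_assoc M.l_neg)
  qed
qed

lemma quot_sub_cosets:
  assumes N: "right_sub N" and B: "right_sub B"
  shows "quot_sub N (cosets N B)"
proof -
  interpret N: right_subcomodule K C \<Delta> \<epsilon> C \<Delta> N by (rule N)
  interpret Q: right_comodule K C \<Delta> \<epsilon> "quot_mod K C N" "quot_coact K C C \<Delta> N"
    by (rule N.quotient_right_comodule)
  have "right_act K (Q N) (quot_coact K C C \<Delta> N) f X \<in> cosets N B"
    if "X \<in> cosets N B" and f: "f \<in> dual K C" for X f
  proof -
    from that obtain b where b: "b \<in> B" "X = N +>\<^bsub>C\<^esub> b" by auto
    then have "right_act K C \<Delta> f b \<in> B" using B f by (simp add: R.right_subcomodule_iff)
    moreover have "b \<in> carrier C" by (rule subspaceD(4)[OF right_sub_subspace[OF B] b(1)])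
    ultimately show ?thesis using N.qact_proj[OF f] b by simp
  qed
  then show ?thesis unfolding Q.right_subcomodule_iff
    using subspace_image[OF N.Q_vs N.proj_hom right_sub_subspace[OF B]] by blast
qed

lemma quot_sub_preim:
  assumes N: "right_sub N" and T: "quot_sub N T"
  shows "right_sub (coset_preimage N T)" "N \<subseteq> coset_preimage N T" "cosets N (coset_preimage N T) = T"
proof -
  interpret N: right_subcomodule K C \<Delta> \<epsilon> C \<Delta> N by (rule N)
  interpret Q: right_comodule K C \<Delta> \<epsilon> "quot_mod K C N" "quot_coact K C C \<Delta> N"
    by (rule N.quotient_right_comodule)
  have sT: "VectorSpace.subspace K T (Q N)"
    and stable: "\<And>X f. X \<in> T \<Longrightarrow> f \<in> dual K C \<Longrightarrow> right_act K (Q N) (quot_coact K C C \<Delta> N) f X \<in> T"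
    using T unfolding Q.right_subcomodule_iff by auto
  have "right_act K C \<Delta> f x \<in> coset_preimage N T" if "x \<in> coset_preimage N T" and f: "f \<in> dual K C" for x f
    using that stable[of "N +>\<^bsub>C\<^esub> x" f] N.qact_proj[OF f] module_hom_in[OF R.act_hom[OF f]] by auto
  then show "right_sub (coset_preimage N T)" unfolding R.right_subcomodule_iff
    using subspace_vimage[OF vectorspace_axioms N.proj_hom sT] by blast
  show "N \<subseteq> coset_preimage N T"
  proof
    fix x assume x: "x \<in> N"
    then have "x \<in> carrier C" by (rule subspaceD(4)[OF right_sub_subspace[OF N]])
    moreover have "N +>\<^bsub>C\<^esub> x = \<zero>\<^bsub>Q N\<^esub>" using cosets_zero[OF N] x by blast
    ultimately show "x \<in> coset_preimage N T" using subspaceD(3)[OF sT] by simp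
  qed
  show "cosets N (coset_preimage N T) = T"
    using subspaceD(2)[OF sT] by (auto simp: quot_carrier[OF right_sub_subspace[OF N]])
qed

text \<open>Taking preimages identifies the subcomodules of \<open>C/N\<close> with the right subcomodules above \<open>N\<close>, and so simple
  ones with covers of \<open>N\<close>.\<close>

lemma simple_covers:
  assumes N: "right_sub N" and T: "quot_simple N T"
  shows "covers (coset_preimage N T) N" "cosets N (coset_preimage N T) = T"
proof -
  have QT: "quot_sub N T" "T \<noteq> {\<zero>\<^bsub>Q N\<^esub>}" "\<And>U. quot_sub N U \<Longrightarrow> U \<subseteq> T \<Longrightarrow> U = {\<zero>\<^bsub>Q N\<^esub>} \<or> U = T"
    using T by (auto simp: simple_right_subcomodule_def)
  note P = quot_sub_preim[OF N QT(1)]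
  show "cosets N (coset_preimage N T) = T" by (rule P(3))
  have "coset_preimage N T \<noteq> N" using P(3) cosets_zero[OF N] QT(2) by auto
  moreover have "B = N \<or> B = coset_preimage N T" if B: "right_sub B" "N \<subseteq> B" "B \<subseteq> coset_preimage N T" for B
  proof -
    have "cosets N B \<subseteq> T" using B(3) by auto
    then have "cosets N B = {\<zero>\<^bsub>Q N\<^esub>} \<or> cosets N B = T" using QT(3)[OF quot_sub_cosets[OF N B(1)]] by blast
    then show ?thesis using coset_preimage_cosets[OF N right_sub_subspace[OF B(1)] B(2)] coset_preimage_zero[OF N] by metis
  qed
  ultimately show "covers (coset_preimage N T) N" unfolding covers_def using P(1,2) by blast
qed

lemma covers_simple:
  assumes N: "right_sub N" and A: "covers A N"
  shows "quot_simple N (cosets N A)"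
proof -
  have RA: "right_sub A" "N \<subseteq> A" "N \<noteq> A" "\<And>B. right_sub B \<Longrightarrow> N \<subseteq> B \<Longrightarrow> B \<subseteq> A \<Longrightarrow> B = N \<or> B = A"
    using A by (auto simp: covers_def)
  note pA = coset_preimage_cosets[OF N right_sub_subspace[OF RA(1)] RA(2)]
  have "cosets N A \<noteq> {\<zero>\<^bsub>Q N\<^esub>}" using pA coset_preimage_zero[OF N] RA(3) by metis
  moreover have "U = {\<zero>\<^bsub>Q N\<^esub>} \<or> U = cosets N A" if U: "quot_sub N U" "U \<subseteq> cosets N A" for U
  proof -
    note P = quot_sub_preim[OF N U(1)]
    have "coset_preimage N U \<subseteq> A" using U(2) pA by blast
    then consider "coset_preimage N U = N" | "coset_preimage N U = A" using RA(4)[OF P(1,2)] by blast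
    then show ?thesis
    proof cases
      case 1
      then show ?thesis using P(3) cosets_zero[OF N] unfolding 1 by blast
    next
      case 2
      then show ?thesis using P(3) unfolding 2 by blast
    qed
  qed
  ultimately show ?thesis unfolding simple_right_subcomodule_def using quot_sub_cosets[OF N RA(1)] by blast
qed

text \<open>What is used of the preimage \<open>P\<close> of the socle of \<open>C/N\<close>: it contains every cover of \<open>N\<close>, and if there is
  at most one cover, the covers determine it.\<close>

definition socle_above :: "'c set \<Rightarrow> 'c set \<Rightarrow> bool" where
  "socle_above P N \<longleftrightarrow> VectorSpace.subspace K P C \<and> N \<subseteq> P \<and> (\<forall>A. covers A N \<longrightarrow> A \<subseteq> P) \<and>
    ((\<forall>A. \<not> covers A N) \<longrightarrow> P = N) \<and> (\<forall>A. covers A N \<longrightarrow> (\<forall>B. covers B N \<longrightarrow> B = A) \<longrightarrow> P = A)"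

lemma socle_aboveD:
  assumes "socle_above P N"
  shows "VectorSpace.subspace K P C" "N \<subseteq> P" "covers A N \<Longrightarrow> A \<subseteq> P" "\<forall>A. \<not> covers A N \<Longrightarrow> P = N"
    and "covers A N \<Longrightarrow> \<forall>B. covers B N \<longrightarrow> B = A \<Longrightarrow> P = A"
  using assms unfolding socle_above_def by iprover+

lemma coversD:
  assumes "covers A N"
  shows "right_sub A" "N \<subseteq> A" "N \<noteq> A" "right_sub B \<Longrightarrow> N \<subseteq> B \<Longrightarrow> B \<subseteq> A \<Longrightarrow> B = N \<or> B = A"
  using assms unfolding covers_def by auto

lemma socle_above_step:
  assumes N: "right_sub N"
  shows "socle_above (coset_preimage N (right_socle K C \<Delta> \<epsilon> (quot_mod K C N) (quot_coact K C C \<Delta> N))) N"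
proof -
  interpret N: right_subcomodule K C \<Delta> \<epsilon> C \<Delta> N by (rule N)
  interpret Q: right_comodule K C \<Delta> \<epsilon> "quot_mod K C N" "quot_coact K C C \<Delta> N"
    by (rule N.quotient_right_comodule)
  define Z where "Z = right_socle K C \<Delta> \<epsilon> (quot_mod K C N) (quot_coact K C C \<Delta> N)"
  let ?U = "\<Union>{S. quot_simple N S}"
  have Z: "Z = Q.M.span ?U" by (simp add: Z_def right_socle_def)
  have U: "?U \<subseteq> carrier (Q N)"
    using subspaceD(2) by (auto simp: simple_right_subcomodule_def Q.right_subcomodule_iff)
  have sZ: "VectorSpace.subspace K Z (Q N)" unfolding Z by (rule Q.M.span_is_subspace[OF U])
  have "VectorSpace.subspace K (coset_preimage N Z) C" by (rule subspace_vimage[OF vectorspace_axioms N.proj_hom sZ])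
  moreover have NZ: "N \<subseteq> coset_preimage N Z"
  proof -
    have "coset_preimage N {\<zero>\<^bsub>Q N\<^esub>} \<subseteq> coset_preimage N Z" using subspaceD(3)[OF sZ] by auto
    then show ?thesis unfolding coset_preimage_zero[OF N] .
  qed
  moreover have "A \<subseteq> coset_preimage N Z" if A: "covers A N" for A
  proof -
    have "cosets N A \<subseteq> Z" unfolding Z using covers_simple[OF N A] Q.M.in_own_span[OF U] by blast
    then show ?thesis using A subspaceD(4)[OF right_sub_subspace] by (auto simp: covers_def)
  qed
  moreover have "coset_preimage N Z = N" if none: "\<forall>A. \<not> covers A N"
  proof -
    have U0: "?U = {}" using none simple_covers(1)[OF N] by blast
    have Z0: "Z = {\<zero>\<^bsub>Q N\<^esub>}" unfolding Z U0 by (rule Q.M.span_empty)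
    show ?thesis unfolding Z0 by (rule coset_preimage_zero[OF N])
  qed
  moreover have "coset_preimage N Z = A" if A: "covers A N" and uniq: "\<forall>B. covers B N \<longrightarrow> B = A" for A
  proof -
    have RA: "right_sub A" "N \<subseteq> A" using A by (auto simp: covers_def)
    have "S = cosets N A" if "quot_simple N S" for S
    proof -
      have *: "coset_preimage N S = A" using simple_covers(1)[OF N that] uniq by blast
      show ?thesis using simple_covers(2)[OF N that] unfolding * by blast
    qed
    then have "?U = cosets N A" using covers_simple[OF N A] by blast
    then have "Z \<subseteq> cosets N A"
      using span_minimal[OF subspace_image[OF N.Q_vs N.proj_hom right_sub_subspace[OF RA(1)]], of ?U] by (simp add: Z)
    then have "coset_preimage N Z \<subseteq> coset_preimage N (cosets N A)" by auto
    then have "coset_preimage N Z \<subseteq> A" unfolding coset_preimage_cosets[OF N right_sub_subspace[OF RA(1)] RA(2)] .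
    moreover have "A \<subseteq> coset_preimage N Z" using \<open>\<And>A. covers A N \<Longrightarrow> A \<subseteq> coset_preimage N Z\<close> A by blast
    ultimately show ?thesis by blast
  qed
  ultimately show ?thesis unfolding socle_above_def Z_def by blast
qed

lemma simple_iff_covers_zero:
  "simple_right_subcomodule K C \<Delta> \<epsilon> C \<Delta> S \<longleftrightarrow> covers S {\<zero>\<^bsub>C\<^esub>}"
  unfolding simple_right_subcomodule_def covers_def
  using subspaceD(3)[OF right_sub_subspace] by blast

text \<open>The filtration starts with the socle of \<open>C\<close> itself instead of the socle of \<open>C/0\<close>; the simple subcomodules of \<open>C\<close>
  are the covers of zero.\<close>

lemma socle_above_zero: "socle_above (right_socle K C \<Delta> \<epsilon> C \<Delta>) {\<zero>\<^bsub>C\<^esub>}"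
proof -
  let ?U = "\<Union>{S. covers S {\<zero>\<^bsub>C\<^esub>}}"
  have Z: "right_socle K C \<Delta> \<epsilon> C \<Delta> = span ?U" by (simp add: right_socle_def simple_iff_covers_zero)
  have U: "?U \<subseteq> carrier C" using subspaceD(2)[OF right_sub_subspace] by (auto simp: covers_def)
  have s: "VectorSpace.subspace K (span ?U) C" by (rule span_is_subspace[OF U])
  have "span ?U = A" if A: "covers A {\<zero>\<^bsub>C\<^esub>}" and uniq: "\<forall>B. covers B {\<zero>\<^bsub>C\<^esub>} \<longrightarrow> B = A" for A
  proof -
    have "?U = A" using A uniq by blast
    moreover have "VectorSpace.subspace K A C" using A right_sub_subspace by (auto simp: covers_def)
    ultimately show ?thesis using span_minimal[of K A C A] in_own_span[OF U] by auto
  qed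
  moreover have "span ?U = {\<zero>\<^bsub>C\<^esub>}" if "\<forall>A. \<not> covers A {\<zero>\<^bsub>C\<^esub>}" using that by (simp add: span_empty)
  moreover have "A \<subseteq> span ?U" if "covers A {\<zero>\<^bsub>C\<^esub>}" for A using that in_own_span[OF U] by blast
  moreover have "{\<zero>\<^bsub>C\<^esub>} \<subseteq> span ?U" using subspaceD(3)[OF s] by simp
  ultimately show ?thesis unfolding socle_above_def Z using s by blast
qed

section \<open>The coradical filtration\<close>

text \<open>The filtration shifted to start at index zero: \<open>layer n\<close> is \<open>C\<^sub>n\<^sub>-\<^sub>1\<close>. This makes it accessible to induction on natural
  numbers.\<close>

definition layer :: "nat \<Rightarrow> 'c set" where "layer n = corad_filt K C \<Delta> \<epsilon> (int n - 1)"

lemma layer_0: "layer 0 = {\<zero>\<^bsub>C\<^esub>}" by (simp add: layer_def corad_filt_def)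

lemma layer_Suc: "layer (Suc n) = corad_nat K C \<Delta> \<epsilon> n" by (simp add: layer_def corad_filt_def)

lemma socle_above_layer:
  assumes "right_sub (layer n)"
  shows "socle_above (layer (Suc n)) (layer n)"
proof (cases n)
  case 0
  then show ?thesis using socle_above_zero by (simp add: layer_0 layer_Suc)
next
  case (Suc m)
  then have "layer (Suc n) = coset_preimage (layer n) (right_socle K C \<Delta> \<epsilon> (quot_mod K C (layer n)) (quot_coact K C C \<Delta> (layer n)))"
    by (simp add: layer_Suc Let_def)
  then show ?thesis using socle_above_step[OF assms] by (simp only:)
qed

text \<open>The factor is the image of the next layer in the quotient by the present one, and the next layer is
  the full preimage of that image.\<close>

lemma factor_iff:
  assumes N: "right_sub (layer n)"
  shows "corad_factor_zero_or_simple K C \<Delta> \<epsilon> (int n - 1) \<longleftrightarrow>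
     layer (Suc n) = layer n \<or> covers (layer (Suc n)) (layer n)"
proof -
  note P = socle_aboveD(1,2)[OF socle_above_layer[OF N]]
  note pP = coset_preimage_cosets[OF N P]
  have "corad_factor_zero_or_simple K C \<Delta> \<epsilon> (int n - 1) \<longleftrightarrow>
     cosets (layer n) (layer (Suc n)) = {\<zero>\<^bsub>Q (layer n)\<^esub>} \<or> quot_simple (layer n) (cosets (layer n) (layer (Suc n)))"
    by (simp add: corad_factor_zero_or_simple_def layer_def Let_def)
  also have "cosets (layer n) (layer (Suc n)) = {\<zero>\<^bsub>Q (layer n)\<^esub>} \<longleftrightarrow> layer (Suc n) = layer n"
  proof
    assume "cosets (layer n) (layer (Suc n)) = {\<zero>\<^bsub>Q (layer n)\<^esub>}"
    then show "layer (Suc n) = layer n" using pP coset_preimage_zero[OF N] by (simp only:)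
  qed (simp only: cosets_zero[OF N])
  also have "quot_simple (layer n) (cosets (layer n) (layer (Suc n))) \<longleftrightarrow> covers (layer (Suc n)) (layer n)"
    using simple_covers(1)[OF N, of "cosets (layer n) (layer (Suc n))", unfolded pP] covers_simple[OF N] by blast
  finally show ?thesis .
qed

lemma all_ge_neg1: "(\<forall>n\<ge>-1::int. P n) \<longleftrightarrow> (\<forall>n::nat. P (int n - 1))"
proof
  assume *: "\<forall>n. P (int n - 1)"
  show "\<forall>n\<ge>-1. P n"
  proof (intro allI impI)
    fix n :: int assume "n \<ge> -1"
    then show "P n" using *[rule_format, of "nat (n + 1)"] by simp
  qed
qed auto

text \<open>The lattice form of the condition on the factors of the filtration.\<close>

definition uniserial_layers :: bool where
  "uniserial_layers \<longleftrightarrow> (\<forall>n. right_sub (layer n) \<and> (layer (Suc n) = layer n \<or> covers (layer (Suc n)) (layer n)))"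

text \<open>A factor is known to be a subcomodule of a comodule only once the layer below it is a right
  subcomodule; the induction supplies this along the way.\<close>

lemma factors_iff_uniserial:
  "(\<forall>n\<ge>-1. corad_factor_zero_or_simple K C \<Delta> \<epsilon> n) \<longleftrightarrow> uniserial_layers"
proof -
  have layers_RS: "right_sub (layer n)" if *: "\<And>n. corad_factor_zero_or_simple K C \<Delta> \<epsilon> (int n - 1)" for n
  proof (induction n)
    case (Suc n)
    from *[of n] have "layer (Suc n) = layer n \<or> covers (layer (Suc n)) (layer n)"
      unfolding factor_iff[OF Suc] .
    then show ?case
    proof
      assume "layer (Suc n) = layer n"
      then show ?thesis using Suc by simp
    qed (rule coversD(1))
  qed (simp add: layer_0 right_sub_zero)
  show ?thesis unfolding all_ge_neg1 uniserial_layers_def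
  proof
    assume "\<forall>n. corad_factor_zero_or_simple K C \<Delta> \<epsilon> (int n - 1)"
    then have *: "corad_factor_zero_or_simple K C \<Delta> \<epsilon> (int n - 1)" for n by blast
    show "\<forall>n. right_sub (layer n) \<and> (layer (Suc n) = layer n \<or> covers (layer (Suc n)) (layer n))"
    proof (intro allI conjI)
      fix n show RSn: "right_sub (layer n)" by (rule layers_RS[OF *])
      show "layer (Suc n) = layer n \<or> covers (layer (Suc n)) (layer n)"
        using *[of n] unfolding factor_iff[OF RSn] .
    qed
  next
    assume *: "\<forall>n. right_sub (layer n) \<and> (layer (Suc n) = layer n \<or> covers (layer (Suc n)) (layer n))"
    show "\<forall>n. corad_factor_zero_or_simple K C \<Delta> \<epsilon> (int n - 1)"
    proof
      fix n
      have RSn: "right_sub (layer n)" using * by blast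
      show "corad_factor_zero_or_simple K C \<Delta> \<epsilon> (int n - 1)" unfolding factor_iff[OF RSn] using * by blast
    qed
  qed
qed

text \<open>In a chain two covers of the same subcomodule are comparable and hence equal.\<close>

lemma chain_imp_uniserial:
  assumes chain: "\<And>M N. right_sub M \<Longrightarrow> right_sub N \<Longrightarrow> M \<subseteq> N \<or> N \<subseteq> M"
  shows uniserial_layers
proof -
  have step: "layer (Suc n) = layer n \<or> covers (layer (Suc n)) (layer n)" if N: "right_sub (layer n)" for n
  proof (cases "\<exists>A. covers A (layer n)")
    case True
    then obtain A where A: "covers A (layer n)" by blast
    have "B = A" if B: "covers B (layer n)" for B
      using chain[OF coversD(1)[OF A] coversD(1)[OF B]] coversD(4)[OF A coversD(1,2)[OF B]]
        coversD(4)[OF B coversD(1,2)[OF A]] coversD(3)[OF A] coversD(3)[OF B] by argo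
    then have "layer (Suc n) = A" using socle_aboveD(5)[OF socle_above_layer[OF N] A] by simp
    then show ?thesis using A by simp
  next
    case False
    then show ?thesis using socle_aboveD(4)[OF socle_above_layer[OF N]] by simp
  qed
  have "right_sub (layer n)" for n
  proof (induction n)
    case (Suc n)
    from step[OF Suc] show ?case
    proof
      assume "layer (Suc n) = layer n"
      then show ?thesis using Suc by simp
    qed (rule coversD(1))
  qed (simp add: layer_0 right_sub_zero)
  then show ?thesis using step by (simp add: uniserial_layers_def)
qed

context
  assumes uniserial: uniserial_layers
begin

lemma right_sub_layer: "right_sub (layer n)" using uniserial unfolding uniserial_layers_def by (elim allE conjE)

lemma layer_step: "layer (Suc n) = layer n \<or> covers (layer (Suc n)) (layer n)"
  using uniserial unfolding uniserial_layers_def by (elim allE conjE)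

lemma layer_mono: "m \<le> n \<Longrightarrow> layer m \<subseteq> layer n"
proof (rule lift_Suc_mono_le[of layer])
  fix k
  from layer_step[of k] show "layer k \<subseteq> layer (Suc k)"
    by (elim disjE) (rule equalityD2, assumption, rule coversD(2))
qed

text \<open>If \<open>x\<close> is in no layer, the cyclic subcomodule of \<open>x\<close> yields a cover of each layer, which lies in the next one.
  By the modular law its intersections with the layers increase strictly in dimension, which is impossible in finite dimension.\<close>

lemma layers_exhaust:
  assumes x: "x \<in> carrier C"
  shows "\<exists>n. x \<in> layer n"
proof (rule ccontr)
  assume no: "\<not> (\<exists>n. x \<in> layer n)"
  note D = right_cyclic[OF x] and fd = cyclic_dims(1)[OF x]
  have I: "VectorSpace.subspace K (right_cyclic x \<inter> layer n) C" for n
    by (rule right_sub_subspace[OF right_sub_Int[OF D(1) right_sub_layer]])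
  have fdI: "sub_fin_dim K C (right_cyclic x \<inter> layer n)" "sub_dim K C (right_cyclic x \<inter> layer n) \<le> sub_dim K C (right_cyclic x)" for n
    using sub_dim_mono[OF right_sub_subspace[OF D(1)] fd I] by auto
  have lt: "sub_dim K C (right_cyclic x \<inter> layer n) < sub_dim K C (right_cyclic x \<inter> layer (Suc n))" for n
  proof -
    have "\<not> right_cyclic x \<subseteq> layer n" using D(2) no by blast
    then obtain A where A: "covers A (layer n)" "A \<subseteq> subspace_sum (layer n) (right_cyclic x)"
      using covers_exists[OF right_sub_layer D(1) fd] by blast
    have AS: "A \<subseteq> layer (Suc n)" by (rule socle_aboveD(3)[OF socle_above_layer[OF right_sub_layer] A(1)])
    note RA = coversD(1,2)[OF A(1)]
    obtain a where a: "a \<in> A" "a \<notin> layer n" using coversD(2,3)[OF A(1)] by auto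
    obtain m d where md: "m \<in> layer n" "d \<in> right_cyclic x" "d \<in> A" "a = m \<oplus>\<^bsub>C\<^esub> d"
      using mem_subspace_sumD[OF right_sub_layer D(1) RA a(1)] A(2) a(1) by blast
    have "d \<notin> layer n" using md a(2) subspaceD(5)[OF right_sub_subspace[OF right_sub_layer]] by blast
    then have ne: "right_cyclic x \<inter> layer n \<noteq> right_cyclic x \<inter> layer (Suc n)" using md AS by blast
    have sub: "right_cyclic x \<inter> layer n \<subseteq> right_cyclic x \<inter> layer (Suc n)" using layer_mono[of n "Suc n"] by auto
    note d = sub_dim_mono[OF I fdI(1) I sub]
    show ?thesis using d(2,3) ne by linarith
  qed
  have "n \<le> sub_dim K C (right_cyclic x \<inter> layer n)" for n
  proof (induction n)
    case (Suc n)
    then show ?case using lt[of n] by linarith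
  qed simp
  from this[of "Suc (sub_dim K C (right_cyclic x))"] fdI(2)[of "Suc (sub_dim K C (right_cyclic x))"]
  show False by linarith
qed

text \<open>Let \<open>layer (Suc k)\<close> be the first layer not contained in \<open>M\<close>. If \<open>M\<close> were larger than \<open>layer k\<close>, it would contain a cover
  of \<open>layer k\<close>; but \<open>layer (Suc k)\<close> contains all covers of \<open>layer k\<close> and is one itself, so it would be that cover.\<close>

lemma right_sub_classification:
  assumes M: "right_sub M"
  shows "M = carrier C \<or> (\<exists>n. M = layer n)"
proof (cases "\<forall>n. layer n \<subseteq> M")
  case True
  then have "carrier C \<subseteq> M" using layers_exhaust by blast
  then show ?thesis using subspaceD(2)[OF right_sub_subspace[OF M]] by blast
next
  case False
  then have "\<exists>n. \<not> layer n \<subseteq> M" by (simp only: not_all)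
  from exists_least_iff[THEN iffD1, OF this]
  obtain n where n: "\<not> layer n \<subseteq> M" and least: "\<And>m. m < n \<Longrightarrow> layer m \<subseteq> M" by blast
  have "layer 0 \<subseteq> M" using subspaceD(3)[OF right_sub_subspace[OF M]] by (simp add: layer_0)
  then obtain k where k: "n = Suc k" using n by (cases n) auto
  have kM: "layer k \<subseteq> M" using least k by simp
  have cov: "covers (layer (Suc k)) (layer k)" using layer_step[of k] n kM k by auto
  have "M \<subseteq> layer k"
  proof (rule ccontr)
    assume "\<not> M \<subseteq> layer k"
    then obtain x where x: "x \<in> M" "x \<notin> layer k" by blast
    then have xc: "x \<in> carrier C" using subspaceD(4)[OF right_sub_subspace[OF M]] by simp
    have "\<not> right_cyclic x \<subseteq> layer k" using right_cyclic(2)[OF xc] x(2) by blast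
    then obtain A where A: "covers A (layer k)" "A \<subseteq> subspace_sum (layer k) (right_cyclic x)"
      using covers_exists[OF right_sub_layer right_cyclic(1)[OF xc] cyclic_dims(1)[OF xc]] by blast
    have "subspace_sum (layer k) (right_cyclic x) \<subseteq> M"
      using vsum_is_minimal[OF right_sub_subspace[OF right_sub_layer] right_sub_subspace[OF right_cyclic(1)[OF xc]] right_sub_subspace[OF M]]
        kM right_cyclic_least[OF M x(1)] by blast
    then have AM: "A \<subseteq> M" using A(2) by blast
    have "A \<subseteq> layer (Suc k)" by (rule socle_aboveD(3)[OF socle_above_layer[OF right_sub_layer] A(1)])
    then have "A = layer (Suc k)" using coversD(4)[OF cov coversD(1,2)[OF A(1)]] coversD(3)[OF A(1)] by simp
    then show False using AM n k by simp
  qed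
  then show ?thesis using kM by blast
qed

lemma uniserial_chain:
  assumes M: "right_sub M" and N: "right_sub N"
  shows "M \<subseteq> N \<or> N \<subseteq> M"
proof -
  have "layer m \<subseteq> layer n \<or> layer n \<subseteq> layer m" for m n using layer_mono[of m n] layer_mono[of n m] by linarith
  then show ?thesis using right_sub_classification[OF M] right_sub_classification[OF N]
      subspaceD(2)[OF right_sub_subspace[OF M]] subspaceD(2)[OF right_sub_subspace[OF N]] by blast
qed

text \<open>Comparability with the previous layer makes a proper layer cyclic, generated by any of its new elements.\<close>

lemma layer_fin_dim: "sub_fin_dim K C (layer n)"
proof (induction n)
  case 0
  have "sub_fin_dim K C (span {})" by (rule sub_dim_span(1)[OF vectorspace_axioms]) (auto simp: lin_dep_def)
  then show ?case by (simp add: layer_0 span_empty)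
next
  case (Suc n)
  show ?case
  proof (cases "layer (Suc n) = layer n")
    case False
    then have cov: "covers (layer (Suc n)) (layer n)" using layer_step by blast
    then obtain x where x: "x \<in> layer (Suc n)" "x \<notin> layer n" by (auto simp: covers_def)
    then have xc: "x \<in> carrier C" using subspaceD(4)[OF right_sub_subspace[OF right_sub_layer]] by blast
    have "\<not> right_cyclic x \<subseteq> layer n" using right_cyclic(2)[OF xc] x(2) by blast
    then have "layer n \<subseteq> right_cyclic x" using uniserial_chain[OF right_cyclic(1)[OF xc] right_sub_layer] by blast
    moreover have "right_cyclic x \<subseteq> layer (Suc n)" by (rule right_cyclic_least[OF right_sub_layer x(1)])
    ultimately have "right_cyclic x = layer (Suc n)" using coversD(4)[OF cov right_cyclic(1)[OF xc]] right_cyclic(2)[OF xc] x(2) by auto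
    then show ?thesis using cyclic_dims(1)[OF xc] by simp
  qed (use Suc in simp)
qed

end

lemma right_chain_iff_uniserial: "right_chain_coalgebra K C \<Delta> \<epsilon> \<longleftrightarrow> uniserial_layers"
  using chain_imp_uniserial uniserial_chain coalgebra_axioms unfolding right_chain_coalgebra_def by blast

lemma layers_range: "{corad_filt K C \<Delta> \<epsilon> n | n. n \<ge> -1} = range layer"
proof (intro equalityI subsetI)
  fix X assume "X \<in> {corad_filt K C \<Delta> \<epsilon> n | n. n \<ge> -1}"
  then obtain n where n: "n \<ge> -1" "X = corad_filt K C \<Delta> \<epsilon> n" by blast
  then have "X = layer (nat (n + 1))" by (simp add: layer_def)
  then show "X \<in> range layer" by blast
next
  fix X assume "X \<in> range layer"
  then obtain m where "X = corad_filt K C \<Delta> \<epsilon> (int m - 1)" by (auto simp: layer_def)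
  moreover have "int m - 1 \<ge> -1" by simp
  ultimately show "X \<in> {corad_filt K C \<Delta> \<epsilon> n | n. n \<ge> -1}" by blast
qed

lemma right_sub_eq_layers:
  assumes "uniserial_layers"
  shows "{N. right_sub N} = insert (carrier C) (range layer)"
  using right_sub_classification[OF assms] right_sub_carrier right_sub_layer[OF assms] by auto

end

section \<open>The equivalence\<close>

theorem proposition2p2:
  fixes K :: "('k, 'r) ring_scheme" and C :: "('k, 'c, 'm) module_scheme"
    and \<Delta> :: "'c \<Rightarrow> ('c \<times> 'c \<Rightarrow> 'k) set" and \<epsilon> :: "'c \<Rightarrow> 'k"
  assumes "coalgebra K C \<Delta> \<epsilon>"
  shows "(right_chain_coalgebra K C \<Delta> \<epsilon>
            \<longleftrightarrow> (\<forall>n\<ge>-1. corad_factor_zero_or_simple K C \<Delta> \<epsilon> n))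
       \<and> ((\<forall>n\<ge>-1. corad_factor_zero_or_simple K C \<Delta> \<epsilon> n)
            \<longleftrightarrow> left_chain_coalgebra K C \<Delta> \<epsilon>)
       \<and> (right_chain_coalgebra K C \<Delta> \<epsilon> \<longrightarrow>
            {N. right_subcomodule K C \<Delta> \<epsilon> C \<Delta> N}
              = insert (carrier C) {corad_filt K C \<Delta> \<epsilon> n | n. n \<ge> -1}
          \<and> {N. left_subcomodule K C \<Delta> \<epsilon> C \<Delta> N}
              = insert (carrier C) {corad_filt K C \<Delta> \<epsilon> n | n. n \<ge> -1}
          \<and> {N. two_sided_subcomodule K C \<Delta> \<epsilon> N}
              = insert (carrier C) {corad_filt K C \<Delta> \<epsilon> n | n. n \<ge> -1}
          \<and> (\<forall>n\<ge>-1. vectorspace.fin_dim K (C\<lparr>carrier := corad_filt K C \<Delta> \<epsilon> n\<rparr>)))"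
proof -
  interpret coalgebra K C \<Delta> \<epsilon> by fact
  have iff: "right_chain_coalgebra K C \<Delta> \<epsilon> \<longleftrightarrow> (\<forall>n\<ge>-1. corad_factor_zero_or_simple K C \<Delta> \<epsilon> n)"
    by (simp add: right_chain_iff_uniserial factors_iff_uniserial)
  have sub: "{N. right_sub N} = insert (carrier C) {corad_filt K C \<Delta> \<epsilon> n | n. n \<ge> -1}"
    and agree: "\<And>N. right_sub N \<longleftrightarrow> left_sub N"
    and fd: "\<forall>n\<ge>-1. vectorspace.fin_dim K (C\<lparr>carrier := corad_filt K C \<Delta> \<epsilon> n\<rparr>)"
    if chain: "right_chain_coalgebra K C \<Delta> \<epsilon>"
  proof -
    have u: uniserial_layers using chain by (simp add: right_chain_iff_uniserial)
    show "{N. right_sub N} = insert (carrier C) {corad_filt K C \<Delta> \<epsilon> n | n. n \<ge> -1}"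
      unfolding layers_range by (rule right_sub_eq_layers[OF u])
    show "right_sub N \<longleftrightarrow> left_sub N" for N by (rule right_chain_agree) (rule uniserial_chain[OF u])
    show "\<forall>n\<ge>-1. vectorspace.fin_dim K (C\<lparr>carrier := corad_filt K C \<Delta> \<epsilon> n\<rparr>)"
      unfolding all_ge_neg1 using layer_fin_dim[OF u] by (simp add: sub_fin_dim_def layer_def)
  qed
  show ?thesis
  proof (intro conjI impI)
    assume chain: "right_chain_coalgebra K C \<Delta> \<epsilon>"
    show "{N. left_sub N} = insert (carrier C) {corad_filt K C \<Delta> \<epsilon> n | n. n \<ge> -1}"
      using sub[OF chain] by (simp add: agree[OF chain])
    show "{N. two_sided_subcomodule K C \<Delta> \<epsilon> N} = insert (carrier C) {corad_filt K C \<Delta> \<epsilon> n | n. n \<ge> -1}"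
      using sub[OF chain] agree[OF chain] by (simp add: two_sided_subcomodule_def)
  qed (use iff right_chain_iff_left_chain sub fd in blast)+
qed

end
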